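(* Let $\mathcal{H}^d$ be $d$-dimensional hyperbolic space of curvature $-1$ ($d\ge2$) with Riemannian volume measure $\nu$, let $p\in\mathcal{H}^d$ be a fixed point and for $\lambda\ge2$ let $W_\lambda=B(p,\lambda)\subset\mathcal{H}^d$ be the ball of radius $\lambda$. Let $\mathcal{P}_\lambda$ be a Poisson measure of intensity $\nu$ on $W_\lambda$. Fix $\rho>0$ and consider the random geometric graph on $\mathcal{P}_\lambda$ with parameter $\rho$, i.e. two points of $\mathcal{P}_\lambda$ are joined by an edge if they are at hyperbolic distance at most $\rho$. Let $H_\lambda$ be the number of isolated points (points of degree zero) of this graph. Let $N$ be a standard Gaussian random variable. Then there is a constant $C>0$ not depending on $\lambda$ such that for all $\lambda\ge2$ $$\mathbf{d}_K\Big(\frac{H_\lambda-\mathbb{E}H_\lambda}{\sqrt{\mathrm{Var}H_\lambda}},N\Big)\le C\,\frac{\nu(W_\lambda)^{1/2}}{\mathrm{Var}H_\lambda},\qquad \mathbf{d}_W\Big(\frac{H_\lambda-\mathbb{E}H_\lambda}{\sqrt{\mathrm{Var}H_\lambda}},N\Big)\le C\,\frac{\nu(W_\lambda)^{1/2}}{\mathrm{Var}H_\lambda}+C\,\frac{\nu(W_\lambda)}{(\mathrm{Var}H_\lambda)^{3/2}},$$ with $\nu(W_\lambda)\le\Gamma_d\,e^{(d-1)\lambda}$ for a constant $\Gamma_d>0$ depending only on $d$.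
   Context: $\mathbf{d}_K$ and $\mathbf{d}_W$ are the Kolmogorov distance $\sup_t|\mathbb{P}(X\le t)-\mathbb{P}(Y\le t)|$ and the Wasserstein distance $\sup_h|\mathbb{E}h(X)-\mathbb{E}h(Y)|$ over $1$-Lipschitz $h:\mathbb{R}\to\mathbb{R}$. *)

theory Defs
  imports "HOL-Probability.Probability"
begin

text \<open>
  Hyperbolic space of curvature \<open>-1\<close> and dimension \<open>d = DIM('a \<times> real) = DIM('a) + 1\<close> in the
  upper half-space model: points are pairs \<open>(x, t)\<close> with \<open>x\<close> in a Euclidean space of dimension
  \<open>d - 1\<close> and height \<open>t > 0\<close>; the Riemannian metric is \<open>(\<bar>dx\<bar>\<^sup>2 + dt\<^sup>2) / t\<^sup>2\<close>.
  As \<open>DIM('a) \<ge> 1\<close> for every Euclidean space, \<open>d\<close> ranges over all integers \<open>\<ge> 2\<close>.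
\<close>

definition hyp_space :: "('a::euclidean_space \<times> real) set" where
  "hyp_space = {p. snd p > 0}"

text \<open>Geodesic distance of the metric above. The norm on the product type is Euclidean.\<close>

definition hyp_dist :: "'a::euclidean_space \<times> real \<Rightarrow> 'a \<times> real \<Rightarrow> real" where
  "hyp_dist p q = arcosh (1 + (norm (p - q))\<^sup>2 / (2 * snd p * snd q))"

text \<open>The metric tensor at height \<open>t\<close> is \<open>t\<^sup>-\<^sup>2\<close> times the identity, so the square root of its
  determinant is \<open>t\<^sup>-\<^sup>d\<close>.\<close>

definition hyp_vol :: "('a::euclidean_space \<times> real) measure" where
  "hyp_vol = density (restrict_space lborel hyp_space)
     (\<lambda>p. ennreal (1 / snd p ^ DIM('a \<times> real)))"

definition hyp_ball :: "'a::euclidean_space \<times> real \<Rightarrow> real \<Rightarrow> ('a \<times> real) set" where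
  "hyp_ball p r = {q \<in> hyp_space. hyp_dist p q \<le> r}"

text \<open>
  A Poisson measure \<open>P\<close>, defined on the probability space \<open>M\<close>, with finite intensity measure \<open>\<nu>\<close>.
  Since \<open>\<nu>\<close> is finite, a realisation is a finite set of points; it is a set (no multiplicities), so
  the notion is meant for diffuse \<open>\<nu>\<close>. The Poisson weights are written out because
  \<open>poisson_pmf\<close> is not specified for rate \<open>0\<close>; for \<open>emeasure \<nu> A = 0\<close> the formula gives mass \<open>1\<close> to
  \<open>k = 0\<close>, as \<open>0 ^ 0 = 1\<close>.
\<close>

definition poisson_measure :: "'w measure \<Rightarrow> 'b measure \<Rightarrow> ('w \<Rightarrow> 'b set) \<Rightarrow> bool" where
  "poisson_measure M \<nu> P \<longleftrightarrow>
     prob_space M \<and> finite_measure \<nu> \<and>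
     (\<forall>\<omega>\<in>space M. finite (P \<omega>) \<and> P \<omega> \<subseteq> space \<nu>) \<and>
     (\<forall>A\<in>sets \<nu>.
        (\<lambda>\<omega>. card (P \<omega> \<inter> A)) \<in> measurable M (count_space UNIV) \<and>
        (\<forall>k. measure M {\<omega> \<in> space M. card (P \<omega> \<inter> A) = k} =
             measure \<nu> A ^ k / fact k * exp (- measure \<nu> A))) \<and>
     (\<forall>A :: nat \<Rightarrow> 'b set. range A \<subseteq> sets \<nu> \<longrightarrow> disjoint_family A \<longrightarrow>
        prob_space.indep_vars M (\<lambda>_. count_space UNIV) (\<lambda>i \<omega>. card (P \<omega> \<inter> A i)) UNIV)"

definition rgg_adj :: "real \<Rightarrow> 'a::euclidean_space \<times> real \<Rightarrow> 'a \<times> real \<Rightarrow> bool" where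
  "rgg_adj \<rho> x y \<longleftrightarrow> x \<noteq> y \<and> hyp_dist x y \<le> \<rho>"

definition rgg_degree ::
    "real \<Rightarrow> ('a::euclidean_space \<times> real) set \<Rightarrow> 'a \<times> real \<Rightarrow> nat" where
  "rgg_degree \<rho> V x = card {y \<in> V. rgg_adj \<rho> x y}"

definition isolated_count :: "real \<Rightarrow> ('a::euclidean_space \<times> real) set \<Rightarrow> real" where
  "isolated_count \<rho> V = real (card {x \<in> V. rgg_degree \<rho> V x = 0})"

text \<open>
  Distances between laws on the real line. The Wasserstein distance takes values in \<open>[0, \<infinity>]\<close>; it is
  meant for laws with finite first moment, for which every Lipschitz function is integrable.
\<close>

definition kolmogorov_dist :: "real measure \<Rightarrow> real measure \<Rightarrow> real" where
  "kolmogorov_dist \<mu> \<nu> = (SUP t. \<bar>measure \<mu> {..t} - measure \<nu> {..t}\<bar>)"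

definition wasserstein_dist :: "real measure \<Rightarrow> real measure \<Rightarrow> ennreal" where
  "wasserstein_dist \<mu> \<nu> =
     (SUP h \<in> {h :: real \<Rightarrow> real. 1-lipschitz_on UNIV h}.
        ennreal \<bar>(\<integral>x. h x \<partial>\<mu>) - (\<integral>x. h x \<partial>\<nu>)\<bar>)"

definition standardized_law :: "'w measure \<Rightarrow> ('w \<Rightarrow> real) \<Rightarrow> real measure" where
  "standardized_law M X =
     distr M borel
       (\<lambda>\<omega>. (X \<omega> - prob_space.expectation M X) / sqrt (prob_space.variance M X))"

end

theory Submission
  imports Defs "HOL-Real_Asymp.Real_Asymp"
begin

text \<open>
  Fix a maximal \<open>\<rho>/4\<close>-separated set of centres in the ball and cut the ball into finitely many cells of
  small diameter, each attached to a nearby centre. Counting the cells that contain exactly one point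
  while all cells within distance \<open>\<rho>\<close> are empty gives a sum over the centres of random variables with
  values in \<open>{0, 1}\<close> whose dependency graph has bounded degree, by packing. When the mesh tends to \<open>0\<close>
  this sum is eventually equal to the number of isolated points.

  For such sums the bounds come from Stein's method. As \<open>f' = h - \<integral>h dN + w f\<close>, bounds on \<open>f\<close> and \<open>f'\<close>
  alone control the increments of \<open>f'\<close> by those of \<open>h\<close>, and all partial sums over neighbourhoods are
  bounded. For the Kolmogorov distance the indicator is smoothed at scale \<open>\<theta>/\<sigma>\<close>, and for \<open>\<theta>\<close> large the
  resulting inequality for the distance can be solved. Both distances are of order \<open>1/\<sigma>\<close>, which suffices
  because the variance is of the order of the volume. The lower bound for the variance is the
  Cauchy-Schwarz inequality with the sum of the variables \<open>1\<^sub>E (1\<^sub>F - P(F))\<close> over the centres, where \<open>F\<close> says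
  that there is exactly one point in the cells of the centre and \<open>E\<close> that there is none in the cells of
  the neighbouring centres.
\<close>

section \<open>Stein's equation\<close>

text \<open>Two scales are kept apart. The mesh of the cells tends to 0, but the constants must not
  depend on it; therefore the summands belong to centres and not to cells. The number of neighbours
  of a centre is bounded by a packing number \<open>d\<close>, the volume attached to it by
  \<open>K\<close>, and by homogeneity of the space both depend on \<open>\<rho>\<close> and the
  dimension only. Smoothing an indicator at a scale of order 1/\<sigma> has to be paid for by a
  bound on the probability that the sum falls into a short interval. The remainder of Stein's
  expansion is estimated pointwise by a function of the sum itself, since the absolute values of the
  centred summands add up to at most \<open>S + 2 * n\<close>. Hence only the law of the full sum
  occurs, and the probability of a short interval is at most its Gaussian value plus twice the
  distance to be estimated. All sums over centres carry the weights \<open>p i\<close>, whose total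
  is at most the volume \<open>n\<close>; the number of centres enters no error term.\<close>

abbreviation (input) gauss :: "real \<Rightarrow> real" where "gauss \<equiv> std_normal_density"

lemma antiderivative_vanishing_at_bot:
  fixes k :: "real \<Rightarrow> real"
  assumes cont: "continuous_on UNIV k" and int: "integrable lborel k"
  obtains F where "\<And>x. (F has_real_derivative k x) (at x)"
    "(F \<longlongrightarrow> 0) at_bot" "(F \<longlongrightarrow> integral\<^sup>L lborel k) at_top"
proof -
  have "\<exists>F. \<forall>x :: real. -\<infinity> < ereal x \<longrightarrow> ereal x < \<infinity> \<longrightarrow> (F has_vector_derivative k x) (at x)"
    by (rule einterval_antiderivative) (use cont in \<open>auto simp: continuous_on_eq_continuous_at\<close>)
  then obtain F where F: "\<And>x. (F has_vector_derivative k x) (at x)" by auto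
  have si: "set_integrable lborel A k" if "A \<in> sets borel" for A
    using int that by (intro integrable_mult_indicator set_integrable_subset[where A=UNIV and B=A])
       (auto simp: set_integrable_def)
  have ftc: "(LINT x:{a..b}|lborel. k x) = F b - F a" if "a \<le> b" for a b
  proof -
    have "(LBINT x. indicator {a..b} x *\<^sub>R k x) = F b - F a"
      using that F cont
      by (intro integral_FTC_Icc) 
         (auto intro: has_vector_derivative_at_within continuous_on_subset)
    then show ?thesis by (simp add: set_lebesgue_integral_def)
  qed
  define L where "L = F 0 - (LINT x:{..0}|lborel. k x)"
  define U where "U = F 0 + (LINT x:{0..}|lborel. k x)"
  have top: "(F \<longlongrightarrow> U) at_top"
  proof -
    have "((\<lambda>b. F 0 + (LINT x:{0..b}|lborel. k x)) \<longlongrightarrow> U) at_top"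
      unfolding U_def by (intro tendsto_intros tendsto_set_lebesgue_integral_at_top si) auto
    moreover have "\<forall>\<^sub>F b in at_top. F 0 + (LINT x:{0..b}|lborel. k x) = F b"
      using eventually_ge_at_top[of 0] by eventually_elim (simp add: ftc)
    ultimately show ?thesis by (rule Lim_transform_eventually)
  qed
  have bot: "(F \<longlongrightarrow> L) at_bot"
  proof -
    have "((\<lambda>b. F 0 - (LINT x:{b..0}|lborel. k x)) \<longlongrightarrow> L) at_bot"
      unfolding L_def by (intro tendsto_intros tendsto_set_lebesgue_integral_at_bot si) auto
    moreover have "\<forall>\<^sub>F b in at_bot. F 0 - (LINT x:{b..0}|lborel. k x) = F b"
      using eventually_le_at_bot[of 0] by eventually_elim (simp add: ftc)
    ultimately show ?thesis by (rule Lim_transform_eventually)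
  qed
  have "integral\<^sup>L lborel k = (LINT x:{..0} \<union> {0<..}|lborel. k x)"
    by (auto simp: set_lebesgue_integral_def intro!: Bochner_Integration.integral_cong
        split: split_indicator)
  also have "\<dots> = (LINT x:{..0}|lborel. k x) + (LINT x:{0<..}|lborel. k x)"
    by (rule set_integral_Un) (auto intro!: si)
  also have "(LINT x:{0<..}|lborel. k x) = (LINT x:{0..}|lborel. k x)"
  proof -
    have "AE x in lborel. x \<noteq> (0::real)" by (rule AE_lborel_singleton)
    then show ?thesis unfolding set_lebesgue_integral_def
      using si[of "{0<..}"] si[of "{0..}"]
      by (intro integral_cong_AE) (auto simp: set_integrable_def split: split_indicator)
  qed
  finally have UL: "integral\<^sup>L lborel k = U - L" by (simp add: U_def L_def)
  show ?thesis
  proof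
    show "((\<lambda>x. F x - L) has_real_derivative k x) (at x)" for x
      using F[of x] by (auto intro!: derivative_eq_intros simp: has_real_derivative_iff_has_vector_derivative[symmetric])
    show "((\<lambda>x. F x - L) \<longlongrightarrow> 0) at_bot" using tendsto_diff[OF bot tendsto_const[of L]] by simp
    show "((\<lambda>x. F x - L) \<longlongrightarrow> integral\<^sup>L lborel k) at_top"
      unfolding UL by (intro tendsto_intros top)
  qed
qed

lemma nonneg_if_decreasing_to_0:
  fixes F :: "real \<Rightarrow> real"
  assumes der: "\<And>x. a \<le> x \<Longrightarrow> (F has_real_derivative F' x) (at x)"
    and le: "\<And>x. a \<le> x \<Longrightarrow> F' x \<le> 0" and lim: "(F \<longlongrightarrow> 0) at_top"
  shows "0 \<le> F a"
proof -
  have "F x \<le> F a" if "a \<le> x" for x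
    using that by (rule DERIV_nonpos_imp_nonincreasing) (use der le in blast)
  then have "\<forall>\<^sub>F x in at_top. F x \<le> F a"
    using eventually_ge_at_top[of a] by (rule eventually_mono[rotated])
  with lim show ?thesis by (rule tendsto_upperbound) simp
qed

text \<open>Both \<open>B - G\<close> and \<open>B + G\<close> decrease to 0, so they are
  nonnegative. Every Gaussian tail estimate below consists of guessing an explicit majorant
  \<open>B\<close> and comparing derivatives.\<close>

lemma abs_le_if_derivative_dominated:
  fixes G B :: "real \<Rightarrow> real"
  assumes G: "\<And>x. a \<le> x \<Longrightarrow> (G has_real_derivative G' x) (at x)"
    and B: "\<And>x. a \<le> x \<Longrightarrow> (B has_real_derivative B' x) (at x)"
    and le: "\<And>x. a \<le> x \<Longrightarrow> \<bar>G' x\<bar> \<le> - B' x"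
    and lim: "(G \<longlongrightarrow> 0) at_top" "(B \<longlongrightarrow> 0) at_top"
  shows "\<bar>G a\<bar> \<le> B a"
proof -
  have "0 \<le> B a - G a"
  proof (rule nonneg_if_decreasing_to_0[where F="\<lambda>x. B x - G x" and F'="\<lambda>x. B' x - G' x"])
    fix x assume "a \<le> x"
    then show "((\<lambda>x. B x - G x) has_real_derivative B' x - G' x) (at x)" "B' x - G' x \<le> 0"
      using le[of x] by (auto intro!: derivative_intros G B)
  next
    show "((\<lambda>x. B x - G x) \<longlongrightarrow> 0) at_top" using tendsto_diff[OF lim(2,1)] by simp
  qed
  moreover have "0 \<le> B a + G a"
  proof (rule nonneg_if_decreasing_to_0[where F="\<lambda>x. B x + G x" and F'="\<lambda>x. B' x + G' x"])
    fix x assume "a \<le> x"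
    then show "((\<lambda>x. B x + G x) has_real_derivative B' x + G' x) (at x)" "B' x + G' x \<le> 0"
      using le[of x] by (auto intro!: derivative_intros G B)
  next
    show "((\<lambda>x. B x + G x) \<longlongrightarrow> 0) at_top" using tendsto_add[OF lim(2,1)] by simp
  qed
  ultimately show ?thesis by linarith
qed

lemma gauss_pos: "0 < gauss x" by (simp add: normal_density_pos)

lemma gauss_even: "gauss (- x) = gauss x" by (simp add: normal_density_def)

lemma gauss_has_derivative [derivative_intros]:
  "(gauss has_real_derivative (- x * gauss x)) (at x)"
  unfolding std_normal_density_def[abs_def]
  by (auto intro!: derivative_eq_intros simp: field_simps)

lemma gauss_tendsto_0: "(gauss \<longlongrightarrow> 0) at_top"
  unfolding std_normal_density_def[abs_def] by real_asymp

section \<open>Gaussian tails: \<open>G\<close> is the integral of \<open>g\<close> times the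
  density from the argument to infinity\<close>

context
  fixes g G :: "real \<Rightarrow> real"
  assumes G: "\<And>x. 0 \<le> x \<Longrightarrow> (G has_real_derivative - g x * gauss x) (at x)"
    and G_lim: "(G \<longlongrightarrow> 0) at_top"
begin

text \<open>The majorant is a Mills ratio bound; its derivative condition is (1 + x)^2 \<le> 2 (x (1
  + x) + 1). The denominator \<open>1 + w\<close> is what later keeps \<open>w * G w\<close> bounded
  by a multiple of the density.\<close>

lemma gauss_tail_bounded:
  assumes g: "\<And>x. \<bar>g x\<bar> \<le> 1" and w: "0 \<le> w"
  shows "\<bar>G w\<bar> \<le> 2 * gauss w / (1 + w)"
proof (rule abs_le_if_derivative_dominated[where G=G and a=w])
  show "(G has_real_derivative - g x * gauss x) (at x)" if "w \<le> x" for x using that w G by simp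
  show "((\<lambda>x. 2 * gauss x / (1 + x)) has_real_derivative
      2 * (- x * gauss x * (1 + x) - gauss x) / (1 + x)\<^sup>2) (at x)" if "w \<le> x" for x
    using that w by (auto intro!: derivative_eq_intros simp: field_simps power2_eq_square)
  show "\<bar>- g x * gauss x\<bar> \<le> - (2 * (- x * gauss x * (1 + x) - gauss x) / (1 + x)\<^sup>2)" if "w \<le> x" for x
  proof -
    have x: "0 \<le> x" using that w by simp
    have "\<bar>- g x * gauss x\<bar> \<le> 1 * gauss x"
      unfolding abs_mult using g[of x] gauss_pos[of x] by (intro mult_mono) auto
    also have "\<dots> \<le> 2 * (x * (1 + x) + 1) / (1 + x)\<^sup>2 * gauss x"
    proof (intro mult_right_mono)
      have "(1 + x)\<^sup>2 \<le> 2 * (x * (1 + x) + 1)"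
        using x by (simp add: power2_eq_square algebra_simps)
      then show "1 \<le> 2 * (x * (1 + x) + 1) / (1 + x)\<^sup>2" using x by simp
    qed (use gauss_pos[of x] in simp)
    also have "\<dots> = - (2 * (- x * gauss x * (1 + x) - gauss x) / (1 + x)\<^sup>2)"
      unfolding minus_divide_left by (simp add: algebra_simps)
    finally show ?thesis .
  qed
  show "((\<lambda>x. 2 * gauss x / (1 + x)) \<longlongrightarrow> 0) at_top"
    unfolding std_normal_density_def[abs_def] by real_asymp
qed (rule G_lim)

text \<open>The linear part of \<open>g\<close> integrates against the density to the density
  itself; the term \<open>1 / (1 + w)\<close> of the majorant absorbs the constant part.\<close>

lemma gauss_tail_linear:
  assumes g: "\<And>x. \<bar>g x\<bar> \<le> 1 + \<bar>x\<bar>" and w: "0 \<le> w"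
  shows "\<bar>G w\<bar> \<le> 4 * gauss w"
proof -
  have "\<bar>G w\<bar> \<le> 2 * (gauss w * (1 + 1 / (1 + w)))"
  proof (rule abs_le_if_derivative_dominated[where G=G and a=w])
    show "(G has_real_derivative - g x * gauss x) (at x)" if "w \<le> x" for x using that w G by simp
    show "((\<lambda>x. 2 * (gauss x * (1 + 1 / (1 + x)))) has_real_derivative
        2 * (- x * gauss x * (1 + 1 / (1 + x)) - gauss x / (1 + x)\<^sup>2)) (at x)" if "w \<le> x" for x
    proof -
      have "1 + x \<noteq> 0" using that w by simp
      then have "((\<lambda>x. 1 + 1 / (1 + x)) has_real_derivative - 1 / (1 + x)\<^sup>2) (at x)"
        by (auto intro!: derivative_eq_intros simp: power2_eq_square)
      from DERIV_cmult[OF DERIV_mult[OF gauss_has_derivative this], of 2] show ?thesis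
        by (simp add: algebra_simps)
    qed
    show "\<bar>- g x * gauss x\<bar> \<le> - (2 * (- x * gauss x * (1 + 1 / (1 + x)) - gauss x / (1 + x)\<^sup>2))"
      if "w \<le> x" for x
    proof -
      have x: "0 \<le> x" using that w by simp
      have "\<bar>- g x * gauss x\<bar> \<le> (1 + x) * gauss x"
        unfolding abs_mult using g[of x] gauss_pos[of x] x by (intro mult_mono) auto
      also have "\<dots> \<le> 2 * (x * (1 + 1 / (1 + x)) + 1 / (1 + x)\<^sup>2) * gauss x"
      proof (intro mult_right_mono)
        have eq: "x * (1 + 1 / (1 + x)) + 1 / (1 + x)\<^sup>2 = x + (x * (1 + x) + 1) / (1 + x)\<^sup>2"
          using x by (simp add: divide_simps power2_eq_square) (simp add: algebra_simps)
        have "(1 + x)\<^sup>2 \<le> 2 * (x * (1 + x) + 1)"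
          using x by (simp add: power2_eq_square algebra_simps)
        then have "1 / 2 \<le> (x * (1 + x) + 1) / (1 + x)\<^sup>2"
          using x by (simp add: le_divide_eq)
        then show "1 + x \<le> 2 * (x * (1 + 1 / (1 + x)) + 1 / (1 + x)\<^sup>2)"
          unfolding eq using x by (simp only: distrib_left)
      qed (use gauss_pos[of x] in simp)
      finally show ?thesis by (simp add: algebra_simps)
    qed
    show "((\<lambda>x. 2 * (gauss x * (1 + 1 / (1 + x)))) \<longlongrightarrow> 0) at_top"
      unfolding std_normal_density_def[abs_def] by real_asymp
  qed (rule G_lim)
  also have "\<dots> \<le> 2 * (gauss w * 2)"
    using w gauss_pos[of w] by (intro mult_left_mono) (auto simp: divide_simps)
  finally show ?thesis by simp
qed

text \<open>Compares the tail of \<open>g\<close> with the tail of the constant \<open>g w\<close>: the comparison function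
  \<open>(x - w + 1) / (x + 1)\<close> times the density dominates the tail of \<open>x - w\<close>.\<close>

lemma gauss_tail_lipschitz:
  assumes lip: "\<And>x y. \<bar>g x - g y\<bar> \<le> \<bar>x - y\<bar>" and g: "\<And>x. \<bar>g x\<bar> \<le> 1 + \<bar>x\<bar>"
    and w: "0 \<le> w"
    and T: "\<And>x. (T has_real_derivative - gauss x) (at x)" and T_lim: "(T \<longlongrightarrow> 0) at_top"
  shows "\<bar>g w * gauss w - w * G w\<bar> \<le> 2 * gauss w"
proof -
  let ?B = "\<lambda>x. gauss x * ((x - w + 1) / (x + 1))"
  let ?B' = "\<lambda>x. - x * gauss x * ((x - w + 1) / (x + 1)) + gauss x * (w / (x + 1)\<^sup>2)"
  have dB: "(?B has_real_derivative ?B' x) (at x)" if "w \<le> x" for x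
  proof -
    have "x + 1 \<noteq> 0" using that w by simp
    then have "((\<lambda>x. (x - w + 1) / (x + 1)) has_real_derivative w / (x + 1)\<^sup>2) (at x)"
      by (auto intro!: derivative_eq_intros simp: power2_eq_square)
    from DERIV_mult[OF gauss_has_derivative this] show ?thesis
      by (simp add: algebra_simps)
  qed
  have key: "(x - w) * gauss x \<le> - ?B' x" if "w \<le> x" for x
  proof -
    have "(x - w) \<le> x * ((x - w + 1) / (x + 1)) - w / (x + 1)\<^sup>2"
    proof -
      have "x * ((x - w + 1) / (x + 1)) - w / (x + 1)\<^sup>2 - (x - w)
          = ((x + 1) * w - w) / (x + 1)\<^sup>2"
        using that w by (simp add: divide_simps power2_eq_square) (simp add: algebra_simps)
      moreover have "0 \<le> ((x + 1) * w - w) / (x + 1)\<^sup>2"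
        using that w by (auto simp: algebra_simps)
      ultimately show ?thesis by linarith
    qed
    from mult_right_mono[OF this, of "gauss x"] gauss_pos[of x]
    have "(x - w) * gauss x \<le> (x * ((x - w + 1) / (x + 1)) - w / (x + 1)\<^sup>2) * gauss x" by simp
    also have "\<dots> = - ?B' x" unfolding left_diff_distrib by (simp add: mult_ac)
    finally show ?thesis .
  qed
  have B_lim: "(?B \<longlongrightarrow> 0) at_top"
    unfolding std_normal_density_def[abs_def] by real_asymp
  have 1: "\<bar>G w - g w * T w\<bar> \<le> ?B w"
  proof (rule abs_le_if_derivative_dominated[where G="\<lambda>x. G x - g w * T x", OF _ dB])
    show "((\<lambda>x. G x - g w * T x) has_real_derivative - (g x - g w) * gauss x) (at x)"
      if "w \<le> x" for x
      using that w by (auto intro!: derivative_eq_intros G T simp: algebra_simps)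
    show "\<bar>- (g x - g w) * gauss x\<bar> \<le> - ?B' x" if "w \<le> x" for x
    proof -
      have "\<bar>- (g x - g w) * gauss x\<bar> = \<bar>g x - g w\<bar> * gauss x"
        using gauss_pos[of x] by (simp add: abs_mult)
      also have "\<dots> \<le> (x - w) * gauss x"
        using lip[of x w] that gauss_pos[of x] by (intro mult_right_mono) auto
      finally show ?thesis using key[OF that] by linarith
    qed
    show "((\<lambda>x. G x - g w * T x) \<longlongrightarrow> 0) at_top"
      using tendsto_diff[OF G_lim tendsto_mult_left[OF T_lim, of "g w"]] by simp
  qed (assumption | rule B_lim)+
  have 2: "\<bar>gauss w - w * T w\<bar> \<le> ?B w"
  proof (rule abs_le_if_derivative_dominated[where G="\<lambda>x. gauss x - w * T x", OF _ dB])
    show "((\<lambda>x. gauss x - w * T x) has_real_derivative - (x - w) * gauss x) (at x)" for x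
      by (auto intro!: derivative_eq_intros T simp: algebra_simps)
    show "\<bar>- (x - w) * gauss x\<bar> \<le> - ?B' x" if "w \<le> x" for x
    proof -
      have "\<bar>- (x - w) * gauss x\<bar> = (x - w) * gauss x"
        using gauss_pos[of x] that by (simp add: abs_mult)
      then show ?thesis using key[OF that] by linarith
    qed
    show "((\<lambda>x. gauss x - w * T x) \<longlongrightarrow> 0) at_top"
      using tendsto_diff[OF gauss_tendsto_0 tendsto_mult_left[OF T_lim, of w]] by simp
  qed (assumption | rule B_lim)+
  \<comment> \<open>The value \<open>g w\<close> may be as large as \<open>1 + w\<close>. Each
    bracket is at most \<open>?B w\<close>, which equals \<open>gauss w / (1 + w)\<close> and thus
    beats the factors \<open>1 + w\<close> and \<open>w\<close>.\<close>
  have "g w * gauss w - w * G w = g w * (gauss w - w * T w) - w * (G w - g w * T w)"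
    by (simp add: algebra_simps)
  also have "\<bar>\<dots>\<bar> \<le> \<bar>g w\<bar> * \<bar>gauss w - w * T w\<bar> + w * \<bar>G w - g w * T w\<bar>"
    using w abs_triangle_ineq4[of "g w * (gauss w - w * T w)" "w * (G w - g w * T w)"]
    by (simp add: abs_mult)
  also have "\<dots> \<le> (1 + w) * ?B w + w * ?B w"
    using g[of w] w 1 2 by (intro add_mono mult_mono) auto
  also have "\<dots> = gauss w * (1 + w / (1 + w))"
  proof -
    have "(1 + w) * ?B w = gauss w" using w by (simp add: add.commute)
    then show ?thesis using w by (simp add: algebra_simps)
  qed
  also have "\<dots> \<le> gauss w * (1 + 1)"
    using w gauss_pos[of w] by (intro mult_left_mono add_left_mono) auto
  finally show ?thesis by simp
qed

text \<open>The solution of Stein's equation will be \<open>- G / gauss\<close>, and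
  \<open>g w * gauss w - w * G w\<close> is its derivative times the density. So these are the
  bounds on the solution and on its derivative, with a common constant 4 for bounded and for
  Lipschitz data.\<close>

lemma gauss_tail_bounds:
  assumes g: "(\<forall>x. \<bar>g x\<bar> \<le> 1) \<or> (\<forall>x y. \<bar>g x - g y\<bar> \<le> \<bar>x - y\<bar>) \<and> (\<forall>x. \<bar>g x\<bar> \<le> 1 + \<bar>x\<bar>)"
    and w: "0 \<le> w"
  shows "\<bar>G w\<bar> \<le> 4 * gauss w" "\<bar>g w * gauss w - w * G w\<bar> \<le> 4 * gauss w"
proof -
  have "\<bar>G w\<bar> \<le> 4 * gauss w \<and> \<bar>g w * gauss w - w * G w\<bar> \<le> 4 * gauss w"
    using g
  proof (elim disjE conjE)
    assume *: "\<forall>x. \<bar>g x\<bar> \<le> 1"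
    then have G: "\<bar>G w\<bar> \<le> 2 * gauss w / (1 + w)" using w by (intro gauss_tail_bounded) auto
    also have "\<dots> \<le> 2 * gauss w" using w gauss_pos[of w] by (simp add: field_simps)
    finally have 1: "\<bar>G w\<bar> \<le> 2 * gauss w" .
    have "\<bar>g w * gauss w - w * G w\<bar> \<le> \<bar>g w\<bar> * gauss w + w * \<bar>G w\<bar>"
      using w gauss_pos[of w] abs_triangle_ineq4[of "g w * gauss w" "w * G w"]
      by (simp add: abs_mult)
    also have "\<dots> \<le> 1 * gauss w + w * (2 * gauss w / (1 + w))"
      using * w gauss_pos[of w] G by (intro add_mono mult_right_mono mult_left_mono) auto
    also have "\<dots> = gauss w * (1 + 2 * (w / (1 + w)))" by (simp add: algebra_simps)
    also have "\<dots> \<le> gauss w * (1 + 2 * 1)"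
      using w gauss_pos[of w] by (intro mult_left_mono add_left_mono) auto
    finally show ?thesis using 1 gauss_pos[of w] by simp
  next
    assume *: "\<forall>x y. \<bar>g x - g y\<bar> \<le> \<bar>x - y\<bar>" "\<forall>x. \<bar>g x\<bar> \<le> 1 + \<bar>x\<bar>"
    obtain T where T: "\<And>x. (T has_real_derivative gauss x) (at x)"
      "(T \<longlongrightarrow> integral\<^sup>L lborel gauss) at_top"
    proof (rule antiderivative_vanishing_at_bot[of gauss])
      show "continuous_on UNIV gauss"
        by (auto simp: continuous_on_eq_continuous_at intro: DERIV_isCont gauss_has_derivative)
    qed auto
    have "\<bar>g w * gauss w - w * G w\<bar> \<le> 2 * gauss w"
    proof (rule gauss_tail_lipschitz)
      show "((\<lambda>x. 1 - T x) has_real_derivative - gauss x) (at x)" for x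
        by (auto intro!: derivative_eq_intros T)
      show "((\<lambda>x. 1 - T x) \<longlongrightarrow> 0) at_top" using tendsto_diff[OF tendsto_const T(2), of 1] by simp
    qed (use * w in auto)
    then show ?thesis using gauss_tail_linear[of w] * w gauss_pos[of w] by auto
  qed
  then show "\<bar>G w\<bar> \<le> 4 * gauss w" "\<bar>g w * gauss w - w * G w\<bar> \<le> 4 * gauss w" by auto
qed

end

section \<open>Bounded solutions of Stein's equation\<close>

lemma stein_equation_solution:
  fixes g :: "real \<Rightarrow> real"
  assumes cont: "continuous_on UNIV g"
    and g: "(\<forall>x. \<bar>g x\<bar> \<le> 1) \<or> (\<forall>x y. \<bar>g x - g y\<bar> \<le> \<bar>x - y\<bar>) \<and> (\<forall>x. \<bar>g x\<bar> \<le> 1 + \<bar>x\<bar>)"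
    and int: "integrable lborel (\<lambda>x. gauss x * g x)" and zero: "(\<integral>x. gauss x * g x \<partial>lborel) = 0"
  obtains f where "\<And>x. (f has_real_derivative x * f x + g x) (at x)"
    "\<And>x. \<bar>f x\<bar> \<le> 4" "\<And>x. \<bar>x * f x + g x\<bar> \<le> 4"
proof -
  have gauss_cont: "continuous_on UNIV gauss"
    by (auto simp: continuous_on_eq_continuous_at intro: DERIV_isCont gauss_has_derivative)
  \<comment> \<open>Since \<open>gauss * g\<close> has integral 0, its antiderivative vanishes at
    both ends. So \<open>F\<close> is at once minus the right tail and equal to the left tail, and
    each half-line can be treated by tail bounds.\<close>
  obtain F where F: "\<And>x. (F has_real_derivative gauss x * g x) (at x)"
    "(F \<longlongrightarrow> 0) at_bot" "(F \<longlongrightarrow> 0) at_top"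
    using antiderivative_vanishing_at_bot[OF _ int] cont gauss_cont zero
    by (metis continuous_on_mult)
  have "\<bar>F x\<bar> \<le> 4 * gauss x \<and> \<bar>g x * gauss x + x * F x\<bar> \<le> 4 * gauss x" for x
  proof (cases "0 \<le> x")
    case True
    have "((\<lambda>x. - F x) has_real_derivative - g x * gauss x) (at x)" for x
      using DERIV_minus[OF F(1)[of x]] by (simp add: mult.commute)
    from gauss_tail_bounds[OF this _ g True] tendsto_minus[OF F(3)] show ?thesis by simp
  next
    case False
    \<comment> \<open>For negative arguments the left tail of \<open>g\<close> is the right tail of
      the reflected function, which satisfies the same hypotheses.\<close>
    let ?g = "\<lambda>x. g (- x)"
    have d: "((\<lambda>x. F (- x)) has_real_derivative - ?g x * gauss x) (at x)" for x
      using DERIV_chain2[OF F(1)[of "- x"] DERIV_minus[OF DERIV_ident]]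
      by (simp add: gauss_even mult.commute)
    have g': "(\<forall>x. \<bar>?g x\<bar> \<le> 1) \<or> (\<forall>x y. \<bar>?g x - ?g y\<bar> \<le> \<bar>x - y\<bar>) \<and> (\<forall>x. \<bar>?g x\<bar> \<le> 1 + \<bar>x\<bar>)"
      using g
    proof (elim disjE conjE)
      assume *: "\<forall>x y. \<bar>g x - g y\<bar> \<le> \<bar>x - y\<bar>" "\<forall>x. \<bar>g x\<bar> \<le> 1 + \<bar>x\<bar>"
      have "\<bar>?g x - ?g y\<bar> \<le> \<bar>x - y\<bar>" for x y using *(1)[rule_format, of "-x" "-y"] by (simp add: abs_minus_commute)
      moreover have "\<bar>?g x\<bar> \<le> 1 + \<bar>x\<bar>" for x using *(2)[rule_format, of "-x"] by simp
      ultimately show ?thesis by blast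
    qed blast
    have lim: "((\<lambda>x. F (- x)) \<longlongrightarrow> 0) at_top"
      using F(2) by (simp add: filterlim_at_bot_mirror)
    from gauss_tail_bounds[OF d lim g', of "- x"] False show ?thesis
      by (simp add: gauss_even)
  qed
  then have *: "\<bar>F x\<bar> \<le> 4 * gauss x" "\<bar>g x * gauss x + x * F x\<bar> \<le> 4 * gauss x" for x by blast+
  let ?f = "\<lambda>x. F x / gauss x"
  show ?thesis
  proof
    fix x
    show "(?f has_real_derivative x * ?f x + g x) (at x)"
      using gauss_pos[of x]
      by (auto intro!: derivative_eq_intros F(1) simp: divide_simps algebra_simps)
    show "\<bar>?f x\<bar> \<le> 4" using *(1)[of x] gauss_pos[of x] by (simp add: field_simps)
    have "x * ?f x + g x = (g x * gauss x + x * F x) / gauss x"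
      using gauss_pos[of x] by (simp add: field_simps)
    then show "\<bar>x * ?f x + g x\<bar> \<le> 4" using *(2)[of x] gauss_pos[of x] by (simp add: field_simps)
  qed
qed

lemma integral_std_normal:
  assumes [measurable]: "h \<in> borel_measurable borel"
  shows "(\<integral>x. h x \<partial>std_normal_distribution) = (\<integral>x. gauss x * h x \<partial>lborel)"
  by (subst integral_density) (auto simp: )

text \<open>Subtracting the Gaussian mean \<open>c\<close> makes the integral vanish. Values of
  \<open>h\<close> in the unit interval give \<bar>h - c\<bar> \<le> 1; a Lipschitz \<open>h\<close>
  deviates from \<open>c\<close> at \<open>y\<close> by at most \<bar>y\<bar> plus the first
  absolute Gaussian moment. These are the two cases of the tail bounds.\<close>

lemma stein_solution:
  fixes h :: "real \<Rightarrow> real"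
  defines "c \<equiv> \<integral>x. h x \<partial>std_normal_distribution"
  assumes cont: "continuous_on UNIV h"
    and h: "(\<forall>x. 0 \<le> h x \<and> h x \<le> 1) \<or> (\<forall>x y. \<bar>h x - h y\<bar> \<le> \<bar>x - y\<bar>)"
  obtains f where "\<And>x. (f has_real_derivative x * f x + (h x - c)) (at x)"
    "\<And>x. \<bar>f x\<bar> \<le> 4" "\<And>x. \<bar>x * f x + (h x - c)\<bar> \<le> 4"
proof -
  have [measurable]: "h \<in> borel_measurable borel" using cont by (rule borel_measurable_continuous_onI)
  have i0: "integrable lborel gauss" by simp
  have i1: "integrable lborel (\<lambda>x. gauss x * \<bar>x\<bar>)" using integrable_std_normal_moment_abs[of 1] by simp
  \<comment> \<open>The first absolute moment is sqrt (2 / pi), hence at most 1.\<close>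
  have m1: "(\<integral>x. gauss x * \<bar>x\<bar> \<partial>lborel) \<le> 1"
  proof -
    have "2 / pi \<le> 1" using pi_gt3 by simp
    then have "sqrt (2 / pi) \<le> 1" by simp
    then show ?thesis using integral_std_normal_moment_abs_odd[of 0] by simp
  qed
  have growth: "\<exists>a. \<forall>x. \<bar>h x\<bar> \<le> a + \<bar>x\<bar>"
    using h
  proof
    assume *: "\<forall>x. 0 \<le> h x \<and> h x \<le> 1"
    have "\<bar>h x\<bar> \<le> 1 + \<bar>x\<bar>" for x using *[rule_format, of x] by auto
    then show ?thesis by blast
  next
    assume *: "\<forall>x y. \<bar>h x - h y\<bar> \<le> \<bar>x - y\<bar>"
    have "\<bar>h x\<bar> \<le> \<bar>h 0\<bar> + \<bar>x\<bar>" for x using *[rule_format, of x 0] by auto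
    then show ?thesis by blast
  qed
  then obtain a where a: "\<And>x. \<bar>h x\<bar> \<le> a + \<bar>x\<bar>" by blast
  have ih: "integrable lborel (\<lambda>x. gauss x * h x)"
  proof (rule Bochner_Integration.integrable_bound)
    show "integrable lborel (\<lambda>x. gauss x * a + gauss x * \<bar>x\<bar>)"
      using i0 i1 by (intro Bochner_Integration.integrable_add integrable_mult_left) auto
    show "AE x in lborel. norm (gauss x * h x) \<le> norm (gauss x * a + gauss x * \<bar>x\<bar>)"
    proof (rule AE_I2)
      fix x
      have "\<bar>gauss x * h x\<bar> \<le> gauss x * (a + \<bar>x\<bar>)"
        using a[of x] gauss_pos[of x] by (simp add: abs_mult)
      then show "norm (gauss x * h x) \<le> norm (gauss x * a + gauss x * \<bar>x\<bar>)" by (simp add: distrib_left)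
    qed
  qed simp
  have c: "c = (\<integral>x. gauss x * h x \<partial>lborel)" unfolding c_def by (rule integral_std_normal) simp
  have cdev: "h y - c = (\<integral>x. gauss x * (h y - h x) \<partial>lborel)" for y
    using ih i0 unfolding c right_diff_distrib by (subst Bochner_Integration.integral_diff) auto
  let ?g = "\<lambda>x. h x - c"
  have ig: "integrable lborel (\<lambda>x. gauss x * ?g x)"
    using ih i0 by (auto simp: right_diff_distrib)
  have zero: "(\<integral>x. gauss x * ?g x \<partial>lborel) = 0"
    using ih i0 by (simp add: right_diff_distrib c)
  have g: "(\<forall>x. \<bar>?g x\<bar> \<le> 1) \<or> (\<forall>x y. \<bar>?g x - ?g y\<bar> \<le> \<bar>x - y\<bar>) \<and> (\<forall>x. \<bar>?g x\<bar> \<le> 1 + \<bar>x\<bar>)"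
    using h
  proof
    assume *: "\<forall>x. 0 \<le> h x \<and> h x \<le> 1"
    have "0 \<le> c" unfolding c using * gauss_pos by (intro Bochner_Integration.integral_nonneg) (simp add: less_imp_le)
    moreover have "c \<le> (\<integral>x. gauss x \<partial>lborel)"
      unfolding c using * gauss_pos ih i0 by (intro integral_mono) (auto simp: mult_left_le less_imp_le)
    ultimately show ?thesis using * by (intro disjI1 allI) (smt (verit) integral_normal_density zero_less_one)
  next
    assume *: "\<forall>x y. \<bar>h x - h y\<bar> \<le> \<bar>x - y\<bar>"
    have "\<bar>?g y\<bar> \<le> 1 + \<bar>y\<bar>" for y
    proof -
      have "\<bar>?g y\<bar> \<le> (\<integral>x. gauss x * \<bar>y\<bar> + gauss x * \<bar>x\<bar> \<partial>lborel)"
        unfolding cdev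
      proof (rule integral_abs_bound_integral)
        show "\<bar>gauss x * (h y - h x)\<bar> \<le> gauss x * \<bar>y\<bar> + gauss x * \<bar>x\<bar>" for x
        proof -
          have "\<bar>h y - h x\<bar> \<le> \<bar>y\<bar> + \<bar>x\<bar>" using *[rule_format, of y x] by linarith
          then have "gauss x * \<bar>h y - h x\<bar> \<le> gauss x * (\<bar>y\<bar> + \<bar>x\<bar>)"
            using gauss_pos[of x] by (intro mult_left_mono) auto
          then show ?thesis using gauss_pos[of x] by (simp add: abs_mult distrib_left)
        qed
      qed (use ih i0 i1 in \<open>auto simp: right_diff_distrib\<close>)
      also have "\<dots> = \<bar>y\<bar> + (\<integral>x. gauss x * \<bar>x\<bar> \<partial>lborel)" using i0 i1 by simp
      finally show ?thesis using m1 by linarith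
    qed
    then show ?thesis using * by auto
  qed
  show ?thesis
    by (rule stein_equation_solution[OF _ g ig zero, of thesis])
       (use cont that in \<open>auto intro!: continuous_intros\<close>)
qed

section \<open>Normal approximation under local dependence\<close>

definition Phi :: "real \<Rightarrow> real" where "Phi t = measure std_normal_distribution {..t}"

abbreviation (input) Nint :: "(real \<Rightarrow> real) \<Rightarrow> real" where
  "Nint h \<equiv> \<integral>y. h y \<partial>std_normal_distribution"

lemma Phi_increment:
  assumes "a \<le> b" shows "Phi b - Phi a \<le> b - a"
proof -
  interpret N: prob_space std_normal_distribution by (rule prob_space_normal_density) simp
  have le1: "gauss y \<le> 1" for y
  proof -
    have "1 \<le> sqrt (2 * pi)" using pi_gt3 by simp
    moreover have "exp (- y\<^sup>2 / 2) \<le> 1" by simp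
    ultimately show ?thesis
      using mult_mono[of "1 / sqrt (2 * pi)" 1 "exp (- y\<^sup>2 / 2)" 1]
      unfolding std_normal_density_def by simp
  qed
  have "Phi b - Phi a = N.prob ({..b} - {..a})"
    unfolding Phi_def using assms by (subst N.finite_measure_Diff) auto
  also have "{..b} - {..a} = {a<..b}" by auto
  also have "N.prob {a<..b} \<le> b - a"
  proof -
    have "emeasure std_normal_distribution {a<..b} = (\<integral>\<^sup>+y. ennreal (gauss y) * indicator {a<..b} y \<partial>lborel)"
      by (subst emeasure_density) auto
    also have "\<dots> \<le> (\<integral>\<^sup>+y. indicator {a<..b} y \<partial>lborel)"
      using le1 by (intro nn_integral_mono) (auto split: split_indicator)
    also have "\<dots> = ennreal (b - a)" using assms by simp
    finally show ?thesis using assms by (simp add: N.emeasure_eq_measure)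
  qed
  finally show ?thesis .
qed

text \<open>A common upper bound of the constants
  \<open>2 * A + 2 * D^2 + 3 * \<theta> + D + 1\<close> (Kolmogorov) and
  \<open>A + 2 * D^2 / c + 5\<close> (Wasserstein) with \<open>A\<close> and \<open>\<theta>\<close>
  written out. It stands outside the locale to make visible that it depends on \<open>D\<close> and
  \<open>c\<close> alone.\<close>

definition clt_const :: "real \<Rightarrow> real \<Rightarrow> real" where
  "clt_const D c = 2 * (8 * sqrt (D ^ 3 / c) + 4 * D\<^sup>2 + 16 * D\<^sup>2 / c) + 2 * D\<^sup>2
     + 3 * (8 * D\<^sup>2 / c + 1) + D + 5 + 2 * D\<^sup>2 / c"

text \<open>Independence enters only through two consequences: \<open>x i\<close> is uncorrelated
  with functions of the sum outside \<open>N i\<close>, and the products \<open>x i * R i\<close>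
  and \<open>x k * R k\<close> are uncorrelated for \<open>k\<close> outside the larger set
  \<open>N' i\<close>. The quantities \<open>p\<close>, \<open>x\<close>, \<open>R\<close>,
  \<open>S\<close>, \<open>V\<close> are parameters with defining equations so that the assumptions
  can mention them.\<close>

locale local_dependence = prob_space M for M :: "'w measure" +
  fixes I :: "'i set" and X :: "'i \<Rightarrow> 'w \<Rightarrow> real" and N N' :: "'i \<Rightarrow> 'i set"
    and D n c :: real
  fixes p :: "'i \<Rightarrow> real" and x R :: "'i \<Rightarrow> 'w \<Rightarrow> real" and S :: "'w \<Rightarrow> real" and V :: real
  defines "p \<equiv> \<lambda>i. expectation (X i)"
    and "x \<equiv> \<lambda>i \<omega>. X i \<omega> - p i"
    and "R \<equiv> \<lambda>i \<omega>. \<Sum>j\<in>N i. x j \<omega>"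
    and "S \<equiv> \<lambda>\<omega>. \<Sum>i\<in>I. x i \<omega>"
    and "V \<equiv> expectation (\<lambda>\<omega>. (S \<omega>)\<^sup>2)"
  assumes finite_I: "finite I"
    and X_meas: "\<And>i. i \<in> I \<Longrightarrow> X i \<in> borel_measurable M"
    and X_range: "\<And>i \<omega>. i \<in> I \<Longrightarrow> 0 \<le> X i \<omega> \<and> X i \<omega> \<le> 1"
    and N: "\<And>i. i \<in> I \<Longrightarrow> N i \<subseteq> I \<and> card (N i) \<le> D"
    and N': "\<And>i. i \<in> I \<Longrightarrow> N' i \<subseteq> I \<and> card (N' i) \<le> D"
    and D_nonneg: "0 \<le> D"
    and decouple: "\<And>i f. i \<in> I \<Longrightarrow> continuous_on UNIV (f :: real \<Rightarrow> real) \<Longrightarrow>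
          expectation (\<lambda>\<omega>. x i \<omega> * f (S \<omega> - R i \<omega>)) = 0"
    and uncorrelated: "\<And>i k. i \<in> I \<Longrightarrow> k \<in> I \<Longrightarrow> k \<notin> N' i \<Longrightarrow>
          expectation (\<lambda>\<omega>. (x i \<omega> * R i \<omega>) * (x k \<omega> * R k \<omega>)) =
          expectation (\<lambda>\<omega>. x i \<omega> * R i \<omega>) * expectation (\<lambda>\<omega>. x k \<omega> * R k \<omega>)"
    and sum_p_le: "(\<Sum>i\<in>I. p i) \<le> n"
    and c_pos: "0 < c" and V_ge: "c * n \<le> V" and V_pos: "0 < V"
begin

section \<open>Moments of the summands and of the standardised sum\<close>

definition \<sigma> :: real where "\<sigma> = sqrt V"
definition W :: "'w \<Rightarrow> real" where "W \<omega> = S \<omega> / \<sigma>"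

lemma sigma_pos: "0 < \<sigma>" and sigma_sq: "\<sigma>\<^sup>2 = V"
  using V_pos by (auto simp: \<sigma>_def)

lemma S_eq: "S \<omega> = \<sigma> * W \<omega>" using sigma_pos by (simp add: W_def)

lemma integrable_X: "i \<in> I \<Longrightarrow> integrable M (X i)"
  by (rule integrable_const_bound[where B=1]) (use X_range X_meas in auto)

lemma p_range: "i \<in> I \<Longrightarrow> 0 \<le> p i \<and> p i \<le> 1"
  unfolding p_def using X_range integrable_X
  by (auto intro!: integral_nonneg_AE integral_le_const)

lemma x_bound: "i \<in> I \<Longrightarrow> \<bar>x i \<omega>\<bar> \<le> 1"
  using X_range[of i \<omega>] p_range[of i] by (auto simp: x_def)

lemma x_bound': "i \<in> I \<Longrightarrow> \<bar>x i \<omega>\<bar> \<le> X i \<omega> + p i"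
  using X_range[of i \<omega>] p_range[of i] by (auto simp: x_def)

lemma x_meas [measurable]: "i \<in> I \<Longrightarrow> x i \<in> borel_measurable M"
  unfolding x_def using X_meas by auto

lemma R_bound: "i \<in> I \<Longrightarrow> \<bar>R i \<omega>\<bar> \<le> D"
proof -
  assume i: "i \<in> I"
  have "\<bar>R i \<omega>\<bar> \<le> (\<Sum>j\<in>N i. \<bar>x j \<omega>\<bar>)" unfolding R_def by (rule sum_abs)
  also have "\<dots> \<le> (\<Sum>j\<in>N i. 1)" using N[OF i] x_bound by (intro sum_mono) auto
  finally show ?thesis using N[OF i] by simp
qed

lemma R_meas [measurable]: "i \<in> I \<Longrightarrow> R i \<in> borel_measurable M"
  unfolding R_def using N by (intro borel_measurable_sum x_meas) auto

lemma S_meas [measurable]: "S \<in> borel_measurable M"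
  unfolding S_def by (intro borel_measurable_sum x_meas)

lemma S_bound: "\<bar>S \<omega>\<bar> \<le> card I"
proof -
  have "\<bar>S \<omega>\<bar> \<le> (\<Sum>j\<in>I. \<bar>x j \<omega>\<bar>)" unfolding S_def by (rule sum_abs)
  also have "\<dots> \<le> (\<Sum>j\<in>I. 1)" using x_bound by (intro sum_mono) auto
  finally show ?thesis by simp
qed

lemma W_meas [measurable]: "W \<in> borel_measurable M" unfolding W_def by measurable

lemma W_bound: "\<bar>W \<omega>\<bar> \<le> card I / \<sigma>"
  using S_bound[of \<omega>] sigma_pos by (simp add: W_def field_simps)

lemma integrable_bounded:
  "(f :: 'w \<Rightarrow> real) \<in> borel_measurable M \<Longrightarrow> (\<And>\<omega>. \<bar>f \<omega>\<bar> \<le> b) \<Longrightarrow> integrable M f"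
  by (rule integrable_const_bound[where B=b]) auto

lemma abs_expectation_le:
  fixes f g :: "'w \<Rightarrow> real"
  assumes "integrable M f" "integrable M g" "\<And>\<omega>. \<bar>f \<omega>\<bar> \<le> g \<omega>"
  shows "\<bar>expectation f\<bar> \<le> expectation g"
proof -
  have "\<bar>expectation f\<bar> \<le> expectation (\<lambda>\<omega>. \<bar>f \<omega>\<bar>)" by (rule integral_abs_bound)
  also have "\<dots> \<le> expectation g" using assms by (intro integral_mono) auto
  finally show ?thesis .
qed

lemma integrable_bdd_mult:
  assumes "(f :: 'w \<Rightarrow> real) \<in> borel_measurable M" "\<And>\<omega>. \<bar>f \<omega>\<bar> \<le> a"
    "(g :: 'w \<Rightarrow> real) \<in> borel_measurable M" "\<And>\<omega>. \<bar>g \<omega>\<bar> \<le> b"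
  shows "integrable M (\<lambda>\<omega>. f \<omega> * g \<omega>)"
proof (rule integrable_bounded[where b="a * b"])
  show "\<bar>f \<omega> * g \<omega>\<bar> \<le> a * b" for \<omega>
    using assms(2,4)[of \<omega>] by (auto simp: abs_mult intro!: mult_mono)
qed (use assms in auto)

lemma integrable_x: "i \<in> I \<Longrightarrow> integrable M (x i)"
  by (rule integrable_bounded[where b=1]) (auto simp: x_bound)

lemma expectation_x: "i \<in> I \<Longrightarrow> expectation (x i) = 0"
  unfolding x_def using integrable_X by (simp add: p_def prob_space)

lemma expectation_abs_x: "i \<in> I \<Longrightarrow> expectation (\<lambda>\<omega>. \<bar>x i \<omega>\<bar>) \<le> 2 * p i"
proof -
  assume i: "i \<in> I"
  have "expectation (\<lambda>\<omega>. \<bar>x i \<omega>\<bar>) \<le> expectation (\<lambda>\<omega>. X i \<omega> + p i)"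
    using i x_bound' integrable_x[OF i] integrable_X[OF i] by (intro integral_mono) auto
  also have "\<dots> = 2 * p i" using integrable_X[OF i] by (simp add: p_def prob_space)
  finally show ?thesis .
qed

lemma expectation_S: "expectation S = 0"
  unfolding S_def using expectation_x integrable_x by (subst Bochner_Integration.integral_sum) auto

lemma expectation_W: "expectation W = 0"
  unfolding W_def using expectation_S by simp

lemma integrable_W: "integrable M W" by (rule integrable_bounded[OF W_meas W_bound])

lemma integrable_W2: "integrable M (\<lambda>\<omega>. (W \<omega>)\<^sup>2)"
  using integrable_bdd_mult[OF W_meas W_bound W_meas W_bound] by (simp add: power2_eq_square)

lemma expectation_W2: "expectation (\<lambda>\<omega>. (W \<omega>)\<^sup>2) = 1"
  using V_pos by (simp add: W_def power_divide sigma_sq V_def[symmetric])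

lemma expectation_abs_W: "expectation (\<lambda>\<omega>. \<bar>W \<omega>\<bar>) \<le> 1"
proof -
  have "expectation (\<lambda>\<omega>. \<bar>W \<omega>\<bar>) \<le> expectation (\<lambda>\<omega>. (1 + (W \<omega>)\<^sup>2) / 2)"
  proof (rule integral_mono)
    show "\<bar>W \<omega>\<bar> \<le> (1 + (W \<omega>)\<^sup>2) / 2" for \<omega>
      using zero_le_power2[of "\<bar>W \<omega>\<bar> - 1"] by (simp add: power2_diff)
  qed (use integrable_W integrable_W2 in auto)
  also have "\<dots> = 1" using expectation_W2 integrable_W2 by (simp add: prob_space add_divide_distrib)
  finally show ?thesis .
qed

lemma n_nonneg: "0 \<le> n"
  using sum_p_le sum_nonneg[of I p] p_range by auto

text \<open>In the expansion of \<open>W * f W\<close> the derivative of \<open>f\<close> is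
  multiplied by \<open>Q / V\<close>. This factor has mean 1, and its fluctuation is the first error
  term.\<close>

definition Q :: "'w \<Rightarrow> real" where "Q \<omega> = (\<Sum>i\<in>I. x i \<omega> * R i \<omega>)"

lemma U_meas [measurable]: "i \<in> I \<Longrightarrow> (\<lambda>\<omega>. x i \<omega> * R i \<omega>) \<in> borel_measurable M" by measurable

lemma U_bound: "i \<in> I \<Longrightarrow> \<bar>x i \<omega> * R i \<omega>\<bar> \<le> \<bar>x i \<omega>\<bar> * D"
  using R_bound[of i \<omega>] by (auto simp: abs_mult intro!: mult_left_mono)

lemma U_bound': "i \<in> I \<Longrightarrow> \<bar>x i \<omega> * R i \<omega>\<bar> \<le> D"
  using U_bound[of i \<omega>] x_bound[of i \<omega>] D_nonneg by (smt (verit) mult_left_le_one_le abs_ge_zero)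

lemma integrable_U: "i \<in> I \<Longrightarrow> integrable M (\<lambda>\<omega>. x i \<omega> * R i \<omega>)"
  by (rule integrable_bounded[OF U_meas U_bound'])

text \<open>Decoupling with the identity function gives equal means of \<open>x i * S\<close> and
  \<open>x i * R i\<close>; summing over \<open>i\<close> yields the second moment of
  \<open>S\<close>.\<close>

lemma expectation_Q: "expectation Q = V"
proof -
  have eq: "expectation (\<lambda>\<omega>. x i \<omega> * S \<omega>) = expectation (\<lambda>\<omega>. x i \<omega> * R i \<omega>)" if i: "i \<in> I" for i
  proof -
    have "expectation (\<lambda>\<omega>. x i \<omega> * (S \<omega> - R i \<omega>)) = 0"
      using decouple[OF i, of "\<lambda>y. y"] by simp
    moreover have "integrable M (\<lambda>\<omega>. x i \<omega> * S \<omega>)"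
      by (rule integrable_bdd_mult[OF x_meas[OF i] x_bound[OF i] S_meas S_bound])
    ultimately show ?thesis using integrable_U[OF i] by (simp add: right_diff_distrib)
  qed
  have "V = expectation (\<lambda>\<omega>. \<Sum>i\<in>I. x i \<omega> * S \<omega>)"
    unfolding V_def by (simp add: power2_eq_square S_def sum_distrib_right[symmetric])
  also have "\<dots> = (\<Sum>i\<in>I. expectation (\<lambda>\<omega>. x i \<omega> * S \<omega>))"
    by (rule Bochner_Integration.integral_sum) (rule integrable_bdd_mult[OF x_meas x_bound S_meas S_bound])
  also have "\<dots> = (\<Sum>i\<in>I. expectation (\<lambda>\<omega>. x i \<omega> * R i \<omega>))" using eq by simp
  also have "\<dots> = expectation Q" unfolding Q_def
    by (rule Bochner_Integration.integral_sum[symmetric]) (rule integrable_U)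
  finally show ?thesis by simp
qed

text \<open>One factor of \<open>x i * R i\<close> is kept in absolute value, with mean at most
  \<open>2 * p i\<close>, and the other is bounded by \<open>D\<close>. This upper bound later turns
  the rate 1/\<sigma> into the square root of the volume over the variance.\<close>

lemma V_le: "V \<le> 2 * D * n"
proof -
  have "V = (\<Sum>i\<in>I. expectation (\<lambda>\<omega>. x i \<omega> * R i \<omega>))"
    unfolding expectation_Q[symmetric] Q_def
    by (rule Bochner_Integration.integral_sum) (rule integrable_U)
  also have "\<dots> \<le> (\<Sum>i\<in>I. 2 * D * p i)"
  proof (rule sum_mono)
    fix i assume i: "i \<in> I"
    have "expectation (\<lambda>\<omega>. x i \<omega> * R i \<omega>) \<le> expectation (\<lambda>\<omega>. \<bar>x i \<omega>\<bar> * D)"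
      using i integrable_U integrable_x U_bound by (intro integral_mono) (auto simp: abs_le_iff)
    also have "\<dots> \<le> 2 * p i * D"
      using expectation_abs_x[OF i] D_nonneg by (simp add: mult_right_mono)
    finally show "expectation (\<lambda>\<omega>. x i \<omega> * R i \<omega>) \<le> 2 * D * p i" by (simp add: mult_ac)
  qed
  also have "\<dots> = 2 * D * (\<Sum>i\<in>I. p i)" by (simp add: sum_distrib_left)
  also have "\<dots> \<le> 2 * D * n" using sum_p_le D_nonneg by (intro mult_left_mono) auto
  finally show ?thesis .
qed

lemma Q_meas [measurable]: "Q \<in> borel_measurable M"
  unfolding Q_def by measurable

lemma Q_bound: "\<bar>Q \<omega>\<bar> \<le> card I * D"
proof -
  have "\<bar>Q \<omega>\<bar> \<le> (\<Sum>i\<in>I. \<bar>x i \<omega> * R i \<omega>\<bar>)" unfolding Q_def by (rule sum_abs)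
  also have "\<dots> \<le> (\<Sum>i\<in>I. D)" using U_bound' by (intro sum_mono) auto
  finally show ?thesis by simp
qed

text \<open>Only the at most \<open>D\<close> indices \<open>k\<close> in \<open>N' i\<close> have a
  covariance with \<open>i\<close>. In such a pair one factor \<open>x i\<close> is retained to gain
  \<open>p i\<close>, the rest is bounded by \<open>D^2\<close>; the mean of the product and the
  product of the means contribute \<open>2 * p i * D^2\<close> each.\<close>

lemma variance_Q: "expectation (\<lambda>\<omega>. (Q \<omega> - V)\<^sup>2) \<le> 4 * D ^ 3 * n"
proof -
  define U where "U i \<omega> = x i \<omega> * R i \<omega>" for i \<omega>
  define e where "e i = expectation (U i)" for i
  have UB: "\<bar>U i \<omega>\<bar> \<le> \<bar>x i \<omega>\<bar> * D" "\<bar>U i \<omega>\<bar> \<le> D" if "i \<in> I" for i \<omega>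
    using that U_bound U_bound' by (auto simp: U_def)
  have Um: "U i \<in> borel_measurable M" if "i \<in> I" for i using that unfolding U_def by measurable
  have Ui: "integrable M (U i)" if "i \<in> I" for i using integrable_U that by (simp add: U_def[abs_def])
  have UUi: "integrable M (\<lambda>\<omega>. U i \<omega> * U k \<omega>)" if "i \<in> I" "k \<in> I" for i k
    by (rule integrable_bdd_mult[OF Um UB(2) Um UB(2)]) (use that in auto)
  have eB: "\<bar>e i\<bar> \<le> D * (2 * p i)" if i: "i \<in> I" for i
  proof -
    have "\<bar>e i\<bar> \<le> expectation (\<lambda>\<omega>. \<bar>x i \<omega>\<bar> * D)"
      unfolding e_def by (rule abs_expectation_le) (use i Ui UB integrable_x in auto)
    also have "\<dots> \<le> 2 * p i * D"
      using expectation_abs_x[OF i] D_nonneg by (simp add: mult_right_mono)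
    finally show ?thesis by (simp add: mult_ac)
  qed
  have eB': "\<bar>e i\<bar> \<le> D" if i: "i \<in> I" for i
  proof -
    have "\<bar>e i\<bar> \<le> expectation (\<lambda>\<omega>. D)"
      unfolding e_def by (rule abs_expectation_le) (use i Ui UB in auto)
    then show ?thesis by (simp add: prob_space)
  qed
  have V_eq: "V = (\<Sum>i\<in>I. e i)"
    unfolding expectation_Q[symmetric] Q_def e_def U_def
    by (rule Bochner_Integration.integral_sum) (rule integrable_U)
  have cov_le: "expectation (\<lambda>\<omega>. (U i \<omega> - e i) * (U k \<omega> - e k)) \<le> (if k \<in> N' i then 4 * D\<^sup>2 * p i else 0)"
    if i: "i \<in> I" and k: "k \<in> I" for i k
  proof -
    have eq: "expectation (\<lambda>\<omega>. (U i \<omega> - e i) * (U k \<omega> - e k)) = expectation (\<lambda>\<omega>. U i \<omega> * U k \<omega>) - e i * e k"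
      using Ui[OF i] Ui[OF k] UUi[OF i k]
      by (simp add: left_diff_distrib right_diff_distrib prob_space e_def[symmetric])
    show ?thesis
    proof (cases "k \<in> N' i")
      case False
      then show ?thesis using uncorrelated[OF i k] eq by (simp add: U_def[abs_def] e_def)
    next
      case True
      have "expectation (\<lambda>\<omega>. U i \<omega> * U k \<omega>) \<le> expectation (\<lambda>\<omega>. \<bar>x i \<omega>\<bar> * (D * D))"
      proof (rule integral_mono)
        show "U i \<omega> * U k \<omega> \<le> \<bar>x i \<omega>\<bar> * (D * D)" for \<omega>
        proof -
          have "\<bar>U i \<omega>\<bar> * \<bar>U k \<omega>\<bar> \<le> (\<bar>x i \<omega>\<bar> * D) * D"
            using UB[OF i, of \<omega>] UB[OF k, of \<omega>] D_nonneg by (intro mult_mono) auto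
          then show ?thesis by (metis abs_le_iff abs_mult mult.assoc order.trans abs_ge_self)
        qed
      qed (use i k UUi integrable_x in auto)
      also have "\<dots> \<le> 2 * p i * (D * D)"
        using expectation_abs_x[OF i] D_nonneg by (simp add: mult_right_mono)
      finally have 1: "expectation (\<lambda>\<omega>. U i \<omega> * U k \<omega>) \<le> 2 * p i * (D * D)" .
      have "\<bar>e i\<bar> * \<bar>e k\<bar> \<le> (D * (2 * p i)) * D"
        using eB[OF i] eB'[OF k] p_range[OF i] D_nonneg by (intro mult_mono) auto
      then have "- (e i * e k) \<le> 2 * p i * (D * D)"
        by (simp add: abs_mult[symmetric] mult_ac abs_le_iff)
      with 1 True eq show ?thesis by (simp add: power2_eq_square algebra_simps)
    qed
  qed
  have "(Q \<omega> - V)\<^sup>2 = (\<Sum>i\<in>I. \<Sum>k\<in>I. (U i \<omega> - e i) * (U k \<omega> - e k))" for \<omega>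
    unfolding V_eq Q_def U_def[symmetric] sum_subtractf[symmetric] power2_eq_square
    by (rule sum_product)
  then have "expectation (\<lambda>\<omega>. (Q \<omega> - V)\<^sup>2) =
      (\<Sum>i\<in>I. \<Sum>k\<in>I. expectation (\<lambda>\<omega>. (U i \<omega> - e i) * (U k \<omega> - e k)))"
    using Ui UUi
    by (simp add: left_diff_distrib right_diff_distrib Bochner_Integration.integral_sum)
  also have "\<dots> \<le> (\<Sum>i\<in>I. \<Sum>k\<in>I. if k \<in> N' i then 4 * D\<^sup>2 * p i else 0)"
    using cov_le by (intro sum_mono) auto
  also have "\<dots> = (\<Sum>i\<in>I. card (N' i) * (4 * D\<^sup>2 * p i))"
  proof (rule sum.cong[OF refl])
    fix i assume "i \<in> I"
    then have "I \<inter> {k. k \<in> N' i} = N' i" using N' by auto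
    then show "(\<Sum>k\<in>I. if k \<in> N' i then 4 * D\<^sup>2 * p i else 0) = card (N' i) * (4 * D\<^sup>2 * p i)"
      using finite_I by (simp add: sum.If_cases)
  qed
  also have "\<dots> \<le> (\<Sum>i\<in>I. D * (4 * D\<^sup>2 * p i))"
    using N' p_range by (intro sum_mono mult_right_mono) auto
  also have "\<dots> = 4 * D ^ 3 * (\<Sum>i\<in>I. p i)"
    unfolding sum_distrib_left
    by (intro sum.cong refl) (simp add: power2_eq_square power3_eq_cube)
  also have "\<dots> \<le> 4 * D ^ 3 * n" using sum_p_le D_nonneg by (intro mult_left_mono) auto
  finally show ?thesis .
qed

lemma n_div_V: "n / V \<le> 1 / c"
  using V_ge V_pos c_pos by (simp add: field_simps)

text \<open>Cauchy-Schwarz, in the form that the variance of the absolute value is nonnegative,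
  applied to \<open>variance_Q\<close>; the linear lower bound on \<open>V\<close> replaces
  \<open>n / V\<close> by \<open>1 / c\<close>.\<close>

lemma stein_first_term: "expectation (\<lambda>\<omega>. \<bar>1 - Q \<omega> / V\<bar>) \<le> 2 * sqrt (D ^ 3 / c) / \<sigma>"
proof -
  let ?Y = "\<lambda>\<omega>. \<bar>1 - Q \<omega> / V\<bar>"
  have Yi: "integrable M ?Y" 
  proof (rule integrable_bounded[where b="1 + card I * D / V"])
    fix \<omega>
    have "\<bar>Q \<omega> / V\<bar> \<le> card I * D / V" using Q_bound[of \<omega>] V_pos by (simp add: divide_right_mono)
    then show "\<bar>\<bar>1 - Q \<omega> / V\<bar>\<bar> \<le> 1 + card I * D / V" by linarith
  qed simp
  have Y2: "(?Y \<omega>)\<^sup>2 = (Q \<omega> - V)\<^sup>2 / V\<^sup>2" for \<omega>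
    using V_pos by (simp add: power_divide[symmetric] power2_commute diff_divide_distrib)
  have Q2i: "integrable M (\<lambda>\<omega>. (Q \<omega> - V)\<^sup>2)"
  proof -
    have "\<bar>Q \<omega> - V\<bar> \<le> card I * D + V" for \<omega> using Q_bound[of \<omega>] V_pos by linarith
    from integrable_bdd_mult[OF _ this _ this] show ?thesis by (simp add: power2_eq_square)
  qed
  have "(expectation ?Y)\<^sup>2 \<le> expectation (\<lambda>\<omega>. (?Y \<omega>)\<^sup>2)"
  proof -
    have "0 \<le> variance ?Y" by (rule variance_positive)
    then show ?thesis using Yi Q2i by (subst (asm) variance_eq) (auto simp: Y2 simp del: power2_abs)
  qed
  also have "\<dots> \<le> 4 * D ^ 3 * n / V\<^sup>2"
    unfolding Y2 using variance_Q Q2i V_pos by (simp add: divide_right_mono)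
  also have "\<dots> = 4 * D ^ 3 * (n / V) / V" by (simp add: power2_eq_square)
  also have "\<dots> \<le> 4 * D ^ 3 * (1 / c) / V"
    using n_div_V D_nonneg V_pos by (intro divide_right_mono mult_left_mono) auto
  also have "\<dots> = (2 * sqrt (D ^ 3 / c) / \<sigma>)\<^sup>2"
    using D_nonneg c_pos V_pos by (simp add: power_divide power_mult_distrib sigma_sq)
  finally show ?thesis
    by (rule power2_le_imp_le) (use D_nonneg c_pos sigma_pos in auto)
qed

section \<open>Stein's expansion with a local modulus of continuity\<close>

lemma stein_taylor:
  fixes f g :: "real \<Rightarrow> real"
  assumes f: "\<And>y. (f has_real_derivative y * f y + g y) (at y)"
    and f_le: "\<And>y. \<bar>f y\<bar> \<le> 4" and f'_le: "\<And>y. \<bar>y * f y + g y\<bar> \<le> 4"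
    and mod: "\<And>s. \<bar>s\<bar> \<le> b \<Longrightarrow> \<bar>g (w - s) - g w\<bar> \<le> m" and r: "\<bar>r\<bar> \<le> b"
  shows "\<bar>f w - f (w - r) - r * (w * f w + g w)\<bar> \<le> \<bar>r\<bar> * (4 * b * (1 + \<bar>w\<bar>) + m)"
proof -
  let ?f' = "\<lambda>y. y * f y + g y"
  have lip: "\<bar>f u - f v\<bar> \<le> 4 * \<bar>u - v\<bar>" for u v
    using field_differentiable_bound[of UNIV f ?f' 4 u v] f f'_le
    by (auto simp: has_field_derivative_at_within)
  obtain s where s: "\<bar>s\<bar> \<le> \<bar>r\<bar>" "f w - f (w - r) = r * ?f' (w - s)"
  proof (cases r "0 :: real" rule: linorder_cases)
    case less
    then obtain z where "w < z" "z < w - r" "f (w - r) - f w = (w - r - w) * ?f' z"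
      using MVT2[of w "w - r" f ?f'] f by auto
    then show ?thesis using that[of "w - z"] less by (simp add: algebra_simps)
  next
    case greater
    then obtain z where "w - r < z" "z < w" "f w - f (w - r) = (w - (w - r)) * ?f' z"
      using MVT2[of "w - r" w f ?f'] f by auto
    then show ?thesis using that[of "w - z"] greater by (simp add: algebra_simps)
  qed (use that[of 0] in auto)
  \<comment> \<open>The equation itself replaces a bound on the second derivative. The modulus
    \<open>m\<close> refers to the given \<open>w\<close> only, so for a smoothed indicator it can
    vanish away from the step.\<close>
  have "?f' (w - s) - ?f' w = (g (w - s) - g w) + (- s * f (w - s) + w * (f (w - s) - f w))"
    by (simp add: algebra_simps)
  also have "\<bar>\<dots>\<bar> \<le> m + (\<bar>s\<bar> * 4 + \<bar>w\<bar> * (4 * \<bar>s\<bar>))"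
  proof -
    have "\<bar>g (w - s) - g w\<bar> \<le> m" using mod s r by auto
    moreover have "\<bar>- s * f (w - s)\<bar> \<le> \<bar>s\<bar> * 4"
      using f_le[of "w - s"] unfolding abs_mult by (auto intro: mult_left_mono)
    moreover have "\<bar>w * (f (w - s) - f w)\<bar> \<le> \<bar>w\<bar> * (4 * \<bar>s\<bar>)"
      using lip[of "w - s" w] unfolding abs_mult by (intro mult_left_mono) auto
    ultimately show ?thesis by linarith
  qed
  also have "\<dots> \<le> 4 * b * (1 + \<bar>w\<bar>) + m"
  proof -
    have "\<bar>s\<bar> * (4 * (1 + \<bar>w\<bar>)) \<le> b * (4 * (1 + \<bar>w\<bar>))" using s r by (intro mult_right_mono) auto
    then show ?thesis by (simp add: algebra_simps)
  qed
  finally have "\<bar>r\<bar> * \<bar>?f' (w - s) - ?f' w\<bar> \<le> \<bar>r\<bar> * (4 * b * (1 + \<bar>w\<bar>) + m)"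
    by (intro mult_left_mono) auto
  moreover have "f w - f (w - r) - r * ?f' w = r * (?f' (w - s) - ?f' w)"
    unfolding s(2) by (simp add: right_diff_distrib)
  ultimately show ?thesis by (simp add: abs_mult)
qed


text \<open>The part of the error that does not see the modulus of \<open>g\<close>: 4 times the
  bound of \<open>stein_first_term\<close>, then the contribution of the term
  \<open>4 * b * (1 + \<bar>w\<bar>)\<close> of the Taylor remainder with
  \<open>b = D / \<sigma>\<close>.\<close>

definition A :: real where "A = 8 * sqrt (D ^ 3 / c) + 4 * D\<^sup>2 + 16 * D\<^sup>2 / c"

lemma A_nonneg: "0 \<le> A" using D_nonneg c_pos by (auto simp: A_def)

text \<open>Pointwise, \<open>\<bar>x i\<bar> \<le> X i + p i = x i + 2 * p i\<close>. The
  right-hand side is a function of \<open>W\<close>, so after multiplication by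
  \<open>m (W \<omega>)\<close> the remainder involves the law of \<open>W\<close> alone and no
  leave-out sums.\<close>

lemma sum_abs_x_le: "(\<Sum>i\<in>I. \<bar>x i \<omega>\<bar>) \<le> S \<omega> + 2 * n"
proof -
  have "(\<Sum>i\<in>I. \<bar>x i \<omega>\<bar>) \<le> (\<Sum>i\<in>I. x i \<omega> + 2 * p i)"
  proof (rule sum_mono)
    show "\<bar>x i \<omega>\<bar> \<le> x i \<omega> + 2 * p i" if "i \<in> I" for i
      using x_bound'[OF that, of \<omega>] by (simp add: x_def)
  qed
  also have "\<dots> = S \<omega> + 2 * (\<Sum>i\<in>I. p i)"
    by (simp add: S_def sum.distrib sum_distrib_left)
  finally show ?thesis using sum_p_le by linarith
qed

lemma integrable_weight:
  assumes "(m :: real \<Rightarrow> real) \<in> borel_measurable borel" "\<And>w. \<bar>w\<bar> \<le> card I / \<sigma> \<Longrightarrow> \<bar>m w\<bar> \<le> B"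
  shows "integrable M (\<lambda>\<omega>. (S \<omega> + 2 * n) * m (W \<omega>))"
proof (rule integrable_bdd_mult)
  show "\<bar>S \<omega> + 2 * n\<bar> \<le> card I + 2 * n" for \<omega> using S_bound[of \<omega>] n_nonneg by linarith
  show "\<bar>m (W \<omega>)\<bar> \<le> B" for \<omega> using assms(2) W_bound by blast
  show "(\<lambda>\<omega>. m (W \<omega>)) \<in> borel_measurable M" using assms(1) by measurable
qed simp

text \<open>By Stein's equation g (W) is f' (W) - W f (W). Each \<open>x i * f W\<close> is expanded
  around \<open>W - R i / \<sigma>\<close>: the terms \<open>d i\<close> have mean 0 by decoupling,
  the linear terms add up to f' (W) Q / V, and \<open>T i\<close> is the Taylor remainder.\<close>

lemma stein_bound:
  fixes f g m :: "real \<Rightarrow> real"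
  assumes f: "\<And>y. (f has_real_derivative y * f y + g y) (at y)"
    and f_le: "\<And>y. \<bar>f y\<bar> \<le> 4" and f'_le: "\<And>y. \<bar>y * f y + g y\<bar> \<le> 4"
    and g: "continuous_on UNIV g"
    and m: "m \<in> borel_measurable borel" and m_le: "\<And>w. \<bar>m w\<bar> \<le> B"
    and mod: "\<And>w s. \<bar>s\<bar> \<le> D / \<sigma> \<Longrightarrow> \<bar>g (w - s) - g w\<bar> \<le> m w"
    and \<sigma>: "1 \<le> \<sigma>"
  shows "\<bar>expectation (\<lambda>\<omega>. g (W \<omega>))\<bar> \<le> A / \<sigma> + D / V * expectation (\<lambda>\<omega>. (S \<omega> + 2 * n) * m (W \<omega>))"
proof -
  note [measurable] = m
  define F' where "F' y = y * f y + g y" for y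
  have fc: "continuous_on UNIV f" using f by (auto simp: continuous_on_eq_continuous_at intro: DERIV_isCont)
  have F'c: "continuous_on UNIV F'" unfolding F'_def[abs_def] using fc g by (intro continuous_intros) auto
  have [measurable]: "f \<in> borel_measurable borel" "F' \<in> borel_measurable borel" "g \<in> borel_measurable borel"
    using fc F'c g by (auto intro: borel_measurable_continuous_onI)
  define T where "T i \<omega> = f (W \<omega>) - f (W \<omega> - R i \<omega> / \<sigma>) - R i \<omega> / \<sigma> * F' (W \<omega>)" for i \<omega>
  define a where "a \<omega> = F' (W \<omega>) * (1 - Q \<omega> / V)" for \<omega>
  define d where "d i \<omega> = x i \<omega> * f (W \<omega> - R i \<omega> / \<sigma>)" for i \<omega>
  have decomp: "g (W \<omega>) = a \<omega> - (1 / \<sigma>) * (\<Sum>i\<in>I. x i \<omega> * T i \<omega>) - (1 / \<sigma>) * (\<Sum>i\<in>I. d i \<omega>)" for \<omega>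
  proof -
    have "(\<Sum>i\<in>I. x i \<omega> * T i \<omega>) + (\<Sum>i\<in>I. d i \<omega>) = (\<Sum>i\<in>I. x i \<omega> * f (W \<omega>) - (F' (W \<omega>) / \<sigma>) * (x i \<omega> * R i \<omega>))"
      unfolding sum.distrib[symmetric] T_def d_def by (intro sum.cong refl) (simp add: algebra_simps)
    also have "\<dots> = S \<omega> * f (W \<omega>) - F' (W \<omega>) / \<sigma> * Q \<omega>"
      by (simp add: sum_subtractf sum_distrib_left[symmetric] sum_distrib_right[symmetric]
          sum_divide_distrib[symmetric] S_def Q_def)
    finally have "(1 / \<sigma>) * ((\<Sum>i\<in>I. x i \<omega> * T i \<omega>) + (\<Sum>i\<in>I. d i \<omega>)) = W \<omega> * f (W \<omega>) - F' (W \<omega>) * (Q \<omega> / V)"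
      using sigma_pos by (simp add: S_eq sigma_sq[symmetric] right_diff_distrib power2_eq_square)
    then show ?thesis by (simp add: a_def F'_def algebra_simps)
  qed
  have T_le: "\<bar>T i \<omega>\<bar> \<le> (D / \<sigma>) * (4 * (D / \<sigma>) * (1 + \<bar>W \<omega>\<bar>) + m (W \<omega>))" if i: "i \<in> I" for i \<omega>
  proof -
    have r: "\<bar>R i \<omega> / \<sigma>\<bar> \<le> D / \<sigma>" using R_bound[OF i, of \<omega>] sigma_pos by (simp add: divide_right_mono)
    have "0 \<le> m (W \<omega>)" using mod[of 0 "W \<omega>"] D_nonneg sigma_pos by auto
    then have pos: "0 \<le> 4 * (D / \<sigma>) * (1 + \<bar>W \<omega>\<bar>) + m (W \<omega>)" using D_nonneg sigma_pos by auto
    have "\<bar>T i \<omega>\<bar> \<le> \<bar>R i \<omega> / \<sigma>\<bar> * (4 * (D / \<sigma>) * (1 + \<bar>W \<omega>\<bar>) + m (W \<omega>))"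
      unfolding T_def F'_def by (rule stein_taylor[where f=f and g=g and b="D / \<sigma>" and m="m (W \<omega>)"])
         (use f f_le f'_le mod r in auto)
    also have "\<dots> \<le> (D / \<sigma>) * (4 * (D / \<sigma>) * (1 + \<bar>W \<omega>\<bar>) + m (W \<omega>))"
      using r pos by (intro mult_right_mono) auto
    finally show ?thesis .
  qed
  have dm: "d i \<in> borel_measurable M" if "i \<in> I" for i
    unfolding d_def using that by measurable
  have di: "integrable M (d i)" if "i \<in> I" for i
    unfolding d_def
    by (rule integrable_bdd_mult[OF x_meas[OF that] x_bound[OF that] _ f_le]) (use that in measurable)
  have d0: "expectation (d i) = 0" if i: "i \<in> I" for i
  proof -
    have "continuous_on UNIV (\<lambda>y. f (y / \<sigma>))"
    proof (rule continuous_on_compose2[OF fc])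
      show "continuous_on UNIV (\<lambda>y. y / \<sigma>)" using sigma_pos by (intro continuous_intros) auto
    qed simp
    from decouple[OF i this] show ?thesis
      by (simp add: d_def[abs_def] W_def diff_divide_distrib)
  qed
  have ai: "integrable M a" unfolding a_def
  proof (rule integrable_bdd_mult)
    show "\<bar>F' (W \<omega>)\<bar> \<le> 4" for \<omega> using f'_le by (simp add: F'_def)
    show "\<bar>1 - Q \<omega> / V\<bar> \<le> 1 + card I * D / V" for \<omega>
    proof -
      have "\<bar>Q \<omega> / V\<bar> \<le> card I * D / V" using Q_bound[of \<omega>] V_pos by (simp add: divide_right_mono)
      then show ?thesis by linarith
    qed
  qed simp_all
  have Tm: "(\<lambda>\<omega>. \<Sum>i\<in>I. x i \<omega> * T i \<omega>) \<in> borel_measurable M"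
    unfolding T_def by measurable
  let ?b = "\<lambda>\<omega>. (D / \<sigma>) * (4 * (D / \<sigma>) * ((S \<omega> + 2 * n) * (1 + \<bar>W \<omega>\<bar>)) + (S \<omega> + 2 * n) * m (W \<omega>))"
  have w1: "integrable M (\<lambda>\<omega>. (S \<omega> + 2 * n) * (1 + \<bar>W \<omega>\<bar>))"
    by (rule integrable_weight[where B="1 + card I / \<sigma>"]) auto
  have w2: "integrable M (\<lambda>\<omega>. (S \<omega> + 2 * n) * m (W \<omega>))"
    by (rule integrable_weight[OF m m_le])
  have bi: "integrable M ?b" using w1 w2 by (intro integrable_mult_right Bochner_Integration.integrable_add)
  have sum_le: "\<bar>\<Sum>i\<in>I. x i \<omega> * T i \<omega>\<bar> \<le> ?b \<omega>" for \<omega>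
  proof -
    let ?t = "(D / \<sigma>) * (4 * (D / \<sigma>) * (1 + \<bar>W \<omega>\<bar>) + m (W \<omega>))"
    have "0 \<le> m (W \<omega>)" using mod[of 0 "W \<omega>"] D_nonneg sigma_pos by auto
    then have pos: "0 \<le> ?t" using D_nonneg sigma_pos by auto
    have "\<bar>\<Sum>i\<in>I. x i \<omega> * T i \<omega>\<bar> \<le> (\<Sum>i\<in>I. \<bar>x i \<omega>\<bar> * \<bar>T i \<omega>\<bar>)"
      unfolding abs_mult[symmetric] by (rule sum_abs)
    also have "\<dots> \<le> (\<Sum>i\<in>I. \<bar>x i \<omega>\<bar> * ?t)" by (intro sum_mono mult_left_mono T_le) auto
    also have "\<dots> = (\<Sum>i\<in>I. \<bar>x i \<omega>\<bar>) * ?t" by (rule sum_distrib_right[symmetric])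
    also have "\<dots> \<le> (S \<omega> + 2 * n) * ?t" using sum_abs_x_le pos by (rule mult_right_mono)
    also have "\<dots> = ?b \<omega>" by (simp only: distrib_left mult_ac)
    finally show ?thesis .
  qed
  have Ti: "integrable M (\<lambda>\<omega>. \<Sum>i\<in>I. x i \<omega> * T i \<omega>)"
  proof (rule Bochner_Integration.integrable_bound[OF bi Tm], rule AE_I2)
    show "norm (\<Sum>i\<in>I. x i \<omega> * T i \<omega>) \<le> norm (?b \<omega>)" for \<omega>
      unfolding real_norm_def by (rule order.trans[OF sum_le abs_ge_self])
  qed
  have "expectation (\<lambda>\<omega>. g (W \<omega>)) = expectation a - (1 / \<sigma>) * expectation (\<lambda>\<omega>. \<Sum>i\<in>I. x i \<omega> * T i \<omega>)"
    unfolding decomp using ai Ti di d0 by (simp add: Bochner_Integration.integral_sum)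
  moreover have "\<bar>expectation a\<bar> \<le> 4 * (2 * sqrt (D ^ 3 / c) / \<sigma>)"
  proof -
    have "\<bar>a \<omega>\<bar> \<le> 4 * \<bar>1 - Q \<omega> / V\<bar>" for \<omega>
      unfolding a_def abs_mult using f'_le by (intro mult_right_mono) (auto simp: F'_def)
    moreover have "integrable M (\<lambda>\<omega>. 4 * \<bar>1 - Q \<omega> / V\<bar>)"
    proof (intro integrable_mult_right integrable_abs)
      have "integrable M Q" by (rule integrable_bounded[OF Q_meas Q_bound])
      then show "integrable M (\<lambda>\<omega>. 1 - Q \<omega> / V)" by simp
    qed
    ultimately have "\<bar>expectation a\<bar> \<le> expectation (\<lambda>\<omega>. 4 * \<bar>1 - Q \<omega> / V\<bar>)"
      using ai by (intro abs_expectation_le) auto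
    also have "\<dots> \<le> 4 * (2 * sqrt (D ^ 3 / c) / \<sigma>)" using stein_first_term by simp
    finally show ?thesis .
  qed
  moreover have "\<bar>(1 / \<sigma>) * expectation (\<lambda>\<omega>. \<Sum>i\<in>I. x i \<omega> * T i \<omega>)\<bar> \<le>
      (4 * D\<^sup>2 + 16 * D\<^sup>2 / c) / \<sigma> + D / V * expectation (\<lambda>\<omega>. (S \<omega> + 2 * n) * m (W \<omega>))"
  proof -
    \<comment> \<open>Here \<open>S = \<sigma> * W\<close> has mean 0,
      \<open>S * \<bar>W\<bar>\<close> is at most \<open>\<sigma> * W^2\<close> with mean \<sigma>,
      and \<open>\<bar>W\<bar>\<close> has mean at most 1.\<close>
    have w3: "expectation (\<lambda>\<omega>. (S \<omega> + 2 * n) * (1 + \<bar>W \<omega>\<bar>)) \<le> \<sigma> + 4 * n"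
    proof -
      have "expectation (\<lambda>\<omega>. (S \<omega> + 2 * n) * (1 + \<bar>W \<omega>\<bar>)) \<le>
          expectation (\<lambda>\<omega>. \<sigma> * W \<omega> + \<sigma> * (W \<omega>)\<^sup>2 + (2 * n + 2 * n * \<bar>W \<omega>\<bar>))"
      proof (rule integral_mono[OF w1])
        show "(S \<omega> + 2 * n) * (1 + \<bar>W \<omega>\<bar>) \<le> \<sigma> * W \<omega> + \<sigma> * (W \<omega>)\<^sup>2 + (2 * n + 2 * n * \<bar>W \<omega>\<bar>)" for \<omega>
        proof -
          have "W \<omega> * \<bar>W \<omega>\<bar> \<le> (W \<omega>)\<^sup>2" by (simp add: power2_eq_square abs_if)
          then have "\<sigma> * (W \<omega> * \<bar>W \<omega>\<bar>) \<le> \<sigma> * (W \<omega>)\<^sup>2" using sigma_pos by (intro mult_left_mono) auto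
          then show ?thesis unfolding S_eq by (simp add: algebra_simps)
        qed
      qed (use integrable_W integrable_W2 in auto)
      also have "\<dots> = \<sigma> + 2 * n + 2 * n * expectation (\<lambda>\<omega>. \<bar>W \<omega>\<bar>)"
        using integrable_W integrable_W2 expectation_W expectation_W2 by (simp add: prob_space)
      also have "\<dots> \<le> \<sigma> + 2 * n + 2 * n * 1"
        using expectation_abs_W n_nonneg by (intro add_left_mono mult_left_mono) auto
      finally show ?thesis by simp
    qed
    have "\<bar>expectation (\<lambda>\<omega>. \<Sum>i\<in>I. x i \<omega> * T i \<omega>)\<bar> \<le> expectation ?b"
      using Ti bi sum_le by (rule abs_expectation_le)
    also have "\<dots> = (D / \<sigma>) * (4 * (D / \<sigma>) * expectation (\<lambda>\<omega>. (S \<omega> + 2 * n) * (1 + \<bar>W \<omega>\<bar>))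
        + expectation (\<lambda>\<omega>. (S \<omega> + 2 * n) * m (W \<omega>)))"
      using w1 w2 by simp
    also have "\<dots> \<le> (D / \<sigma>) * (4 * (D / \<sigma>) * (\<sigma> + 4 * n) + expectation (\<lambda>\<omega>. (S \<omega> + 2 * n) * m (W \<omega>)))"
      using w3 D_nonneg sigma_pos by (intro mult_left_mono add_right_mono) auto
    finally have "\<bar>expectation (\<lambda>\<omega>. \<Sum>i\<in>I. x i \<omega> * T i \<omega>)\<bar> \<le>
       (D / \<sigma>) * (4 * (D / \<sigma>) * (\<sigma> + 4 * n) + expectation (\<lambda>\<omega>. (S \<omega> + 2 * n) * m (W \<omega>)))" .
    then have "\<bar>(1 / \<sigma>) * expectation (\<lambda>\<omega>. \<Sum>i\<in>I. x i \<omega> * T i \<omega>)\<bar> \<le>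
       (1 / \<sigma>) * ((D / \<sigma>) * (4 * (D / \<sigma>) * (\<sigma> + 4 * n) + expectation (\<lambda>\<omega>. (S \<omega> + 2 * n) * m (W \<omega>))))"
      unfolding abs_mult using sigma_pos by (intro mult_mono) auto
    also have "\<dots> = 4 * D\<^sup>2 * (1 / V) + 16 * D\<^sup>2 * (n / V) / \<sigma> + D / V * expectation (\<lambda>\<omega>. (S \<omega> + 2 * n) * m (W \<omega>))"
      unfolding sigma_sq[symmetric] using sigma_pos
      by (simp add: power2_eq_square field_simps)
    also have "\<dots> \<le> 4 * D\<^sup>2 * (1 / \<sigma>) + 16 * D\<^sup>2 * (1 / c) / \<sigma> + D / V * expectation (\<lambda>\<omega>. (S \<omega> + 2 * n) * m (W \<omega>))"
    proof -
      \<comment> \<open>The assumption \<open>1 \<le> \<sigma>\<close> enters here.\<close>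
      have "1 / V \<le> 1 / \<sigma>"
        using \<sigma> unfolding sigma_sq[symmetric] by (simp add: power2_eq_square frac_le)
      then show ?thesis using n_div_V sigma_pos
        by (intro add_mono order_refl mult_left_mono divide_right_mono) auto
    qed
    finally show ?thesis by (simp add: add_divide_distrib)
  qed
  ultimately have "\<bar>expectation (\<lambda>\<omega>. g (W \<omega>))\<bar> \<le> 4 * (2 * sqrt (D ^ 3 / c) / \<sigma>) +
      ((4 * D\<^sup>2 + 16 * D\<^sup>2 / c) / \<sigma> + D / V * expectation (\<lambda>\<omega>. (S \<omega> + 2 * n) * m (W \<omega>)))"
    by linarith
  then show ?thesis unfolding A_def by (simp add: add_divide_distrib)
qed

section \<open>Wasserstein and Kolmogorov bounds for the standardised sum\<close>

lemma lipschitz_distance: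
  assumes lip: "\<And>y z. \<bar>h y - h z\<bar> \<le> \<bar>y - z\<bar>"
  shows "\<bar>expectation (\<lambda>\<omega>. h (W \<omega>)) - Nint h\<bar> \<le> (A + 2 * D\<^sup>2 / c + 5) / \<sigma>"
proof -
  have cont: "continuous_on UNIV h"
    by (rule lipschitz_on_continuous_on[where L=1]) (use lip in \<open>auto simp: lipschitz_on_def dist_real_def\<close>)
  have [measurable]: "h \<in> borel_measurable borel" using cont by (rule borel_measurable_continuous_onI)
  have hi: "integrable M (\<lambda>\<omega>. h (W \<omega>))"
  proof (rule integrable_bounded)
    show "\<bar>h (W \<omega>)\<bar> \<le> \<bar>h 0\<bar> + card I / \<sigma>" for \<omega>
      using lip[of "W \<omega>" 0] W_bound[of \<omega>] by linarith
  qed simp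
  obtain f where f: "\<And>y. (f has_real_derivative y * f y + (h y - Nint h)) (at y)"
      "\<And>y. \<bar>f y\<bar> \<le> 4" "\<And>y. \<bar>y * f y + (h y - Nint h)\<bar> \<le> 4"
    using stein_solution[OF cont] lip by blast
  have eq: "expectation (\<lambda>\<omega>. h (W \<omega>) - Nint h) = expectation (\<lambda>\<omega>. h (W \<omega>)) - Nint h"
    using hi by (simp add: prob_space)
  show ?thesis
  proof (cases "1 \<le> \<sigma>")
    case True
    have "\<bar>expectation (\<lambda>\<omega>. h (W \<omega>) - Nint h)\<bar> \<le> A / \<sigma> + D / V * expectation (\<lambda>\<omega>. (S \<omega> + 2 * n) * (D / \<sigma>))"
    \<comment> \<open>A Lipschitz function has the constant modulus \<open>D / \<sigma>\<close>, so
      the weight is simply averaged and contributes its mean \<open>2 * n\<close>.\<close>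
    proof (rule stein_bound[where f=f and g="\<lambda>y. h y - Nint h" and m="\<lambda>_. D / \<sigma>" and B="D / \<sigma>"])
      show "continuous_on UNIV (\<lambda>y. h y - Nint h)" using cont by (intro continuous_intros)
      show "\<bar>h (w - s) - Nint h - (h w - Nint h)\<bar> \<le> D / \<sigma>" if "\<bar>s\<bar> \<le> D / \<sigma>" for w s
        using lip[of "w - s" w] that by simp
    qed (use f True D_nonneg in auto)
    also have "expectation (\<lambda>\<omega>. (S \<omega> + 2 * n) * (D / \<sigma>)) = 2 * n * (D / \<sigma>)"
      using expectation_S integrable_bounded[OF S_meas S_bound] by (simp add: prob_space)
    also have "A / \<sigma> + D / V * (2 * n * (D / \<sigma>)) = (A + 2 * D\<^sup>2 * (n / V)) / \<sigma>"
      using sigma_pos V_pos by (simp add: power2_eq_square field_simps)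
    also have "\<dots> \<le> (A + 2 * D\<^sup>2 * (1 / c) + 5) / \<sigma>"
    proof (rule divide_right_mono)
      have "2 * D\<^sup>2 * (n / V) \<le> 2 * D\<^sup>2 * (1 / c)" using n_div_V by (intro mult_left_mono) auto
      then show "A + 2 * D\<^sup>2 * (n / V) \<le> A + 2 * D\<^sup>2 * (1 / c) + 5" by simp
    qed (use sigma_pos in simp)
    finally show ?thesis unfolding eq by simp
  next
    case False
    \<comment> \<open>For \<sigma> below 1 a bound by a constant suffices. At 0 Stein's equation
      reads f' (0) = h 0 - Nint h, which gives 4; the first absolute moment of \<open>W\<close>
      gives 1 more.\<close>
    have "\<bar>expectation (\<lambda>\<omega>. h (W \<omega>) - Nint h)\<bar> \<le> 5"
    proof -
      have "\<bar>h 0 - Nint h\<bar> \<le> 4" using f(3)[of 0] by simp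
      moreover have "\<bar>expectation (\<lambda>\<omega>. h (W \<omega>) - h 0)\<bar> \<le> expectation (\<lambda>\<omega>. \<bar>W \<omega>\<bar>)"
        using lip[of _ 0] hi integrable_W by (intro abs_expectation_le) auto
      moreover have "expectation (\<lambda>\<omega>. h (W \<omega>) - Nint h) = expectation (\<lambda>\<omega>. h (W \<omega>) - h 0) + (h 0 - Nint h)"
        using hi by (simp add: prob_space)
      ultimately show ?thesis using expectation_abs_W by linarith
    qed
    also have "5 \<le> (A + 2 * D\<^sup>2 / c + 5) / \<sigma>"
    proof -
      have "5 * \<sigma> \<le> 5" using False by simp
      also have "5 \<le> A + 2 * D\<^sup>2 / c + 5" using A_nonneg c_pos by simp
      finally show ?thesis using sigma_pos by (simp add: pos_le_divide_eq)
    qed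
    finally show ?thesis unfolding eq .
  qed
qed

text \<open>The function \<open>h\<close> falls linearly from 1 at \<open>z\<close> to 0 at
  \<open>z + \<epsilon>\<close>, so a shift by at most \<open>b = D / \<sigma>\<close> changes it
  only on the window \<open>J\<close>, and there by at most \<open>b / \<epsilon>\<close>. The
  probability of the window is compared with the Gaussian one, which brings the unknown distance
  \<Delta> to the right-hand side.\<close>

lemma smooth_step_distance:
  fixes \<epsilon> \<Delta> z :: real
  defines "h \<equiv> \<lambda>w. max 0 (min 1 (1 - (w - z) / \<epsilon>))"
  assumes \<epsilon>: "0 < \<epsilon>" and \<sigma>: "1 \<le> \<sigma>"
    and \<Delta>: "\<And>t. \<bar>prob {\<omega>\<in>space M. W \<omega> \<le> t} - Phi t\<bar> \<le> \<Delta>"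
  shows "\<bar>expectation (\<lambda>\<omega>. h (W \<omega>)) - Nint h\<bar> \<le>
    A / \<sigma> + D\<^sup>2 / (\<sigma> * \<epsilon>) * (1 / \<sigma> + 4 / c * (\<epsilon> + D / \<sigma> + \<Delta>))"
proof -
  have hc: "continuous_on UNIV h" unfolding h_def using \<epsilon> by (intro continuous_intros) auto
  have [measurable]: "h \<in> borel_measurable borel" using hc by (rule borel_measurable_continuous_onI)
  have h01: "0 \<le> h w" "h w \<le> 1" for w by (auto simp: h_def)
  obtain f where f: "\<And>y. (f has_real_derivative y * f y + (h y - Nint h)) (at y)"
      "\<And>y. \<bar>f y\<bar> \<le> 4" "\<And>y. \<bar>y * f y + (h y - Nint h)\<bar> \<le> 4"
    using stein_solution[OF hc] h01 by blast
  have hi: "integrable M (\<lambda>\<omega>. h (W \<omega>))" by (rule integrable_bounded[where b=1]) (use h01 in auto)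
  define b where "b = D / \<sigma>"
  have b0: "0 \<le> b" using D_nonneg sigma_pos by (simp add: b_def)
  define J where "J = {z - b..z + \<epsilon> + b}"
  define m where "m w = b / \<epsilon> * indicator J w" for w :: real
  have [measurable]: "m \<in> borel_measurable borel" unfolding m_def J_def by measurable
  have hlip: "\<bar>h u - h v\<bar> \<le> \<bar>u - v\<bar> / \<epsilon>" for u v
  proof -
    have "\<bar>h u - h v\<bar> \<le> \<bar>(u - z) / \<epsilon> - (v - z) / \<epsilon>\<bar>"
    proof -
      have "\<bar>max 0 (min 1 (1 - a)) - max 0 (min 1 (1 - b))\<bar> \<le> \<bar>a - b\<bar>" for a b :: real
        by linarith
      then show ?thesis unfolding h_def .
    qed
    also have "\<dots> = \<bar>u - v\<bar> / \<epsilon>" using \<epsilon> by (simp add: diff_divide_distrib[symmetric])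
    finally show ?thesis .
  qed
  have h1: "h w = 1" if "w \<le> z" for w using that \<epsilon> by (auto simp: h_def divide_nonpos_pos)
  have h0: "h w = 0" if "z + \<epsilon> \<le> w" for w using that \<epsilon> by (auto simp: h_def le_divide_eq)
  have mod: "\<bar>h (w - s) - Nint h - (h w - Nint h)\<bar> \<le> m w" if s: "\<bar>s\<bar> \<le> D / \<sigma>" for w s
  proof (cases "w \<in> J")
    case True
    have "\<bar>h (w - s) - h w\<bar> \<le> \<bar>w - s - w\<bar> / \<epsilon>" by (rule hlip)
    also have "\<dots> \<le> b / \<epsilon>" using s \<epsilon> by (intro divide_right_mono) (auto simp: b_def)
    finally show ?thesis using True by (simp add: m_def)
  next
    case False
    then have "w \<le> z - b \<or> z + \<epsilon> + b \<le> w" by (auto simp: J_def)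
    then have "h (w - s) = h w"
    proof
      assume "w \<le> z - b"
      then have "w \<le> z" "w - s \<le> z" using s b0 by (auto simp: b_def)
      then show ?thesis by (simp add: h1)
    next
      assume "z + \<epsilon> + b \<le> w"
      then have "z + \<epsilon> \<le> w" "z + \<epsilon> \<le> w - s" using s b0 by (auto simp: b_def)
      then show ?thesis by (simp add: h0)
    qed
    then show ?thesis using False by (simp add: m_def)
  qed
  have m_le: "\<bar>m w\<bar> \<le> b / \<epsilon>" for w using b0 \<epsilon> by (auto simp: m_def indicator_def)
  have stein: "\<bar>expectation (\<lambda>\<omega>. h (W \<omega>) - Nint h)\<bar> \<le> A / \<sigma> + D / V * expectation (\<lambda>\<omega>. (S \<omega> + 2 * n) * m (W \<omega>))"
    by (rule stein_bound[where f=f and g="\<lambda>y. h y - Nint h", OF f _ _ m_le mod \<sigma>])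
       (use hc in \<open>auto intro!: continuous_intros\<close>)
  have weight: "expectation (\<lambda>\<omega>. (S \<omega> + 2 * n) * m (W \<omega>)) \<le> b / \<epsilon> * (\<sigma> + 2 * n * (2 * \<epsilon> + 2 * b + 2 * \<Delta>))"
  proof -
    let ?E = "{\<omega>\<in>space M. W \<omega> \<in> J}"
    have Em: "?E \<in> events" unfolding J_def by measurable
    have Ei: "integrable M (indicat_real ?E)"
      by (rule integrable_bounded[where b=1]) (use Em in \<open>auto simp: indicator_def\<close>)
    have "expectation (\<lambda>\<omega>. (S \<omega> + 2 * n) * m (W \<omega>)) \<le>
        expectation (\<lambda>\<omega>. b / \<epsilon> * (\<sigma> * \<bar>W \<omega>\<bar> + 2 * n * indicator ?E \<omega>))"
    proof (rule integral_mono)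
      show "integrable M (\<lambda>\<omega>. (S \<omega> + 2 * n) * m (W \<omega>))" by (rule integrable_weight[OF _ m_le]) simp
      show "integrable M (\<lambda>\<omega>. b / \<epsilon> * (\<sigma> * \<bar>W \<omega>\<bar> + 2 * n * indicator ?E \<omega>))"
        using integrable_W Ei by (intro integrable_mult_right Bochner_Integration.integrable_add) auto
      fix \<omega> assume w: "\<omega> \<in> space M"
      \<comment> \<open>The indicator is retained only with \<open>2 * n\<close>. Without it the
        part with \<open>S\<close> costs at most \<sigma>, because \<open>\<bar>W\<bar>\<close> has
        mean at most 1.\<close>
      have "(S \<omega> + 2 * n) * indicator J (W \<omega>) \<le> \<sigma> * \<bar>W \<omega>\<bar> + 2 * n * indicator ?E \<omega>"
        using sigma_pos w unfolding S_eq by (auto simp: indicator_def)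
      then have "b / \<epsilon> * ((S \<omega> + 2 * n) * indicator J (W \<omega>)) \<le> b / \<epsilon> * (\<sigma> * \<bar>W \<omega>\<bar> + 2 * n * indicator ?E \<omega>)"
        using b0 \<epsilon> by (intro mult_left_mono) auto
      then show "(S \<omega> + 2 * n) * m (W \<omega>) \<le> b / \<epsilon> * (\<sigma> * \<bar>W \<omega>\<bar> + 2 * n * indicator ?E \<omega>)"
        by (simp add: m_def mult_ac)
    qed
    also have "\<dots> = b / \<epsilon> * (\<sigma> * expectation (\<lambda>\<omega>. \<bar>W \<omega>\<bar>) + 2 * n * prob ?E)"
      using integrable_W Em Ei by simp
    also have "\<dots> \<le> b / \<epsilon> * (\<sigma> * 1 + 2 * n * (2 * \<epsilon> + 2 * b + 2 * \<Delta>))"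
    proof -
      \<comment> \<open>\<open>J\<close> is closed, so the left endpoint is moved outwards by
        \<epsilon> to lie strictly to the left of it; the interval then has length
        \<open>2 * \<epsilon> + 2 * b\<close>.\<close>
      let ?u = "z + \<epsilon> + b" and ?l = "z - b - \<epsilon>"
      have "prob ?E \<le> prob ({\<omega>\<in>space M. W \<omega> \<le> ?u} - {\<omega>\<in>space M. W \<omega> \<le> ?l})"
        using \<epsilon> by (intro finite_measure_mono) (auto simp: J_def)
      also have "\<dots> = prob {\<omega>\<in>space M. W \<omega> \<le> ?u} - prob {\<omega>\<in>space M. W \<omega> \<le> ?l}"
        using \<epsilon> b0 by (intro finite_measure_Diff) auto
      also have "\<dots> \<le> (Phi ?u - Phi ?l) + 2 * \<Delta>" using \<Delta>[of ?u] \<Delta>[of ?l] by linarith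
      also have "Phi ?u - Phi ?l \<le> ?u - ?l" using \<epsilon> b0 by (intro Phi_increment) auto
      finally have "prob ?E \<le> 2 * \<epsilon> + 2 * b + 2 * \<Delta>" by simp
      then show ?thesis using expectation_abs_W n_nonneg sigma_pos b0 \<epsilon>
        by (intro mult_left_mono add_mono) auto
    qed
    finally show ?thesis by simp
  qed
  note stein
  also have "A / \<sigma> + D / V * expectation (\<lambda>\<omega>. (S \<omega> + 2 * n) * m (W \<omega>)) \<le>
      A / \<sigma> + D / V * (b / \<epsilon> * (\<sigma> + 2 * n * (2 * \<epsilon> + 2 * b + 2 * \<Delta>)))"
    using weight D_nonneg V_pos by (intro add_left_mono mult_left_mono) auto
  also have "A / \<sigma> + D / V * (b / \<epsilon> * (\<sigma> + 2 * n * (2 * \<epsilon> + 2 * b + 2 * \<Delta>))) =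
      A / \<sigma> + D\<^sup>2 / (\<sigma> * \<epsilon>) * (\<sigma> / V + 4 * (n / V) * (\<epsilon> + b + \<Delta>))"
    using sigma_pos V_pos \<epsilon> by (simp add: b_def power2_eq_square field_simps)
  also have "\<dots> \<le> A / \<sigma> + D\<^sup>2 / (\<sigma> * \<epsilon>) * (1 / \<sigma> + 4 * (1 / c) * (\<epsilon> + b + \<Delta>))"
  proof -
    have "0 \<le> \<Delta>" using \<Delta>[of 0] by linarith
    moreover have "\<sigma> / V = 1 / \<sigma>" unfolding sigma_sq[symmetric] by (simp add: power2_eq_square)
    ultimately show ?thesis using n_div_V b0 \<epsilon> sigma_pos
      by (intro add_mono mult_left_mono mult_right_mono order_refl) auto
  qed
  finally show ?thesis using hi by (simp add: prob_space b_def)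
qed

text \<open>With \<open>\<epsilon> = \<theta> / \<sigma>\<close> the coefficient of \<Delta> in
  \<open>smooth_step_distance\<close> is \<open>4 * D^2 / (c * \<theta>)\<close>, free of \<sigma>;
  the first summand of \<theta> makes it at most 1/2, the second ensures
  \<open>1 \<le> \<theta>\<close>.\<close>

definition \<theta> :: real where "\<theta> = 8 * D\<^sup>2 / c + 1"

text \<open>A smoothed step lies between the indicators of the half-lines up to \<open>z\<close> and
  up to \<open>z + \<epsilon>\<close>. This bounds \<Delta> by the smoothing error plus \<epsilon>,
  and since \<Delta> is finite and occurs on the right with coefficient at most 1/2, it can be
  absorbed.\<close>

lemma kolmogorov_distance:
  "\<bar>prob {\<omega>\<in>space M. W \<omega> \<le> t} - Phi t\<bar> \<le> (2 * A + 2 * D\<^sup>2 + 3 * \<theta> + D + 1) / \<sigma>"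
proof -
  interpret N: prob_space std_normal_distribution by (rule prob_space_normal_density) simp
  have Phi01: "0 \<le> Phi z" "Phi z \<le> 1" for z by (auto simp: Phi_def)
  define P where "P z = prob {\<omega>\<in>space M. W \<omega> \<le> z}" for z
  have P01: "0 \<le> P z" "P z \<le> 1" for z by (auto simp: P_def)
  have trivial: "\<bar>P z - Phi z\<bar> \<le> 1" for z using Phi01[of z] P01[of z] by linarith
  have \<theta>1: "1 \<le> \<theta>" using c_pos by (simp add: \<theta>_def)
  show ?thesis
  proof (cases "1 \<le> \<sigma>")
    case False
    have "\<sigma> \<le> 2 * A + 2 * D\<^sup>2 + 3 * \<theta> + D + 1" using False A_nonneg D_nonneg \<theta>1 zero_le_power2[of D] by linarith
    then have "1 \<le> (2 * A + 2 * D\<^sup>2 + 3 * \<theta> + D + 1) / \<sigma>" using sigma_pos by simp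
    then show ?thesis using trivial[of t] by (simp add: P_def)
  next
    case True
    define \<Delta> where "\<Delta> = (SUP z. \<bar>P z - Phi z\<bar>)"
    have bdd: "bdd_above (range (\<lambda>z. \<bar>P z - Phi z\<bar>))" using trivial by (intro bdd_aboveI[where M=1]) auto
    have \<Delta>: "\<bar>P z - Phi z\<bar> \<le> \<Delta>" for z unfolding \<Delta>_def by (rule cSUP_upper[OF _ bdd]) simp
    define \<epsilon> where "\<epsilon> = \<theta> / \<sigma>"
    have \<epsilon>: "0 < \<epsilon>" using \<theta>1 sigma_pos by (simp add: \<epsilon>_def)
    define err where "err = A / \<sigma> + D\<^sup>2 / (\<sigma> * \<epsilon>) * (1 / \<sigma> + 4 / c * (\<epsilon> + D / \<sigma> + \<Delta>))"
    define h where "h z w = max 0 (min 1 (1 - (w - z) / \<epsilon>))" for z w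
    have hc: "continuous_on UNIV (h z)" for z unfolding h_def using \<epsilon> by (intro continuous_intros) auto
    have [measurable]: "h z \<in> borel_measurable borel" for z using hc by (rule borel_measurable_continuous_onI)
    have err: "\<bar>expectation (\<lambda>\<omega>. h z (W \<omega>)) - Nint (h z)\<bar> \<le> err" for z
      unfolding h_def err_def by (rule smooth_step_distance[OF \<epsilon> True]) (use \<Delta> in \<open>simp add: P_def\<close>)
    have h_lower: "indicator {..z} w \<le> h z w" and h_upper: "h z w \<le> indicator {..z + \<epsilon>} w" for z w
      using \<epsilon> by (auto simp: h_def indicator_def divide_nonpos_pos le_divide_eq)
    have h01: "0 \<le> h z w" "h z w \<le> 1" for z w by (auto simp: h_def)
    have hi: "integrable M (\<lambda>\<omega>. h z (W \<omega>))" for z by (rule integrable_bounded[where b=1]) (use h01 in auto)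
    have hiN: "integrable std_normal_distribution (h z)" for z
      by (rule N.integrable_const_bound[where B=1]) (use h01 in auto)
    have iN: "integrable std_normal_distribution (indicator {..z} :: real \<Rightarrow> real)" for z
      by (rule N.integrable_const_bound[where B=1]) auto
    have iM: "integrable M (\<lambda>\<omega>. indicator {..z} (W \<omega>) :: real)" for z
      by (rule integrable_bounded[where b=1]) (auto simp: indicator_def)
    have P_eq: "P z = expectation (\<lambda>\<omega>. indicator {..z} (W \<omega>))" for z
    proof -
      have "expectation (\<lambda>\<omega>. indicat_real {..z} (W \<omega>)) = expectation (indicat_real {\<omega>\<in>space M. W \<omega> \<le> z})"
        by (intro Bochner_Integration.integral_cong) (auto simp: indicator_def)
      then show ?thesis by (simp add: P_def)
    qed
    have Phi_eq: "Phi z = Nint (indicator {..z})" for z by (simp add: Phi_def)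
    have E1: "P z \<le> expectation (\<lambda>\<omega>. h z (W \<omega>))" for z
      unfolding P_eq using h_lower by (intro integral_mono iM hi)
    have E2: "expectation (\<lambda>\<omega>. h z (W \<omega>)) \<le> P (z + \<epsilon>)" for z
      unfolding P_eq using h_upper by (intro integral_mono iM hi)
    have N1: "Phi z \<le> Nint (h z)" for z
      unfolding Phi_eq using h_lower by (intro integral_mono iN hiN)
    have N2: "Nint (h z) \<le> Phi (z + \<epsilon>)" for z
      unfolding Phi_eq using h_upper by (intro integral_mono iN hiN)
    \<comment> \<open>The step starting at \<open>z\<close> gives the upper estimate of
      \<open>P z\<close>, the step ending at \<open>z\<close> the lower one; \<open>Phi\<close>
      changes by at most \<epsilon> over the smoothing interval.\<close>
    have "\<bar>P z - Phi z\<bar> \<le> err + \<epsilon>" for z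
      using E1[of z] E2[of "z - \<epsilon>"] N1[of "z - \<epsilon>"] N2[of z] err[of z] err[of "z - \<epsilon>"] \<epsilon>
        Phi_increment[of z "z + \<epsilon>"] Phi_increment[of "z - \<epsilon>" z]
      by simp
    then have "\<Delta> \<le> err + \<epsilon>" unfolding \<Delta>_def by (intro cSUP_least) auto
    also have "err \<le> A / \<sigma> + D\<^sup>2 / \<sigma> + (1 / 2) * (\<epsilon> + D / \<sigma> + \<Delta>)"
    proof -
      have \<Delta>0: "0 \<le> \<Delta>" using \<Delta>[of 0] by linarith
      have "D\<^sup>2 / (\<sigma> * \<epsilon>) = D\<^sup>2 / \<theta>" using sigma_pos by (simp add: \<epsilon>_def)
      then have "err = A / \<sigma> + D\<^sup>2 / \<theta> * (1 / \<sigma>) + (D\<^sup>2 / \<theta> * (4 / c)) * (\<epsilon> + D / \<sigma> + \<Delta>)"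
        by (simp only: err_def distrib_left mult.assoc add.assoc)
      also have "\<dots> \<le> A / \<sigma> + D\<^sup>2 * (1 / \<sigma>) + (1 / 2) * (\<epsilon> + D / \<sigma> + \<Delta>)"
      proof (intro add_mono mult_right_mono order_refl)
        show "D\<^sup>2 / \<theta> \<le> D\<^sup>2" using \<theta>1 by (simp add: divide_le_eq mult_le_cancel_left1)
        show "D\<^sup>2 / \<theta> * (4 / c) \<le> 1 / 2"
          using \<theta>1 c_pos by (simp add: divide_le_eq) (simp add: \<theta>_def field_simps)
      qed (use sigma_pos \<epsilon> D_nonneg \<Delta>0 in auto)
      finally show ?thesis by simp
    qed
    \<comment> \<open>Half of \<Delta> is moved to the left and the inequality doubled; the
      \<epsilon> inside the error and the separate \<epsilon> give the 3 in
      \<open>3 * \<theta>\<close>.\<close>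
    finally have "\<Delta> \<le> (2 * A + 2 * D\<^sup>2 + 3 * \<theta> + D) / \<sigma>"
      unfolding \<epsilon>_def by (simp add: add_divide_distrib)
    also have "\<dots> \<le> (2 * A + 2 * D\<^sup>2 + 3 * \<theta> + D + 1) / \<sigma>" using sigma_pos by (simp add: divide_right_mono)
    finally show ?thesis using \<Delta>[of t] by (simp add: P_def)
  qed
qed

lemma normal_approximation:
  "\<bar>prob {\<omega>\<in>space M. W \<omega> \<le> t} - Phi t\<bar> \<le> clt_const D c / \<sigma>"
  "(\<And>y z. \<bar>h y - h z\<bar> \<le> \<bar>y - z\<bar>) \<Longrightarrow> \<bar>expectation (\<lambda>\<omega>. h (W \<omega>)) - Nint h\<bar> \<le> clt_const D c / \<sigma>"
proof -
  have eq: "clt_const D c = 2 * A + 2 * D\<^sup>2 + 3 * \<theta> + D + 5 + 2 * D\<^sup>2 / c"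
    by (simp add: clt_const_def A_def \<theta>_def)
  have pos: "0 \<le> 2 * D\<^sup>2 / c" "0 \<le> D\<^sup>2" "0 \<le> \<theta>" using c_pos by (auto simp: \<theta>_def)
  have "(2 * A + 2 * D\<^sup>2 + 3 * \<theta> + D + 1) / \<sigma> \<le> clt_const D c / \<sigma>"
    using pos sigma_pos unfolding eq by (intro divide_right_mono) auto
  then show "\<bar>prob {\<omega>\<in>space M. W \<omega> \<le> t} - Phi t\<bar> \<le> clt_const D c / \<sigma>"
    using kolmogorov_distance[of t] by linarith
  have "(A + 2 * D\<^sup>2 / c + 5) / \<sigma> \<le> clt_const D c / \<sigma>"
    using pos A_nonneg D_nonneg sigma_pos unfolding eq by (intro divide_right_mono) auto
  then show "\<bar>expectation (\<lambda>\<omega>. h (W \<omega>)) - Nint h\<bar> \<le> clt_const D c / \<sigma>"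
    if "\<And>y z. \<bar>h y - h z\<bar> \<le> \<bar>y - z\<bar>"
    using lipschitz_distance[OF that] by linarith
qed

end

section \<open>Isolated cells\<close>

text \<open>\<open>Z c\<close> counts the points in the cell \<open>c\<close> of volume
  \<open>v c\<close>, \<open>cl\<close> is adjacency of cells, \<open>\<kappa>\<close> assigns
  centres and \<open>adj\<close> is adjacency of centres. Cells of one centre are pairwise close and
  close cells have adjacent centres, which makes the centres the vertices of a dependency graph.
  \<open>d\<close> and \<open>K\<close> are the quantities that stay fixed when the cells
  shrink.\<close>

locale poisson_cells = prob_space M for M :: "'w measure" +
  fixes C :: "'c set" and Z :: "'c \<Rightarrow> 'w \<Rightarrow> nat" and v :: "'c \<Rightarrow> real"
    and cl :: "'c \<Rightarrow> 'c \<Rightarrow> bool" and \<kappa> :: "'c \<Rightarrow> 'i" and I :: "'i set"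
    and adj :: "'i \<Rightarrow> 'i \<Rightarrow> bool" and d :: nat and K :: real
  assumes finite_C: "finite C" and finite_I: "finite I" and \<kappa>_in: "\<And>c. c \<in> C \<Longrightarrow> \<kappa> c \<in> I"
    and indep_Z: "indep_vars (\<lambda>_. count_space UNIV) Z C"
    and v_nonneg: "\<And>c. c \<in> C \<Longrightarrow> 0 \<le> v c"
    and prob_0: "\<And>A. A \<subseteq> C \<Longrightarrow>
          prob {\<omega>\<in>space M. (\<Sum>c\<in>A. Z c \<omega>) = 0} = exp (- (\<Sum>c\<in>A. v c))"
    and prob_1: "\<And>A. A \<subseteq> C \<Longrightarrow>
          prob {\<omega>\<in>space M. (\<Sum>c\<in>A. Z c \<omega>) = 1} = (\<Sum>c\<in>A. v c) * exp (- (\<Sum>c\<in>A. v c))"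
    and cl_class: "\<And>c c'. c \<in> C \<Longrightarrow> c' \<in> C \<Longrightarrow> \<kappa> c = \<kappa> c' \<Longrightarrow> cl c c'"
    and cl_sym: "\<And>c c'. c \<in> C \<Longrightarrow> c' \<in> C \<Longrightarrow> cl c c' \<Longrightarrow> cl c' c"
    and adj_refl: "\<And>i. i \<in> I \<Longrightarrow> adj i i"
    and adj_sym: "\<And>i j. i \<in> I \<Longrightarrow> j \<in> I \<Longrightarrow> adj i j \<Longrightarrow> adj j i"
    and cl_adj: "\<And>c c'. c \<in> C \<Longrightarrow> c' \<in> C \<Longrightarrow> cl c c' \<Longrightarrow> adj (\<kappa> c) (\<kappa> c')"
    and degree: "\<And>i. i \<in> I \<Longrightarrow> card {j\<in>I. adj i j} \<le> d"
    and mass: "\<And>i. i \<in> I \<Longrightarrow> (\<Sum>c\<in>{c\<in>C. \<kappa> c = i}. v c) \<le> K"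
    and vol_pos: "0 < (\<Sum>c\<in>C. v c)"
begin

section \<open>Calculus of expectations of functions of the counts\<close>

definition E :: "(('c \<Rightarrow> nat) \<Rightarrow> real) \<Rightarrow> real" where
  "E F = expectation (\<lambda>\<omega>. F (\<lambda>c. Z c \<omega>))"

text \<open>Random variables are handled as functions of a configuration \<open>z\<close>, and
  measurability with respect to the counts in \<open>T\<close> becomes plain dependence on the
  coordinates in \<open>T\<close>. Independence is then the product rule \<open>E_mult\<close> for
  disjoint coordinate sets.\<close>

definition dep :: "(('c \<Rightarrow> nat) \<Rightarrow> real) \<Rightarrow> 'c set \<Rightarrow> bool" where
  "dep F T \<longleftrightarrow> (\<forall>z z'. (\<forall>c\<in>T. z c = z' c) \<longrightarrow> F z = F z')"

definition bdd :: "(('c \<Rightarrow> nat) \<Rightarrow> real) \<Rightarrow> bool" where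
  "bdd F \<longleftrightarrow> (\<exists>b. \<forall>z. \<bar>F z\<bar> \<le> b)"

lemma depD: "dep F T \<Longrightarrow> (\<And>c. c \<in> T \<Longrightarrow> z c = z' c) \<Longrightarrow> F z = F z'"
  by (auto simp: dep_def)

lemma dep_mono: "dep F T \<Longrightarrow> T \<subseteq> T' \<Longrightarrow> dep F T'"
  unfolding dep_def by (meson subsetD)

lemma dep_const: "dep (\<lambda>_. a) T" by (simp add: dep_def)

lemma dep_compose: "dep F T \<Longrightarrow> dep (\<lambda>z. f (F z)) T"
  unfolding dep_def by metis

lemma dep_compose2: "dep F T \<Longrightarrow> dep G T \<Longrightarrow> dep (\<lambda>z. f (F z) (G z)) T"
  unfolding dep_def by metis

lemma dep_sum: "(\<And>i. i \<in> A \<Longrightarrow> dep (F i) T) \<Longrightarrow> dep (\<lambda>z. \<Sum>i\<in>A. F i z) T"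
  unfolding dep_def by (intro allI impI sum.cong) auto

lemma bddI: "(\<And>z. \<bar>F z\<bar> \<le> b) \<Longrightarrow> bdd F" by (auto simp: bdd_def)

lemma bdd_const: "bdd (\<lambda>_. a)" by (rule bddI[of _ "\<bar>a\<bar>"]) simp

lemma bdd_add: assumes "bdd F" "bdd G" shows "bdd (\<lambda>z. F z + G z)"
proof -
  obtain a b where "\<And>z. \<bar>F z\<bar> \<le> a" "\<And>z. \<bar>G z\<bar> \<le> b" using assms by (auto simp: bdd_def)
  then have "\<bar>F z + G z\<bar> \<le> a + b" for z by (meson abs_triangle_ineq add_mono order.trans)
  then show ?thesis by (rule bddI)
qed

lemma bdd_mult: assumes "bdd F" "bdd G" shows "bdd (\<lambda>z. F z * G z)"
proof -
  obtain a b where ab: "\<And>z. \<bar>F z\<bar> \<le> a" "\<And>z. \<bar>G z\<bar> \<le> b" using assms by (auto simp: bdd_def)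
  have "\<bar>F z * G z\<bar> \<le> a * b" for z
    using ab[of z] by (auto simp: abs_mult intro!: mult_mono)
  then show ?thesis by (rule bddI)
qed

lemma bdd_diff: "bdd F \<Longrightarrow> bdd G \<Longrightarrow> bdd (\<lambda>z. F z - G z)"
  using bdd_add[of F "\<lambda>z. -1 * G z"] bdd_mult[OF bdd_const[of "-1"], of G] by simp

lemma bdd_sum: "(\<And>i. i \<in> A \<Longrightarrow> bdd (F i)) \<Longrightarrow> bdd (\<lambda>z. \<Sum>i\<in>A. F i z)"
proof (induction A rule: infinite_finite_induct)
  case (insert x A)
  then show ?case by (simp add: bdd_add)
qed (auto intro: bdd_const)

text \<open>Makes every function of finitely many counts measurable.\<close>

lemma PiM_count: "finite A \<Longrightarrow> PiM A (\<lambda>_. count_space (UNIV :: nat set)) = count_space (PiE A (\<lambda>_. UNIV))"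
  by (rule count_space_PiM_finite) auto

lemma dep_restrict: "dep F T \<Longrightarrow> F z = F (restrict z T)"
  by (erule depD) auto

lemma meas: assumes F: "dep F C" shows "(\<lambda>\<omega>. F (\<lambda>c. Z c \<omega>)) \<in> borel_measurable M"
proof -
  have Z: "Z c \<in> measurable M (count_space UNIV)" if "c \<in> C" for c
    using indep_Z that by (simp add: indep_vars_def)
  have "(\<lambda>\<omega>. restrict (\<lambda>c. Z c \<omega>) C) \<in> measurable M (PiM C (\<lambda>_. count_space UNIV))"
    by (rule measurable_restrict) (rule Z)
  then have 1: "(\<lambda>\<omega>. restrict (\<lambda>c. Z c \<omega>) C) \<in> measurable M (count_space (PiE C (\<lambda>_. UNIV)))"
    using finite_C by (simp add: PiM_count)
  have "(\<lambda>\<omega>. F (restrict (\<lambda>c. Z c \<omega>) C)) \<in> borel_measurable M"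
    by (rule measurable_compose[OF 1]) simp
  then show ?thesis by (simp only: dep_restrict[OF F, symmetric])
qed

lemma integrable_dep: assumes "dep F C" "bdd F" shows "integrable M (\<lambda>\<omega>. F (\<lambda>c. Z c \<omega>))"
proof -
  obtain b where "\<And>z. \<bar>F z\<bar> \<le> b" using assms(2) by (auto simp: bdd_def)
  then show ?thesis by (intro integrable_const_bound[where B=b] meas assms) auto
qed

lemma E_add: "dep F C \<Longrightarrow> bdd F \<Longrightarrow> dep G C \<Longrightarrow> bdd G \<Longrightarrow> E (\<lambda>z. F z + G z) = E F + E G"
  unfolding E_def by (intro Bochner_Integration.integral_add integrable_dep)

lemma E_diff: "dep F C \<Longrightarrow> bdd F \<Longrightarrow> dep G C \<Longrightarrow> bdd G \<Longrightarrow> E (\<lambda>z. F z - G z) = E F - E G"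
  unfolding E_def by (intro Bochner_Integration.integral_diff integrable_dep)

lemma E_sum: "(\<And>i. i \<in> A \<Longrightarrow> dep (F i) C) \<Longrightarrow> (\<And>i. i \<in> A \<Longrightarrow> bdd (F i)) \<Longrightarrow>
    E (\<lambda>z. \<Sum>i\<in>A. F i z) = (\<Sum>i\<in>A. E (F i))"
  unfolding E_def by (intro Bochner_Integration.integral_sum integrable_dep)

lemma E_cmult: "E (\<lambda>z. a * F z) = a * E F"
  unfolding E_def by (cases "integrable M (\<lambda>\<omega>. F (\<lambda>c. Z c \<omega>))") simp_all

lemma E_const: "E (\<lambda>_. a) = a" by (simp add: E_def prob_space)

lemma E_mono: "dep F C \<Longrightarrow> bdd F \<Longrightarrow> dep G C \<Longrightarrow> bdd G \<Longrightarrow> (\<And>z. F z \<le> G z) \<Longrightarrow> E F \<le> E G"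
  unfolding E_def by (intro integral_mono integrable_dep)

text \<open>A function that depends on \<open>S\<close> only can be evaluated at the restriction to
  \<open>S\<close>; restrictions of an independent family to disjoint index sets are
  independent.\<close>

lemma E_mult:
  assumes F: "dep F S" "bdd F" and G: "dep G T" "bdd G" and ST: "S \<inter> T = {}" "S \<subseteq> C" "T \<subseteq> C"
  shows "E (\<lambda>z. F z * G z) = E F * E G"
proof -
  have fin: "finite S" "finite T" using ST finite_C by (auto intro: finite_subset)
  have "indep_var (PiM S (\<lambda>_. count_space UNIV)) (\<lambda>\<omega>. restrict (\<lambda>c. Z c \<omega>) S)
      (PiM T (\<lambda>_. count_space UNIV)) (\<lambda>\<omega>. restrict (\<lambda>c. Z c \<omega>) T)"
    by (rule indep_var_restrict[OF indep_Z ST(1,2,3)])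
  then have "indep_var borel (F \<circ> (\<lambda>\<omega>. restrict (\<lambda>c. Z c \<omega>) S)) borel (G \<circ> (\<lambda>\<omega>. restrict (\<lambda>c. Z c \<omega>) T))"
    by (rule indep_var_compose) (simp_all add: PiM_count fin)
  moreover have "F \<circ> (\<lambda>\<omega>. restrict (\<lambda>c. Z c \<omega>) S) = (\<lambda>\<omega>. F (\<lambda>c. Z c \<omega>))"
    by (simp add: comp_def dep_restrict[OF F(1), symmetric])
  moreover have "G \<circ> (\<lambda>\<omega>. restrict (\<lambda>c. Z c \<omega>) T) = (\<lambda>\<omega>. G (\<lambda>c. Z c \<omega>))"
    by (simp add: comp_def dep_restrict[OF G(1), symmetric])
  ultimately have iv: "indep_var borel (\<lambda>\<omega>. F (\<lambda>c. Z c \<omega>)) borel (\<lambda>\<omega>. G (\<lambda>c. Z c \<omega>))" by simp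
  show ?thesis unfolding E_def
    by (rule indep_var_lebesgue_integral[OF iv])
       (use F G ST dep_mono in \<open>auto intro!: integrable_dep\<close>)
qed

section \<open>Neighbourhoods in the graph of centres\<close>

definition block :: "'i \<Rightarrow> 'c set" where "block i = {c\<in>C. \<kappa> c = i}"

text \<open>Balls in the graph distance of the centres: as \<open>adj\<close> is reflexive on
  \<open>I\<close>, paths of length exactly \<open>k\<close> also reach the points that are
  nearer.\<close>

fun near :: "nat \<Rightarrow> 'i \<Rightarrow> 'i set" where
  "near 0 i = {i}"
| "near (Suc k) i = (\<Union>j\<in>near k i. {l\<in>I. adj j l})"

definition cells :: "nat \<Rightarrow> 'i \<Rightarrow> 'c set" where "cells k i = {c\<in>C. \<kappa> c \<in> near k i}"

lemma near_subset: "i \<in> I \<Longrightarrow> near k i \<subseteq> I"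
  by (induction k) auto

lemma finite_near: "i \<in> I \<Longrightarrow> finite (near k i)"
  using near_subset finite_I finite_subset by blast

lemma card_near: assumes i: "i \<in> I" shows "card (near k i) \<le> d ^ k"
proof (induction k)
  case (Suc k)
  have "card (near (Suc k) i) \<le> (\<Sum>j\<in>near k i. card {l\<in>I. adj j l})"
    using finite_near[OF i, of k] by (simp add: card_UN_le)
  also have "\<dots> \<le> (\<Sum>j\<in>near k i. d)"
    using near_subset[OF i, of k] by (intro sum_mono degree) auto
  also have "\<dots> \<le> d ^ k * d" using Suc by simp
  finally show ?case by (simp add: mult.commute)
qed simp

lemma near_sym_1: "i \<in> I \<Longrightarrow> j \<in> near (Suc 0) i \<Longrightarrow> i \<in> near (Suc 0) j"
  using adj_sym by auto

lemma near_add: "j \<in> near a i \<Longrightarrow> l \<in> near b j \<Longrightarrow> l \<in> near (a + b) i"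
proof (induction b arbitrary: l)
  case (Suc b)
  then show ?case by auto
qed simp

lemma near_sym: assumes "i \<in> I" shows "j \<in> near k i \<Longrightarrow> i \<in> near k j"
proof (induction k arbitrary: j)
  case (Suc k)
  then obtain l where l: "l \<in> near k i" "j \<in> near (Suc 0) l" by auto
  then have lI: "l \<in> I" using near_subset[OF assms] by blast
  have "l \<in> near 1 j" using near_sym_1[OF lI l(2)] by simp
  moreover have "i \<in> near k l" using Suc.IH[OF l(1)] .
  ultimately have "i \<in> near (1 + k) j" by (rule near_add)
  then show ?case by simp
qed simp

lemma near_refl: "i \<in> I \<Longrightarrow> i \<in> near k i"
  by (induction k) (auto intro: adj_refl)

lemma cells_subset: "cells k i \<subseteq> C" by (auto simp: cells_def)

lemma block_subset: "block i \<subseteq> C" by (auto simp: block_def)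

text \<open>A common cell would have a centre reachable from \<open>i\<close> in \<open>a\<close>
  and from \<open>j\<close> in \<open>b\<close> steps, and by symmetry of \<open>near\<close> the
  two paths can be joined.\<close>

lemma cells_disjoint:
  assumes "i \<in> I" "j \<in> I" "j \<notin> near (a + b) i" shows "cells a i \<inter> cells b j = {}"
proof (rule ccontr)
  assume "cells a i \<inter> cells b j \<noteq> {}"
  then obtain c where c: "\<kappa> c \<in> near a i" "\<kappa> c \<in> near b j" by (auto simp: cells_def)
  then have "j \<in> near b (\<kappa> c)" using near_sym[OF assms(2)] by blast
  with c(1) have "j \<in> near (a + b) i" by (rule near_add)
  with assms(3) show False by blast
qed

section \<open>Isolated cells, grouped by centres\<close>

definition iso :: "'c \<Rightarrow> ('c \<Rightarrow> nat) \<Rightarrow> real" where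
  "iso c z = of_bool (z c = 1 \<and> (\<forall>c'\<in>C. c' \<noteq> c \<longrightarrow> cl c c' \<longrightarrow> z c' = 0))"

definition H :: "('c \<Rightarrow> nat) \<Rightarrow> real" where "H z = (\<Sum>c\<in>C. iso c z)"

definition X :: "'i \<Rightarrow> ('c \<Rightarrow> nat) \<Rightarrow> real" where "X i z = (\<Sum>c\<in>block i. iso c z)"

lemma sum_blocks: "(\<Sum>c\<in>C. f c) = (\<Sum>i\<in>I. \<Sum>c\<in>block i. f c)" for f :: "'c \<Rightarrow> real"
  unfolding block_def using finite_C finite_I \<kappa>_in
  by (intro sum.group[symmetric]) auto

lemma H_eq: "H z = (\<Sum>i\<in>I. X i z)" unfolding H_def X_def by (rule sum_blocks)

lemma finite_block: "finite (block i)" using finite_C by (simp add: block_def)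

lemma bdd_iso: "bdd (iso c)" by (rule bddI[where b=1]) (auto simp: iso_def)

text \<open>Two cells of the same centre are close by \<open>cl_class\<close>, so an isolated one
  forces the other to be empty.\<close>

lemma X_01: "X i z = 0 \<or> X i z = 1"
proof (cases "\<exists>c\<in>block i. iso c z = 1")
  case True
  then obtain c where c: "c \<in> block i" "iso c z = 1" by blast
  have "iso c' z = 0" if "c' \<in> block i" "c' \<noteq> c" for c'
  proof -
    have "cl c c'" "c' \<in> C" using c(1) that cl_class[of c c'] by (auto simp: block_def)
    then have "z c' = 0" using c(2) that by (auto simp: iso_def split: if_splits)
    then show ?thesis by (simp add: iso_def)
  qed
  then have "X i z = (\<Sum>c'\<in>block i. if c' = c then 1 else 0)"
    unfolding X_def using c(2) by (intro sum.cong) auto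
  then show ?thesis using c(1) finite_block by simp
next
  case False
  then have "iso c z = 0" if "c \<in> block i" for c using that by (auto simp: iso_def)
  then show ?thesis by (simp add: X_def)
qed

lemma X_range: "0 \<le> X i z" "X i z \<le> 1" using X_01[of i z] by auto

lemma bdd_X: "bdd (X i)" by (rule bddI[where b=1]) (use X_range in \<open>auto simp: abs_le_iff intro: order.trans[of _ 0]\<close>)

lemma dep_iso: "c \<in> C \<Longrightarrow> dep (iso c) (insert c {c'\<in>C. cl c c'})"
  unfolding dep_def iso_def
  by (intro allI impI arg_cong[where f=of_bool]) auto

lemma dep_iso_C: "c \<in> C \<Longrightarrow> dep (iso c) C"
  using dep_iso by (rule dep_mono) auto

lemma dep_X: assumes i: "i \<in> I" shows "dep (X i) (cells 1 i)"
  unfolding X_def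
proof (rule dep_sum)
  fix c assume c: "c \<in> block i"
  then have "c \<in> C" "\<kappa> c = i" by (auto simp: block_def)
  moreover from this have "insert c {c'\<in>C. cl c c'} \<subseteq> cells 1 i"
    using i cl_adj[of c] \<kappa>_in adj_refl by (auto simp: cells_def)
  ultimately show "dep (iso c) (cells 1 i)" using dep_iso dep_mono by blast
qed

lemma dep_X_C: "i \<in> I \<Longrightarrow> dep (X i) C" using dep_X cells_subset dep_mono by blast

text \<open>An isolated cell holds exactly one point, which has probability v e^(-v) \<le> v.
  Summation bounds the total of the means by the volume, whatever the mesh.\<close>

lemma E_iso_le: assumes c: "c \<in> C" shows "E (iso c) \<le> v c"
proof -
  let ?A = "{\<omega>\<in>space M. (\<Sum>c\<in>{c}. Z c \<omega>) = 1}"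
  have [measurable]: "Z c \<in> measurable M (count_space UNIV)" using indep_Z c by (simp add: indep_vars_def)
  have Am: "?A \<in> events" by simp
  have "E (iso c) \<le> expectation (indicat_real ?A)"
    unfolding E_def
  proof (rule integral_mono)
    show "integrable M (\<lambda>\<omega>. iso c (\<lambda>c. Z c \<omega>))" by (rule integrable_dep[OF dep_iso_C[OF c] bdd_iso])
    show "integrable M (indicat_real ?A)" using Am by (intro integrable_const_bound[where B=1]) auto
  qed (auto simp: iso_def indicator_def)
  also have "\<dots> = prob ?A" using Am by simp
  also have "\<dots> = v c * exp (- v c)" using prob_1[of "{c}"] c by simp
  also have "\<dots> \<le> v c" using v_nonneg[OF c] by (simp add: mult_left_le)
  finally show ?thesis .
qed

definition a :: "'i \<Rightarrow> real" where "a i = (\<Sum>c\<in>block i. v c)"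

lemma a_nonneg: "0 \<le> a i" unfolding a_def by (intro sum_nonneg v_nonneg) (simp add: block_def)

lemma a_le: "i \<in> I \<Longrightarrow> a i \<le> K" using mass[of i] by (simp add: a_def block_def)

lemma E_X_le: assumes "i \<in> I" shows "E (X i) \<le> a i"
proof -
  have "E (X i) = (\<Sum>c\<in>block i. E (iso c))"
    unfolding X_def[abs_def] by (rule E_sum) (auto simp: block_def intro: dep_iso_C bdd_iso)
  also have "\<dots> \<le> a i" unfolding a_def by (intro sum_mono E_iso_le) (auto simp: block_def)
  finally show ?thesis .
qed

subsection \<open>Lower bound for the variance\<close>

text \<open>In the notation of the overview \<open>B\<close> and \<open>e\<close> are the indicators
  of F and E, \<open>q\<close> is P(F) and \<open>\<tau>\<close> is the test variable. The rim
  leaves out the block itself, so \<open>B i\<close> and \<open>e i\<close> depend on disjoint sets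
  of cells.\<close>

definition B :: "'i \<Rightarrow> ('c \<Rightarrow> nat) \<Rightarrow> real" where
  "B i z = of_bool ((\<Sum>c\<in>block i. z c) = 1)"

definition rim :: "'i \<Rightarrow> 'c set" where "rim i = cells 1 i - block i"

definition e :: "'i \<Rightarrow> ('c \<Rightarrow> nat) \<Rightarrow> real" where
  "e i z = of_bool (\<forall>c\<in>rim i. z c = 0)"

definition q :: "'i \<Rightarrow> real" where "q i = a i * exp (- a i)"

definition \<tau> :: "'i \<Rightarrow> ('c \<Rightarrow> nat) \<Rightarrow> real" where "\<tau> i z = e i z * (B i z - q i)"

lemma E_of_bool:
  assumes "A \<subseteq> C"
  shows "E (\<lambda>z. of_bool ((\<Sum>c\<in>A. z c) = k)) = prob {\<omega>\<in>space M. (\<Sum>c\<in>A. Z c \<omega>) = k}"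
proof -
  have "E (\<lambda>z. of_bool ((\<Sum>c\<in>A. z c) = k)) = expectation (indicat_real {\<omega>\<in>space M. (\<Sum>c\<in>A. Z c \<omega>) = k})"
    unfolding E_def by (intro Bochner_Integration.integral_cong) (auto simp: indicator_def)
  also have "\<dots> = prob {\<omega>\<in>space M. (\<Sum>c\<in>A. Z c \<omega>) = k}"
    by (simp add: Int_absorb2)
  finally show ?thesis .
qed

lemma E_B: "E (B i) = q i"
  unfolding B_def[abs_def] q_def a_def
  using E_of_bool[OF block_subset[of i], of 1] prob_1[OF block_subset[of i]] by simp

text \<open>The inequality 2 a \<le> exp a follows from the quadratic Taylor bound and 0 \<le> (a -
  1)^2. It keeps \<open>1 - q i\<close> at least 1/2 in the variance of \<open>B i\<close>.\<close>

lemma q_range: "0 \<le> q i" "q i \<le> 1 / 2"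
proof -
  show "0 \<le> q i" using a_nonneg by (simp add: q_def)
  have "1 + a i + (a i)\<^sup>2 / 2 \<le> exp (a i)" using a_nonneg by (rule exp_lower_Taylor_quadratic)
  moreover have "0 \<le> (a i - 1)\<^sup>2" by simp
  ultimately have "2 * a i \<le> exp (a i)" unfolding power2_diff by simp
  then show "q i \<le> 1 / 2" by (simp add: q_def exp_minus field_simps)
qed

lemma finite_rim: "finite (rim i)"
  using finite_C cells_subset[of 1 i] by (auto simp: rim_def intro: finite_subset)

lemma rim_subset: "rim i \<subseteq> C" using cells_subset by (auto simp: rim_def)

lemma e_eq: "e i z = of_bool ((\<Sum>c\<in>rim i. z c) = 0)"
  using finite_rim by (simp add: e_def)

lemma dep_e: "dep (e i) (rim i)" unfolding e_def dep_def by auto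

lemma dep_B: "dep (B i) (block i)" unfolding B_def dep_def
  by (intro allI impI arg_cong[where f=of_bool]) (metis sum.cong)

lemma bdd_e: "bdd (e i)" and bdd_B: "bdd (B i)"
  by (rule bddI[where b=1], simp add: e_def B_def)+

lemma bdd_\<tau>: "bdd (\<tau> i)" unfolding \<tau>_def[abs_def] by (intro bdd_mult bdd_diff bdd_e bdd_B bdd_const)

lemma dep_e_C: "dep (e i) C" and dep_B_C: "dep (B i) C"
  by (rule dep_mono[OF dep_e rim_subset], rule dep_mono[OF dep_B block_subset])

lemma dep_\<tau>: "i \<in> I \<Longrightarrow> dep (\<tau> i) (cells 1 i)"
proof -
  assume "i \<in> I"
  then have "block i \<subseteq> cells 1 i" "rim i \<subseteq> cells 1 i"
    using adj_refl by (auto simp: block_def cells_def rim_def)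
  then have "dep (e i) (cells 1 i)" "dep (\<lambda>z. B i z - q i) (cells 1 i)"
    by (auto intro: dep_mono[OF dep_e] dep_mono[OF dep_compose[OF dep_B]])
  then show ?thesis unfolding \<tau>_def[abs_def] by (rule dep_compose2)
qed

lemma dep_\<tau>_C: "i \<in> I \<Longrightarrow> dep (\<tau> i) C"
  using dep_\<tau> cells_subset dep_mono by blast

text \<open>The rim lies in the blocks of at most \<open>d\<close> centres, each of volume at most
  \<open>K\<close>, and a Poisson count of mean \<open>d * K\<close> is 0 with the probability on
  the left.\<close>

lemma E_e_ge: assumes i: "i \<in> I" shows "exp (- d * K) \<le> E (e i)"
proof -
  have "(\<Sum>c\<in>rim i. v c) \<le> (\<Sum>c\<in>cells 1 i. v c)"
    using finite_C cells_subset v_nonneg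
    by (intro sum_mono2) (auto simp: rim_def intro: finite_subset)
  also have "\<dots> = (\<Sum>j\<in>near 1 i. \<Sum>c\<in>{c\<in>cells 1 i. \<kappa> c = j}. v c)"
    using finite_C cells_subset[of 1 i] finite_near[OF i]
    by (intro sum.group[symmetric]) (auto simp: cells_def simp del: near.simps One_nat_def intro: finite_subset)
  also have "\<dots> = (\<Sum>j\<in>near 1 i. a j)"
    unfolding a_def by (intro sum.cong refl) (auto simp: cells_def block_def)
  also have "\<dots> \<le> (\<Sum>j\<in>near 1 i. K)" using near_subset[OF i] by (intro sum_mono a_le) auto
  also have "\<dots> = card (near 1 i) * K" by simp
  also have "\<dots> \<le> d * K"
    using card_near[OF i, of 1] a_le[OF i] a_nonneg[of i] by (intro mult_right_mono) auto
  finally have "exp (- (d * K)) \<le> exp (- (\<Sum>c\<in>rim i. v c))" by simp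
  also have "\<dots> = E (e i)" unfolding e_eq[abs_def] by (simp only: E_of_bool rim_subset prob_0)
  finally show ?thesis by simp
qed

lemma block_rim: "block i \<inter> rim i = {}" by (auto simp: rim_def)

lemma E_\<tau>: "E (\<tau> i) = 0"
proof -
  have "E (\<lambda>z. e i z * (B i z - q i)) = E (e i) * E (\<lambda>z. B i z - q i)"
    by (rule E_mult[OF dep_e bdd_e dep_compose[OF dep_B, of "\<lambda>b. b - q i"]])
       (use block_rim rim_subset block_subset in \<open>auto intro: bdd_diff bdd_B bdd_const\<close>)
  also have "E (\<lambda>z. B i z - q i) = 0"
    using E_diff[OF dep_B_C bdd_B dep_const bdd_const, of i "q i"] by (simp add: E_B E_const)
  finally show ?thesis by (simp add: \<tau>_def[abs_def])
qed

lemma E_e_B: "E (\<lambda>z. e i z * (B i z * (B i z - q i))) = E (e i) * (q i * (1 - q i))"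
proof -
  have "E (\<lambda>z. e i z * (B i z * (B i z - q i))) = E (e i) * E (\<lambda>z. B i z * (B i z - q i))"
    by (rule E_mult[OF dep_e bdd_e dep_compose[OF dep_B, of "\<lambda>b. b * (b - q i)"]])
       (use block_rim rim_subset block_subset in \<open>blast intro: bdd_mult[OF bdd_B bdd_diff[OF bdd_B bdd_const]]\<close>)+
  also have "E (\<lambda>z. B i z * (B i z - q i)) = E (\<lambda>z. (1 - q i) * B i z)"
    by (rule arg_cong[where f=E]) (auto simp: B_def)
  also have "\<dots> = q i * (1 - q i)" by (simp add: E_cmult E_B)
  finally show ?thesis .
qed

text \<open>With an empty rim the only occupied cells that a cell of the block can be close to lie
  in the block, and there one is isolated exactly if the block holds a single point. The sum over
  the cells outside \<open>cells 1 i\<close> does not look at the block at all, see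
  \<open>dep_outer\<close>.\<close>

lemma H_on_rim_empty:
  assumes i: "i \<in> I" and e: "e i z = 1"
  shows "H z = B i z + (\<Sum>c\<in>C - cells 1 i. iso c z)"
proof -
  have z0: "z c = 0" if "c \<in> rim i" for c using that e by (auto simp: e_def split: if_splits)
  have bs: "block i \<subseteq> cells 1 i" using i adj_refl by (auto simp: block_def cells_def)
  have "H z = (\<Sum>c\<in>cells 1 i. iso c z) + (\<Sum>c\<in>C - cells 1 i. iso c z)"
    unfolding H_def using finite_C cells_subset[of 1 i] by (metis add.commute sum.subset_diff)
  also have "(\<Sum>c\<in>cells 1 i. iso c z) = (\<Sum>c\<in>block i. iso c z)"
    using finite_C cells_subset[of 1 i] bs z0
    by (intro sum.mono_neutral_right) (auto simp: rim_def iso_def intro: finite_subset)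
  also have "\<dots> = (\<Sum>c\<in>block i. of_bool (z c = 1 \<and> (\<forall>c'\<in>block i. c' \<noteq> c \<longrightarrow> z c' = 0)))"
  proof (rule sum.cong[OF refl])
    fix c assume c: "c \<in> block i"
    have "(\<forall>c'\<in>C. c' \<noteq> c \<longrightarrow> cl c c' \<longrightarrow> z c' = 0) \<longleftrightarrow> (\<forall>c'\<in>block i. c' \<noteq> c \<longrightarrow> z c' = 0)"
    proof
      assume *: "\<forall>c'\<in>C. c' \<noteq> c \<longrightarrow> cl c c' \<longrightarrow> z c' = 0"
      show "\<forall>c'\<in>block i. c' \<noteq> c \<longrightarrow> z c' = 0"
        using * c cl_class[of c] by (auto simp: block_def)
    next
      assume *: "\<forall>c'\<in>block i. c' \<noteq> c \<longrightarrow> z c' = 0"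
      show "\<forall>c'\<in>C. c' \<noteq> c \<longrightarrow> cl c c' \<longrightarrow> z c' = 0"
      proof (intro ballI impI)
        fix c' assume c': "c' \<in> C" "c' \<noteq> c" "cl c c'"
        then have "adj i (\<kappa> c')" using c cl_adj[of c c'] by (auto simp: block_def)
        then have "c' \<in> cells 1 i" using c' \<kappa>_in by (auto simp: cells_def)
        then show "z c' = 0" using * z0 c' by (cases "c' \<in> block i") (auto simp: rim_def)
      qed
    qed
    then show "iso c z = of_bool (z c = 1 \<and> (\<forall>c'\<in>block i. c' \<noteq> c \<longrightarrow> z c' = 0))"
      by (simp add: iso_def)
  qed
  also have "\<dots> = B i z"
  proof (cases "(\<Sum>c\<in>block i. z c) = 1")
    case True
    then obtain c where c: "c \<in> block i" "z c = 1" "\<forall>c'\<in>block i. c' \<noteq> c \<longrightarrow> z c' = 0"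
      using sum_eq_1_iff[OF finite_block[of i], of z] by auto
    have "(\<Sum>c\<in>block i. of_bool (z c = 1 \<and> (\<forall>c'\<in>block i. c' \<noteq> c \<longrightarrow> z c' = 0)) :: real)
        = (\<Sum>c'\<in>block i. if c' = c then 1 else 0)"
      using c by (intro sum.cong refl) auto
    then show ?thesis using c(1) finite_block True by (simp add: B_def)
  next
    case False
    have "of_bool (z c = 1 \<and> (\<forall>c'\<in>block i. c' \<noteq> c \<longrightarrow> z c' = 0)) = (0 :: real)" if "c \<in> block i" for c
      unfolding of_bool_eq_0_iff using False that sum_eq_1_iff[OF finite_block[of i], of z] by metis
    then have *: "(\<Sum>c\<in>block i. of_bool (z c = 1 \<and> (\<forall>c'\<in>block i. c' \<noteq> c \<longrightarrow> z c' = 0))) = (\<Sum>c\<in>block i. (0 :: real))"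
      by (rule sum.cong[OF refl])
    show ?thesis unfolding * using False by (simp add: B_def)
  qed
  finally show ?thesis .
qed

lemma dep_outer:
  assumes i: "i \<in> I" shows "dep (\<lambda>z. \<Sum>c\<in>C - cells 1 i. iso c z) (C - block i)"
proof (rule dep_sum)
  fix c assume c: "c \<in> C - cells 1 i"
  have "c' \<notin> block i" if "c' \<in> C" "cl c c'" for c'
  proof
    assume "c' \<in> block i"
    then have "adj i (\<kappa> c)" using cl_adj[of c' c] cl_sym[of c c'] that c by (auto simp: block_def)
    then show False using c \<kappa>_in by (auto simp: cells_def)
  qed
  moreover have "c \<notin> block i" using c i adj_refl by (auto simp: block_def cells_def)
  ultimately have "insert c {c'\<in>C. cl c c'} \<subseteq> C - block i" using c by auto
  then show "dep (iso c) (C - block i)" using dep_iso dep_mono c by blast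
qed

text \<open>On the event of an empty rim \<open>H\<close> is \<open>B i\<close> plus a term
  \<open>G\<close> that depends only on cells outside the block. The factor \<open>B i - q i\<close>
  is centred and independent of \<open>e i * G\<close>, so only the variance of \<open>B i\<close>
  survives, times the probability of an empty rim.\<close>

lemma E_H_\<tau>:
  assumes i: "i \<in> I" shows "E (\<lambda>z. H z * \<tau> i z) = E (e i) * (q i * (1 - q i))"
proof -
  define G where "G z = (\<Sum>c\<in>C - cells 1 i. iso c z)" for z
  have bG: "bdd G" unfolding G_def[abs_def] by (intro bdd_sum bdd_iso)
  have dG: "dep G (C - block i)" unfolding G_def[abs_def] by (rule dep_outer[OF i])
  have eq: "H z * \<tau> i z = e i z * (B i z * (B i z - q i)) + (B i z - q i) * (e i z * G z)" for z
  proof (cases "e i z = 1")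
    case True
    then show ?thesis using H_on_rim_empty[OF i True] by (simp add: \<tau>_def G_def algebra_simps)
  next
    case False
    then have "e i z = 0" by (auto simp: e_def)
    then show ?thesis by (simp add: \<tau>_def)
  qed
  have dB: "dep (\<lambda>z. B i z - q i) (block i)" by (rule dep_compose[OF dep_B])
  have dBC: "dep (\<lambda>z. B i z - q i) C" by (rule dep_compose[OF dep_B_C])
  have deG: "dep (\<lambda>z. e i z * G z) (C - block i)"
    using rim_subset block_rim by (intro dep_compose2[OF dep_mono[OF dep_e] dG]) blast
  have deGC: "dep (\<lambda>z. e i z * G z) C" by (rule dep_mono[OF deG]) auto
  have bB: "bdd (\<lambda>z. B i z - q i)" by (intro bdd_diff bdd_B bdd_const)
  have beG: "bdd (\<lambda>z. e i z * G z)" by (intro bdd_mult bdd_e bG)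
  have "E (\<lambda>z. (B i z - q i) * (e i z * G z)) = E (\<lambda>z. B i z - q i) * E (\<lambda>z. e i z * G z)"
    by (rule E_mult[OF dB bB deG beG]) (use block_subset in auto)
  also have "E (\<lambda>z. B i z - q i) = 0"
    using E_diff[OF dep_B_C bdd_B dep_const bdd_const, of i "q i"] by (simp add: E_B E_const)
  finally have 0: "E (\<lambda>z. (B i z - q i) * (e i z * G z)) = 0" by simp
  have "E (\<lambda>z. H z * \<tau> i z) = E (\<lambda>z. e i z * (B i z * (B i z - q i))) + E (\<lambda>z. (B i z - q i) * (e i z * G z))"
    unfolding eq
  proof (rule E_add)
    show "dep (\<lambda>z. e i z * (B i z * (B i z - q i))) C"
      by (rule dep_compose2[OF dep_e_C dep_compose[OF dep_B_C]])
    show "dep (\<lambda>z. (B i z - q i) * (e i z * G z)) C" by (rule dep_compose2[OF dBC deGC])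
  qed (intro bdd_mult bdd_diff bdd_e bdd_B bdd_const bG)+
  then show ?thesis using 0 E_e_B by simp
qed

text \<open>For equal centres the variance of \<open>B i\<close> is a bound. For distinct adjacent
  centres each rim contains the other block, so a nonzero product forces \<open>B i\<close> and
  \<open>B k\<close> to vanish and equals \<open>q i * q k\<close>. Otherwise the block of
  \<open>i\<close> misses \<open>cells 1 k\<close>, and \<open>B i - q i\<close> is centred and
  independent of the rest, although \<open>rim i\<close> and \<open>cells 1 k\<close> may
  overlap.\<close>

lemma E_\<tau>_\<tau>:
  assumes i: "i \<in> I" and k: "k \<in> I"
  shows "E (\<lambda>z. \<tau> i z * \<tau> k z) \<le> (if k \<in> near 1 i then q i else 0)"
proof -
  have dd: "dep (\<lambda>z. \<tau> i z * \<tau> k z) C" by (rule dep_compose2[OF dep_\<tau>_C[OF i] dep_\<tau>_C[OF k]])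
  have bb: "bdd (\<lambda>z. \<tau> i z * \<tau> k z)" by (intro bdd_mult bdd_\<tau>)
  consider "k = i" | "k \<noteq> i" "k \<in> near 1 i" | "k \<notin> near 1 i" by blast
  then show ?thesis
  proof cases
    case 1
    have le: "\<tau> i z * \<tau> i z \<le> (1 - 2 * q i) * B i z + q i * q i" for z
    proof -
      have "\<tau> i z * \<tau> i z \<le> (B i z - q i) * (B i z - q i)" by (auto simp: \<tau>_def e_def)
      also have "\<dots> = (1 - 2 * q i) * B i z + q i * q i" by (auto simp: B_def algebra_simps)
      finally show ?thesis .
    qed
    have "E (\<lambda>z. \<tau> i z * \<tau> i z) \<le> E (\<lambda>z. (1 - 2 * q i) * B i z + q i * q i)"
    proof (rule E_mono[OF _ _ _ _ le])
      show "dep (\<lambda>z. (1 - 2 * q i) * B i z + q i * q i) C" by (rule dep_compose[OF dep_B_C])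
      show "bdd (\<lambda>z. (1 - 2 * q i) * B i z + q i * q i)"
        by (rule bdd_add[OF bdd_mult[OF bdd_const bdd_B] bdd_const])
    qed (use dd bb 1 in auto)
    also have "\<dots> = (1 - 2 * q i) * q i + q i * q i"
      by (subst E_add[OF dep_compose[OF dep_B_C] bdd_mult[OF bdd_const bdd_B] dep_const bdd_const])
         (simp add: E_cmult E_B E_const)
    also have "\<dots> \<le> q i" using q_range[of i] by (simp add: algebra_simps)
    finally show ?thesis using 1 near_refl[OF i, of 1] by simp
  next
    case 2
    have le: "\<tau> i z * \<tau> k z \<le> q i" for z
    proof (cases "e i z = 1 \<and> e k z = 1")
      case True
      have "i \<in> near 1 k" using near_sym[OF i] 2 by blast
      then have "block k \<subseteq> rim i" "block i \<subseteq> rim k"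
        using 2 by (auto simp: rim_def cells_def block_def)
      then have "\<forall>c\<in>block k. z c = 0" "\<forall>c\<in>block i. z c = 0"
        using True by (auto simp: e_def split: if_splits)
      then have "B i z = 0" "B k z = 0" by (auto simp: B_def)
      then have "\<tau> i z * \<tau> k z = q i * q k" using True by (simp add: \<tau>_def)
      also have "\<dots> \<le> q i * 1" using q_range[of i] q_range[of k] by (intro mult_left_mono) auto
      finally show ?thesis by simp
    next
      case False
      then have "\<tau> i z * \<tau> k z = 0" by (auto simp: \<tau>_def e_def)
      then show ?thesis using q_range(1)[of i] by linarith
    qed
    have "E (\<lambda>z. \<tau> i z * \<tau> k z) \<le> E (\<lambda>_. q i)"
      using dd bb le by (intro E_mono) (auto intro: dep_const bdd_const)
    then show ?thesis using 2 by (simp add: E_const)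
  next
    case 3
    then have ik: "i \<noteq> k" "i \<notin> near 1 k" using near_refl[OF i, of 1] near_sym[OF k, of i 1] by blast+
    have "block i \<inter> cells 1 k = {}" using ik by (auto simp: block_def cells_def)
    then have sub: "rim i \<subseteq> C - block i" "cells 1 k \<subseteq> C - block i"
      using rim_subset cells_subset block_rim by blast+
    have "E (\<lambda>z. (B i z - q i) * (e i z * \<tau> k z)) = E (\<lambda>z. B i z - q i) * E (\<lambda>z. e i z * \<tau> k z)"
    proof (rule E_mult)
      show "dep (\<lambda>z. B i z - q i) (block i)" by (rule dep_compose[OF dep_B])
      show "dep (\<lambda>z. e i z * \<tau> k z) (C - block i)"
        by (rule dep_compose2[OF dep_mono[OF dep_e sub(1)] dep_mono[OF dep_\<tau>[OF k] sub(2)]])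
    qed (use block_subset in \<open>auto intro: bdd_mult bdd_diff bdd_B bdd_const bdd_e bdd_\<tau>\<close>)
    also have "E (\<lambda>z. B i z - q i) = 0"
      using E_diff[OF dep_B_C bdd_B dep_const bdd_const, of i "q i"] by (simp add: E_B E_const)
    also have "(\<lambda>z. (B i z - q i) * (e i z * \<tau> k z)) = (\<lambda>z. \<tau> i z * \<tau> k z)"
      by (simp add: \<tau>_def fun_eq_iff)
    finally have "E (\<lambda>z. \<tau> i z * \<tau> k z) = 0" by simp
    then show ?thesis using 3 by (simp del: near.simps)
  qed
qed

definition n :: real where "n = (\<Sum>c\<in>C. v c)"

text \<open>Cauchy-Schwarz bounds the variance below by \<open>s^2 / w\<close>, where
  \<open>s\<close> is at least \<open>exp (- d * K) / 2 * Sq\<close>, \<open>w = d * Sq\<close>, and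
  \<open>Sq\<close>, the sum of all \<open>q i\<close>, is at least
  \<open>exp (- K) * n\<close>.\<close>

definition var_const :: real where "var_const = exp (- (2 * d + 1) * K) / (4 * d)"

lemma I_nonempty: "I \<noteq> {}" using vol_pos \<kappa>_in by fastforce

lemma d_pos: "0 < d"
proof -
  obtain i where i: "i \<in> I" using I_nonempty by blast
  have "{i} \<subseteq> near 1 i" using near_refl[OF i, of 1] by blast
  then have "card {i} \<le> card (near 1 i)" using finite_near[OF i] card_mono by blast
  then show ?thesis using card_near[OF i, of 1] by simp
qed

lemma var_const_pos: "0 < var_const" using d_pos by (simp add: var_const_def)

lemma dep_H: "dep H C" unfolding H_def[abs_def] by (intro dep_sum dep_iso_C)

lemma bdd_H: "bdd H" unfolding H_def[abs_def] by (intro bdd_sum bdd_iso)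

definition \<mu> :: real where "\<mu> = E H"

lemma variance_lower: "var_const * n \<le> E (\<lambda>z. (H z - \<mu>)\<^sup>2)"
proof -
  define T where "T z = (\<Sum>i\<in>I. \<tau> i z)" for z
  define s where "s = (\<Sum>i\<in>I. E (e i) * (q i * (1 - q i)))"
  define Sq where "Sq = (\<Sum>i\<in>I. q i)"
  have dT: "dep T C" unfolding T_def[abs_def] by (intro dep_sum dep_\<tau>_C)
  have bT: "bdd T" unfolding T_def[abs_def] by (intro bdd_sum bdd_\<tau>)
  have ET: "E T = 0" unfolding T_def[abs_def] by (subst E_sum) (auto intro: dep_\<tau>_C bdd_\<tau> simp: E_\<tau>)
  have EHT: "E (\<lambda>z. H z * T z) = s"
  proof -
    have "E (\<lambda>z. H z * T z) = E (\<lambda>z. \<Sum>i\<in>I. H z * \<tau> i z)" by (simp add: T_def sum_distrib_left)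
    also have "\<dots> = (\<Sum>i\<in>I. E (\<lambda>z. H z * \<tau> i z))"
      by (rule E_sum) (auto intro: dep_compose2[OF dep_H dep_\<tau>_C] bdd_mult bdd_H bdd_\<tau>)
    finally show ?thesis unfolding s_def using E_H_\<tau> by simp
  qed
  have ETT: "E (\<lambda>z. T z * T z) \<le> d * Sq"
  proof -
    have "E (\<lambda>z. T z * T z) = E (\<lambda>z. \<Sum>i\<in>I. \<Sum>k\<in>I. \<tau> i z * \<tau> k z)" by (simp add: T_def sum_product)
    also have "\<dots> = (\<Sum>i\<in>I. \<Sum>k\<in>I. E (\<lambda>z. \<tau> i z * \<tau> k z))"
      by (subst E_sum, force intro: dep_sum dep_compose2[OF dep_\<tau>_C dep_\<tau>_C], force intro: bdd_sum bdd_mult bdd_\<tau>)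
         (intro sum.cong refl E_sum dep_compose2[OF dep_\<tau>_C dep_\<tau>_C] bdd_mult bdd_\<tau>)
    also have "\<dots> \<le> (\<Sum>i\<in>I. \<Sum>k\<in>I. if k \<in> near 1 i then q i else 0)"
      by (intro sum_mono E_\<tau>_\<tau>)
    also have "\<dots> = (\<Sum>i\<in>I. card (near 1 i) * q i)"
    proof (rule sum.cong[OF refl])
      fix i assume "i \<in> I"
      then have "I \<inter> {k. k \<in> near 1 i} = near 1 i" using near_subset[of i 1] by auto
      then show "(\<Sum>k\<in>I. if k \<in> near 1 i then q i else 0) = card (near 1 i) * q i"
        using finite_I by (simp only: sum.If_cases) simp
    qed
    also have "\<dots> \<le> (\<Sum>i\<in>I. d * q i)"
      using q_range card_near[of _ 1] by (intro sum_mono mult_right_mono) (auto simp del: near.simps)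
    finally show ?thesis by (simp add: Sq_def sum_distrib_left)
  qed
  have Sq_ge: "exp (- K) * n \<le> Sq"
  proof -
    have "exp (- K) * n = (\<Sum>i\<in>I. exp (- K) * a i)"
      unfolding n_def sum_blocks a_def by (simp add: sum_distrib_left)
    also have "\<dots> \<le> Sq" unfolding Sq_def q_def
    proof (rule sum_mono)
      fix i assume "i \<in> I"
      then show "exp (- K) * a i \<le> a i * exp (- a i)"
        using a_le[of i] a_nonneg[of i] mult_left_mono[of "exp (- K)" "exp (- a i)" "a i"]
        by (simp add: mult.commute)
    qed
    finally show ?thesis .
  qed
  have n_pos: "0 < n" using vol_pos by (simp add: n_def)
  then have "0 < exp (- K) * n" by simp
  then have Sq_pos: "0 < Sq" using Sq_ge by linarith
  have s_ge: "exp (- d * K) / 2 * Sq \<le> s"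
  proof -
    have "exp (- d * K) / 2 * Sq = (\<Sum>i\<in>I. exp (- d * K) * (q i * (1 / 2)))"
      by (simp add: Sq_def sum_distrib_left sum_divide_distrib)
    also have "\<dots> \<le> s" unfolding s_def
    proof (rule sum_mono)
      fix i assume i: "i \<in> I"
      have "0 \<le> E (e i)" using E_e_ge[OF i] exp_gt_zero[of "- d * K"] by linarith
      then show "exp (- d * K) * (q i * (1 / 2)) \<le> E (e i) * (q i * (1 - q i))"
        using E_e_ge[OF i] q_range[of i] by (intro mult_mono) auto
    qed
    finally show ?thesis .
  qed
  define w where "w = d * Sq"
  have w_pos: "0 < w" using Sq_pos d_pos by (simp add: w_def)
  \<comment> \<open>The minimiser of the quadratic polynomial that bounds the second moment of
    \<open>(H - \<mu>) - t * T\<close>; nonnegativity at this point is the Cauchy-Schwarz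
    inequality.\<close>
  define t where "t = s / w"
  have "0 \<le> E (\<lambda>z. ((H z - \<mu>) - t * T z)\<^sup>2)" unfolding E_def by simp
  also have "(\<lambda>z. ((H z - \<mu>) - t * T z)\<^sup>2) =
      (\<lambda>z. (H z - \<mu>)\<^sup>2 + ((- 2 * t) * (H z * T z) + ((2 * t * \<mu>) * T z + t\<^sup>2 * (T z * T z))))"
    by (rule ext) (simp add: power2_eq_square algebra_simps)
  also have "E \<dots> = E (\<lambda>z. (H z - \<mu>)\<^sup>2) + ((- 2 * t) * E (\<lambda>z. H z * T z) +
      ((2 * t * \<mu>) * E T + t\<^sup>2 * E (\<lambda>z. T z * T z)))"
  proof -
    have d1: "dep (\<lambda>z. (H z - \<mu>)\<^sup>2) C" by (rule dep_compose[OF dep_H])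
    have d2: "dep (\<lambda>z. (- 2 * t) * (H z * T z)) C" by (rule dep_compose2[OF dep_H dT])
    have d3: "dep (\<lambda>z. (2 * t * \<mu>) * T z) C" by (rule dep_compose[OF dT])
    have d4: "dep (\<lambda>z. t\<^sup>2 * (T z * T z)) C" by (rule dep_compose[OF dT])
    have b1: "bdd (\<lambda>z. (H z - \<mu>)\<^sup>2)" unfolding power2_eq_square by (intro bdd_mult bdd_diff bdd_H bdd_const)
    have b2: "bdd (\<lambda>z. (- 2 * t) * (H z * T z))" by (intro bdd_mult bdd_H bT bdd_const)
    have b3: "bdd (\<lambda>z. (2 * t * \<mu>) * T z)" by (intro bdd_mult bT bdd_const)
    have b4: "bdd (\<lambda>z. t\<^sup>2 * (T z * T z))" by (intro bdd_mult bT bdd_const)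
    have d34: "dep (\<lambda>z. (2 * t * \<mu>) * T z + t\<^sup>2 * (T z * T z)) C" by (rule dep_compose2[OF d3 d4])
    have d234: "dep (\<lambda>z. (- 2 * t) * (H z * T z) + ((2 * t * \<mu>) * T z + t\<^sup>2 * (T z * T z))) C"
      by (rule dep_compose2[OF d2 d34])
    show ?thesis
      by (simp only: E_add[OF d1 b1 d234 bdd_add[OF b2 bdd_add[OF b3 b4]]] E_add[OF d2 b2 d34 bdd_add[OF b3 b4]]
          E_add[OF d3 b3 d4 b4] E_cmult)
  qed
  finally have "0 \<le> E (\<lambda>z. (H z - \<mu>)\<^sup>2) - 2 * t * s + t\<^sup>2 * E (\<lambda>z. T z * T z)"
    by (simp add: ET EHT)
  also have "\<dots> \<le> E (\<lambda>z. (H z - \<mu>)\<^sup>2) - 2 * t * s + t\<^sup>2 * w"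
    using ETT by (intro add_left_mono mult_left_mono) (auto simp: w_def)
  finally have "s\<^sup>2 / w \<le> E (\<lambda>z. (H z - \<mu>)\<^sup>2)"
    using w_pos by (simp add: t_def power2_eq_square)
  moreover have "var_const * n \<le> s\<^sup>2 / w"
  proof -
    have "(exp (- d * K) / 2 * Sq)\<^sup>2 \<le> s\<^sup>2" using s_ge Sq_pos by (intro power_mono) auto
    then have "(exp (- d * K) / 2 * Sq)\<^sup>2 / w \<le> s\<^sup>2 / w" using w_pos by (simp add: divide_right_mono)
    moreover have "(exp (- d * K) / 2 * Sq)\<^sup>2 / w = exp (- d * K) * exp (- d * K) / (4 * d) * Sq"
      using Sq_pos d_pos by (simp add: w_def power2_eq_square field_simps)
    moreover have "exp (- d * K) * exp (- d * K) / (4 * d) * (exp (- K) * n) \<le>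
        exp (- d * K) * exp (- d * K) / (4 * d) * Sq"
      using Sq_ge by (intro mult_left_mono) auto
    moreover have "var_const = exp (- d * K) * exp (- d * K) / (4 * d) * exp (- K)"
      unfolding var_const_def by (simp add: exp_add[symmetric] algebra_simps)
    ultimately show ?thesis by simp
  qed
  ultimately show ?thesis by linarith
qed

lemma variance_eq_E: "variance (\<lambda>\<omega>. H (\<lambda>c. Z c \<omega>)) = E (\<lambda>z. (H z - \<mu>)\<^sup>2)"
  by (simp add: E_def \<mu>_def)

section \<open>Local dependence of the summands attached to the centres\<close>

lemma bdd_finite_range: assumes "finite (range F)" shows "bdd F"
proof -
  have "\<bar>F z\<bar> \<le> Max (abs ` range F)" for z using assms by (intro Max_ge) auto
  then show ?thesis by (rule bddI)
qed

text \<open>The variables \<open>X j\<close> take the values 0 and 1 only, so finitely many of them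
  produce finitely many values of the sum, and every \<open>f\<close> is bounded on these.\<close>

lemma bdd_function_of_X:
  fixes A :: "'i set" and f :: "real \<Rightarrow> real"
  assumes A: "finite A" shows "bdd (\<lambda>z. f (\<Sum>j\<in>A. X j z - p j))"
proof (rule bdd_finite_range)
  have "range (\<lambda>z. f (\<Sum>j\<in>A. X j z - p j)) \<subseteq> (\<lambda>y. f (\<Sum>j\<in>A. y j - p j)) ` (PiE A (\<lambda>_. {0, 1}))"
  proof (rule image_subsetI)
    fix z
    have "f (\<Sum>j\<in>A. X j z - p j) = f (\<Sum>j\<in>A. restrict (\<lambda>j. X j z) A j - p j)"
      by (intro arg_cong[where f=f] sum.cong) auto
    moreover have "restrict (\<lambda>j. X j z) A \<in> PiE A (\<lambda>_. {0, 1})" using X_01 by auto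
    ultimately show "f (\<Sum>j\<in>A. X j z - p j) \<in> (\<lambda>y. f (\<Sum>j\<in>A. y j - p j)) ` (PiE A (\<lambda>_. {0, 1}))"
      by blast
  qed
  then show "finite (range (\<lambda>z. f (\<Sum>j\<in>A. X j z - p j)))"
    by (rule finite_subset) (use A in \<open>auto intro!: finite_imageI finite_PiE\<close>)
qed

definition x :: "'i \<Rightarrow> ('c \<Rightarrow> nat) \<Rightarrow> real" where "x i z = X i z - E (X i)"

lemma bdd_x: "bdd (x i)" unfolding x_def[abs_def] by (rule bdd_diff[OF bdd_X bdd_const])

lemma dep_x: "i \<in> I \<Longrightarrow> dep (x i) (cells 1 i)"
  unfolding x_def[abs_def] by (rule dep_compose[OF dep_X])

lemma E_x: "i \<in> I \<Longrightarrow> E (x i) = 0"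
  unfolding x_def[abs_def] using E_diff[OF dep_X_C bdd_X dep_const bdd_const, of i "E (X i)"]
  by (simp add: E_const)

text \<open>The radius is 2 = 1 + 1: each \<open>x j\<close> sees the cells one step around
  \<open>j\<close>, so centres outside \<open>near 2 i\<close> share no cells with
  \<open>x i\<close>. Consequently \<open>x i * R i\<close> sees the cells within 3 steps, and two
  such products are independent once the centres are more than 6 = 3 + 3 steps apart.\<close>

definition R :: "'i \<Rightarrow> ('c \<Rightarrow> nat) \<Rightarrow> real" where "R i z = (\<Sum>j\<in>near 2 i. x j z)"

lemma bdd_R: "bdd (R i)" unfolding R_def[abs_def] by (intro bdd_sum bdd_x)

lemma cells_mono: "l \<in> near k i \<Longrightarrow> cells m l \<subseteq> cells (k + m) i"
  using near_add by (fastforce simp: cells_def)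

lemma dep_R: assumes i: "i \<in> I" shows "dep (R i) (cells 3 i)"
  unfolding R_def[abs_def]
proof (rule dep_sum)
  fix j assume j: "j \<in> near 2 i"
  then have "j \<in> I" using near_subset[OF i] by blast
  then show "dep (x j) (cells 3 i)"
    using dep_x cells_mono[OF j, of 1] dep_mono by (simp del: near.simps) blast
qed

lemma dep_U: assumes i: "i \<in> I" shows "dep (\<lambda>z. x i z * R i z) (cells 3 i)"
proof (rule dep_compose2[OF dep_mono[OF dep_x[OF i]] dep_R[OF i]])
  show "cells 1 i \<subseteq> cells 3 i"
    using cells_mono[OF near_refl[OF i, of 2], of 1] by simp
qed

lemma E_decouple:
  assumes i: "i \<in> I"
  shows "E (\<lambda>z. x i z * f ((\<Sum>j\<in>I. x j z) - R i z)) = 0"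
proof -
  let ?T = "\<Union>j\<in>I - near 2 i. cells 1 j"
  have eq: "(\<Sum>j\<in>I. x j z) - R i z = (\<Sum>j\<in>I - near 2 i. X j z - E (X j))" for z
    unfolding R_def using finite_I near_subset[OF i, of 2] by (simp add: sum_diff x_def[abs_def])
  have "E (\<lambda>z. x i z * f ((\<Sum>j\<in>I. x j z) - R i z)) = E (x i) * E (\<lambda>z. f ((\<Sum>j\<in>I. x j z) - R i z))"
  proof (rule E_mult[OF dep_x[OF i] bdd_x])
    show "bdd (\<lambda>z. f ((\<Sum>j\<in>I. x j z) - R i z))"
      unfolding eq using finite_I by (intro bdd_function_of_X) auto
    have "dep (x j) ?T" if "j \<in> I - near 2 i" for j
      using that by (intro dep_mono[OF dep_x]) auto
    then have "dep (\<lambda>z. \<Sum>j\<in>I - near 2 i. x j z) ?T" by (rule dep_sum)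
    then have "dep (\<lambda>z. \<Sum>j\<in>I - near 2 i. X j z - E (X j)) ?T" by (simp only: x_def)
    then show "dep (\<lambda>z. f ((\<Sum>j\<in>I. x j z) - R i z)) ?T"
      unfolding eq by (rule dep_compose)
    have "cells 1 i \<inter> cells 1 j = {}" if "j \<in> I - near 2 i" for j
      using cells_disjoint[OF i, of j 1 1] that by (simp add: numeral_2_eq_2)
    then show "cells 1 i \<inter> ?T = {}" by blast
  qed (use cells_subset in blast)+
  then show ?thesis by (simp add: E_x[OF i])
qed

lemma E_uncorrelated:
  assumes i: "i \<in> I" and k: "k \<in> I" "k \<notin> near 6 i"
  shows "E (\<lambda>z. (x i z * R i z) * (x k z * R k z)) = E (\<lambda>z. x i z * R i z) * E (\<lambda>z. x k z * R k z)"
proof (rule E_mult[OF dep_U[OF i] bdd_mult[OF bdd_x bdd_R] dep_U[OF k(1)] bdd_mult[OF bdd_x bdd_R]])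
  show "cells 3 i \<inter> cells 3 k = {}" using cells_disjoint[OF i k(1), of 3 3] k(2) by simp
qed (rule cells_subset)+

lemma sum_x: "(\<Sum>i\<in>I. x i z) = H z - \<mu>"
proof -
  have "\<mu> = (\<Sum>i\<in>I. E (X i))"
    unfolding \<mu>_def H_eq[abs_def] by (rule E_sum) (auto intro: dep_X_C bdd_X)
  then show ?thesis by (simp add: x_def sum_subtractf H_eq)
qed

theorem normal_approximation:
  defines "V \<equiv> variance (\<lambda>\<omega>. H (\<lambda>c. Z c \<omega>))"
    and "D \<equiv> real d ^ 6"
  shows "var_const * n \<le> V" and "V \<le> 2 * D * n"
    and "\<bar>prob {\<omega>\<in>space M. (H (\<lambda>c. Z c \<omega>) - \<mu>) / sqrt V \<le> t} - Phi t\<bar> \<le> clt_const D var_const / sqrt V"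
    and "(\<And>y z. \<bar>h y - h z\<bar> \<le> \<bar>y - z\<bar>) \<Longrightarrow>
      \<bar>expectation (\<lambda>\<omega>. h ((H (\<lambda>c. Z c \<omega>) - \<mu>) / sqrt V)) - Nint h\<bar> \<le> clt_const D var_const / sqrt V"
proof -
  let ?X = "\<lambda>i \<omega>. X i (\<lambda>c. Z c \<omega>)"
  let ?x = "\<lambda>i \<omega>. ?X i \<omega> - expectation (?X i)"
  have x_eq: "?x i \<omega> = x i (\<lambda>c. Z c \<omega>)" for i \<omega> by (simp add: x_def E_def)
  have S_eq: "(\<Sum>i\<in>I. ?x i \<omega>) = H (\<lambda>c. Z c \<omega>) - \<mu>" for \<omega> by (simp only: x_eq sum_x)
  have S_eq': "(\<Sum>i\<in>I. x i (\<lambda>c. Z c \<omega>)) = H (\<lambda>c. Z c \<omega>) - \<mu>" for \<omega> by (rule sum_x)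
  have V_eq: "V = expectation (\<lambda>\<omega>. (\<Sum>i\<in>I. ?x i \<omega>)\<^sup>2)"
    unfolding V_def S_eq by (simp add: \<mu>_def E_def)
  have V_ge: "var_const * n \<le> V" unfolding V_def variance_eq_E by (rule variance_lower)
  have n_pos: "0 < n" using vol_pos by (simp add: n_def)
  \<comment> \<open>One bound \<open>d ^ 6\<close> serves for both neighbourhoods, of radius 2 and
    of radius 6.\<close>
  have card_near_6: "card (near k i) \<le> D" if "i \<in> I" "k \<le> 6" for i k
  proof -
    have "card (near k i) \<le> d ^ k" by (rule card_near[OF that(1)])
    also have "\<dots> \<le> d ^ 6" using that d_pos by (intro power_increasing) auto
    finally show ?thesis unfolding D_def by (metis of_nat_le_iff of_nat_power)
  qed
  interpret L: local_dependence M I ?X "near 2" "near 6" D n var_const "\<lambda>i. expectation (?X i)" ?x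
    "\<lambda>i \<omega>. \<Sum>j\<in>near 2 i. ?x j \<omega>" "\<lambda>\<omega>. \<Sum>i\<in>I. ?x i \<omega>" "expectation (\<lambda>\<omega>. (\<Sum>i\<in>I. ?x i \<omega>)\<^sup>2)"
  proof unfold_locales
    show "expectation (\<lambda>\<omega>. ?x i \<omega> * f ((\<Sum>i\<in>I. ?x i \<omega>) - (\<Sum>j\<in>near 2 i. ?x j \<omega>))) = 0" if "i \<in> I" for i f
      using E_decouple[OF that, of f] by (simp only: x_eq R_def E_def S_eq')
    show "expectation (\<lambda>\<omega>. (?x i \<omega> * (\<Sum>j\<in>near 2 i. ?x j \<omega>)) * (?x k \<omega> * (\<Sum>j\<in>near 2 k. ?x j \<omega>))) =
        expectation (\<lambda>\<omega>. ?x i \<omega> * (\<Sum>j\<in>near 2 i. ?x j \<omega>)) * expectation (\<lambda>\<omega>. ?x k \<omega> * (\<Sum>j\<in>near 2 k. ?x j \<omega>))"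
      if "i \<in> I" "k \<in> I" "k \<notin> near 6 i" for i k
      using E_uncorrelated[OF that] by (simp only: x_eq R_def E_def)
    have "(\<Sum>i\<in>I. E (X i)) \<le> n" unfolding n_def sum_blocks using E_X_le by (auto intro: sum_mono simp: a_def[symmetric])
    then show "(\<Sum>i\<in>I. expectation (?X i)) \<le> n" by (simp add: E_def)
    show "var_const * n \<le> expectation (\<lambda>\<omega>. (\<Sum>i\<in>I. ?x i \<omega>)\<^sup>2)" using V_ge unfolding V_eq .
    then show "0 < expectation (\<lambda>\<omega>. (\<Sum>i\<in>I. ?x i \<omega>)\<^sup>2)"
      using mult_pos_pos[OF var_const_pos n_pos] by linarith
  qed (use finite_I X_range near_subset card_near_6 var_const_pos meas[OF dep_X_C] in \<open>auto simp: D_def simp del: near.simps\<close>)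
  show "var_const * n \<le> V" by (rule V_ge)
  show "V \<le> 2 * D * n" unfolding V_eq by (rule L.V_le)
  show "\<bar>prob {\<omega>\<in>space M. (H (\<lambda>c. Z c \<omega>) - \<mu>) / sqrt V \<le> t} - Phi t\<bar> \<le> clt_const D var_const / sqrt V"
    using L.normal_approximation(1)[of t] unfolding L.W_def L.\<sigma>_def V_eq S_eq .
  show "\<bar>expectation (\<lambda>\<omega>. h ((H (\<lambda>c. Z c \<omega>) - \<mu>) / sqrt V)) - Nint h\<bar> \<le> clt_const D var_const / sqrt V"
    if "\<And>y z. \<bar>h y - h z\<bar> \<le> \<bar>y - z\<bar>"
    using L.normal_approximation(2)[OF that] unfolding L.W_def L.\<sigma>_def V_eq S_eq .
qed

end

section \<open>Hyperbolic space\<close>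

subsection \<open>The upper half-space\<close>

lemma hyp_space_snd_pos: "p \<in> hyp_space \<Longrightarrow> 0 < snd p" by (simp add: hyp_space_def)

lemma hyp_dist_arg_ge: "p \<in> hyp_space \<Longrightarrow> q \<in> hyp_space \<Longrightarrow> 1 \<le> 1 + (norm (p - q))\<^sup>2 / (2 * snd p * snd q)"
  by (simp add: hyp_space_def)

lemma hyp_dist_nonneg: "p \<in> hyp_space \<Longrightarrow> q \<in> hyp_space \<Longrightarrow> 0 \<le> hyp_dist p q"
  unfolding hyp_dist_def by (intro arcosh_nonneg_real hyp_dist_arg_ge)

lemma cosh_hyp_dist:
  "p \<in> hyp_space \<Longrightarrow> q \<in> hyp_space \<Longrightarrow> cosh (hyp_dist p q) = 1 + (norm (p - q))\<^sup>2 / (2 * snd p * snd q)"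
  unfolding hyp_dist_def by (intro cosh_arcosh_real hyp_dist_arg_ge)

lemma hyp_dist_commute: "hyp_dist p q = hyp_dist q p"
  by (simp add: hyp_dist_def norm_minus_commute mult_ac)

lemma hyp_dist_self: "hyp_dist p p = 0" by (simp add: hyp_dist_def)

text \<open>As cosh is increasing on the nonnegative reals, a condition on the distance becomes a
  polynomial inequality in the coordinates; topology and measurability of balls are read off from
  it.\<close>

lemma hyp_dist_le_iff:
  assumes "p \<in> hyp_space" "q \<in> hyp_space" "0 \<le> r"
  shows "hyp_dist p q \<le> r \<longleftrightarrow> (norm (p - q))\<^sup>2 \<le> 2 * snd p * snd q * (cosh r - 1)"
proof -
  have "hyp_dist p q \<le> r \<longleftrightarrow> cosh (hyp_dist p q) \<le> cosh r"
    using assms by (intro cosh_real_nonneg_le_iff[symmetric] hyp_dist_nonneg)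
  then show ?thesis using assms hyp_space_snd_pos[OF assms(1)] hyp_space_snd_pos[OF assms(2)]
    by (simp add: cosh_hyp_dist field_simps)
qed

lemma hyp_dist_less_iff:
  assumes "p \<in> hyp_space" "q \<in> hyp_space" "0 \<le> r"
  shows "hyp_dist p q < r \<longleftrightarrow> (norm (p - q))\<^sup>2 < 2 * snd p * snd q * (cosh r - 1)"
proof -
  have "hyp_dist p q < r \<longleftrightarrow> cosh (hyp_dist p q) < cosh r"
    using assms by (intro cosh_real_nonneg_less_iff[symmetric] hyp_dist_nonneg)
  then show ?thesis using assms hyp_space_snd_pos[OF assms(1)] hyp_space_snd_pos[OF assms(2)]
    by (simp add: cosh_hyp_dist field_simps)
qed

lemma hyp_dist_eq_0_iff:
  assumes "p \<in> hyp_space" "q \<in> hyp_space"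
  shows "hyp_dist p q = 0 \<longleftrightarrow> p = q"
  using hyp_dist_le_iff[OF assms, of 0] hyp_dist_nonneg[OF assms] by auto

section \<open>Ptolemy's inequality and the hyperbolic triangle inequality\<close>

lemma ptolemy_origin:
  fixes a b c :: "'b::real_inner"
  assumes "a \<noteq> 0" "b \<noteq> 0" "c \<noteq> 0"
  shows "norm (a - c) * norm b \<le> norm (a - b) * norm c + norm (b - c) * norm a"
proof -
  \<comment> \<open>Inversion in the unit sphere multiplies the distance of \<open>u\<close> and
    \<open>w\<close> by 1/(\<bar>u\<bar> \<bar>w\<bar>), so the triangle inequality for the images
    is Ptolemy's inequality.\<close>
  define inv where "inv u = (1 / (norm u)\<^sup>2) *\<^sub>R u" for u :: 'b
  have inv: "norm (inv u - inv w) = norm (u - w) / (norm u * norm w)" if "u \<noteq> 0" "w \<noteq> 0" for u w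
  proof (rule power2_eq_imp_eq)
    have "(norm (inv u - inv w))\<^sup>2 = (norm (inv u))\<^sup>2 + (norm (inv w))\<^sup>2 - 2 * (inv u \<bullet> inv w)"
      by (simp add: power2_norm_eq_inner inner_diff_left inner_diff_right inner_commute)
    also have "\<dots> = 1 / (norm u)\<^sup>2 + 1 / (norm w)\<^sup>2 - 2 * (u \<bullet> w) / ((norm u)\<^sup>2 * (norm w)\<^sup>2)"
      using that by (simp add: inv_def power_divide power2_eq_square)
    also have "\<dots> = ((norm u)\<^sup>2 + (norm w)\<^sup>2 - 2 * (u \<bullet> w)) / ((norm u)\<^sup>2 * (norm w)\<^sup>2)"
      using that by (simp add: field_simps)
    also have "(norm u)\<^sup>2 + (norm w)\<^sup>2 - 2 * (u \<bullet> w) = (norm (u - w))\<^sup>2"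
      by (simp add: power2_norm_eq_inner inner_diff_left inner_diff_right inner_commute)
    finally show "(norm (inv u - inv w))\<^sup>2 = (norm (u - w) / (norm u * norm w))\<^sup>2"
      by (simp add: power_divide power_mult_distrib)
  qed auto
  have "norm (inv a - inv c) \<le> norm (inv a - inv b) + norm (inv b - inv c)"
    using norm_triangle_ineq[of "inv a - inv b" "inv b - inv c"] by simp
  then have "norm (a - c) / (norm a * norm c) \<le>
      norm (a - b) / (norm a * norm b) + norm (b - c) / (norm b * norm c)"
    using assms by (simp add: inv)
  then have "norm (a - c) / (norm a * norm c) * (norm a * norm b * norm c) \<le>
      (norm (a - b) / (norm a * norm b) + norm (b - c) / (norm b * norm c)) * (norm a * norm b * norm c)"
    by (rule mult_right_mono) simp
  also have "norm (a - c) / (norm a * norm c) * (norm a * norm b * norm c) = norm (a - c) * norm b"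
    using assms by simp
  also have "(norm (a - b) / (norm a * norm b) + norm (b - c) / (norm b * norm c)) * (norm a * norm b * norm c)
      = norm (a - b) * norm c + norm (b - c) * norm a"
    unfolding distrib_right using assms by simp
  finally show ?thesis .
qed

definition hyp_reflect :: "'a::euclidean_space \<times> real \<Rightarrow> 'a \<times> real" where
  "hyp_reflect p = (fst p, - snd p)"

lemma norm_hyp_reflect: "(norm (p - hyp_reflect q))\<^sup>2 = (norm (p - q))\<^sup>2 + 4 * snd p * snd q"
  by (simp add: hyp_reflect_def power2_norm_eq_inner inner_prod_def algebra_simps)

lemma norm_hyp_reflect_commute: "norm (p - hyp_reflect q) = norm (q - hyp_reflect p)"
  by (simp add: hyp_reflect_def norm_prod_def norm_minus_commute add.commute)

text \<open>The first formula is cosh d = 1 + 2 sinh^2 (d/2). For the second, adding 1 to the square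
  of the hyperbolic sine adds \<open>4 * snd p * snd q\<close> to the squared norm, which is exactly
  the effect of reflecting \<open>q\<close> in the boundary.\<close>

lemma half_hyp_dist:
  assumes p: "p \<in> hyp_space" and q: "q \<in> hyp_space"
  shows "sinh (hyp_dist p q / 2) = norm (p - q) / (2 * sqrt (snd p) * sqrt (snd q))"
    and "cosh (hyp_dist p q / 2) = norm (p - hyp_reflect q) / (2 * sqrt (snd p) * sqrt (snd q))"
proof -
  let ?d = "hyp_dist p q" and ?m = "2 * sqrt (snd p) * sqrt (snd q)"
  have pos: "0 < snd p" "0 < snd q" using p q by (simp_all add: hyp_space_def)
  have m2: "?m\<^sup>2 = 4 * snd p * snd q" using pos by (simp add: power_mult_distrib)
  have c: "cosh ?d = 1 + 2 * (norm (p - q))\<^sup>2 / ?m\<^sup>2"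
    unfolding m2 using cosh_hyp_dist[OF p q] pos by (simp add: field_simps)
  have "cosh ?d = 1 + 2 * (sinh (?d / 2))\<^sup>2"
    using cosh_double[of "?d / 2"] cosh_square_eq[of "?d / 2"] by simp
  then have s2: "(sinh (?d / 2))\<^sup>2 = (norm (p - q) / ?m)\<^sup>2" using c by (simp add: power_divide)
  show "sinh (?d / 2) = norm (p - q) / ?m"
    using s2 by (rule power2_eq_imp_eq) (use hyp_dist_nonneg[OF p q] pos in auto)
  have "(cosh (?d / 2))\<^sup>2 = (norm (p - q) / ?m)\<^sup>2 + 1" using s2 by (simp add: cosh_square_eq)
  also have "\<dots> = (norm (p - hyp_reflect q) / ?m)\<^sup>2"
    unfolding power_divide norm_hyp_reflect m2 using pos by (simp add: add_divide_distrib)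
  finally show "cosh (?d / 2) = norm (p - hyp_reflect q) / ?m"
    by (rule power2_eq_imp_eq) (use pos in \<open>auto intro: cosh_real_nonneg\<close>)
qed

text \<open>With \<open>sinh (d/2)\<close> and \<open>cosh (d/2)\<close> given by the distances to the point and to its reflection, the
  addition theorem turns Ptolemy's inequality for \<open>x, y, z\<close> and the reflection of \<open>y\<close> into the
  triangle inequality.\<close>

lemma hyp_dist_triangle:
  assumes x: "x \<in> hyp_space" and y: "y \<in> hyp_space" and z: "z \<in> hyp_space"
  shows "hyp_dist x z \<le> hyp_dist x y + hyp_dist y z"
proof -
  let ?s = "\<lambda>p. sqrt (snd p)"
  have pos: "0 < snd x" "0 < snd y" "0 < snd z" using x y z by (simp_all add: hyp_space_def)
  have ne: "p - hyp_reflect y \<noteq> 0" if "0 < snd p" for p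
    using that pos by (auto simp: hyp_reflect_def prod_eq_iff)
  \<comment> \<open>The reflection of \<open>y\<close> is translated to the origin; the distance of
    \<open>y\<close> from it is \<open>2 * snd y\<close>, which cancels later.\<close>
  have "norm ((x - hyp_reflect y) - (z - hyp_reflect y)) * norm (y - hyp_reflect y) \<le>
      norm ((x - hyp_reflect y) - (y - hyp_reflect y)) * norm (z - hyp_reflect y) + norm ((y - hyp_reflect y) - (z - hyp_reflect y)) * norm (x - hyp_reflect y)"
    by (rule ptolemy_origin) (use ne pos in auto)
  moreover have "norm (y - hyp_reflect y) = 2 * snd y" using pos by (simp add: hyp_reflect_def norm_prod_def real_sqrt_mult)
  moreover have "norm (z - hyp_reflect y) = norm (y - hyp_reflect z)" by (rule norm_hyp_reflect_commute)
  ultimately have pt: "norm (x - z) * (2 * snd y) \<le> norm (x - y) * norm (y - hyp_reflect z) + norm (x - hyp_reflect y) * norm (y - z)"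
    by (simp add: mult.commute)
  have "sinh (hyp_dist x z / 2) = norm (x - z) * (2 * snd y) / (4 * snd y * ?s x * ?s z)"
    using half_hyp_dist[OF x z] pos by (simp add: field_simps)
  also have "\<dots> \<le> (norm (x - y) * norm (y - hyp_reflect z) + norm (x - hyp_reflect y) * norm (y - z)) / (4 * snd y * ?s x * ?s z)"
    using pt pos by (intro divide_right_mono) auto
  also have "\<dots> = sinh (hyp_dist x y / 2) * cosh (hyp_dist y z / 2) + cosh (hyp_dist x y / 2) * sinh (hyp_dist y z / 2)"
  proof -
    have "?s y * ?s y = snd y" using pos by simp
    then have e4: "4 * snd y * ?s x * ?s z = (2 * ?s x * ?s y) * (2 * ?s y * ?s z)" by (simp add: mult_ac)
    show ?thesis
      unfolding half_hyp_dist[OF x y] half_hyp_dist[OF y z]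
      by (simp only: e4 times_divide_times_eq add_divide_distrib)
  qed
  also have "\<dots> = sinh ((hyp_dist x y + hyp_dist y z) / 2)"
    by (simp add: sinh_add add_divide_distrib)
  finally show ?thesis by simp
qed

text \<open>With t for the height of \<open>q\<close> and s for that of \<open>p\<close>, the
  condition on the distance implies (t - s exp(-r)) (t - s exp r) \<le> 0, so t lies between the two
  roots. The horizontal bound uses cosh r - 1 \<le> exp r.\<close>

lemma hyp_ball_height:
  assumes p: "p \<in> hyp_space" and q: "q \<in> hyp_ball p r" and r: "0 \<le> r"
  shows "snd p * exp (- r) \<le> snd q" "snd q \<le> snd p * exp r"
    "(norm (fst q - fst p))\<^sup>2 \<le> 2 * snd p * snd q * exp r"
proof -
  have qs: "q \<in> hyp_space" and d: "hyp_dist p q \<le> r" using q by (auto simp: hyp_ball_def)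
  let ?s = "snd p" and ?t = "snd q"
  have pos: "0 < ?s" "0 < ?t" using p qs by (simp_all add: hyp_space_def)
  have le: "(norm (p - q))\<^sup>2 \<le> 2 * ?s * ?t * (cosh r - 1)" using hyp_dist_le_iff[OF p qs r] d by simp
  have nrm: "(norm (p - q))\<^sup>2 = (norm (fst q - fst p))\<^sup>2 + (?s - ?t)\<^sup>2"
    by (simp add: norm_prod_def norm_minus_commute)
  have ch: "2 * cosh r = exp r + exp (- r)" by (simp add: cosh_def)
  have er: "exp r * exp (- r) = 1" by (simp add: exp_minus)
  have "(?s - ?t)\<^sup>2 \<le> 2 * ?s * ?t * (cosh r - 1)" using le nrm by (smt (verit) zero_le_power2)
  then have "?s\<^sup>2 + ?t\<^sup>2 \<le> ?s * ?t * (2 * cosh r)" by (simp add: power2_eq_square algebra_simps)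
  then have "?s * ?s * (exp r * exp (- r)) + ?t * ?t \<le> ?s * ?t * exp r + ?s * ?t * exp (- r)"
    unfolding ch er by (simp add: power2_eq_square algebra_simps)
  then have "(?t - ?s * exp (- r)) * (?t - ?s * exp r) \<le> 0" by (simp add: algebra_simps)
  moreover have "?s * exp (- r) \<le> ?s * exp r" using pos r by simp
  ultimately show "?s * exp (- r) \<le> ?t" "?t \<le> ?s * exp r"
    by (smt (verit) mult_neg_neg mult_pos_pos)+
  have "cosh r - 1 \<le> exp r" using ch r by (smt (verit) exp_le_cancel_iff)
  then have "2 * ?s * ?t * (cosh r - 1) \<le> 2 * ?s * ?t * exp r" using pos by (intro mult_left_mono) auto
  then show "(norm (fst q - fst p))\<^sup>2 \<le> 2 * ?s * ?t * exp r"
    using le nrm by (smt (verit) zero_le_power2)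
qed

lemma hyp_ball_subset: "hyp_ball p r \<subseteq> hyp_space" by (auto simp: hyp_ball_def)

text \<open>The half-space is open, so closedness is not immediate. The lower bound on the height
  replaces the condition of lying in the half-space by a closed one, and the upper bound on the
  height makes the set bounded.\<close>

lemma compact_hyp_ball:
  fixes p :: "'a::euclidean_space \<times> real"
  assumes p: "p \<in> hyp_space" and r: "0 \<le> r" shows "compact (hyp_ball p r)"
proof -
  have pos: "0 < snd p" using p by (simp add: hyp_space_def)
  have eq: "hyp_ball p r = {q. snd p * exp (- r) \<le> snd q \<and>
      (norm (p - q))\<^sup>2 \<le> 2 * snd p * snd q * (cosh r - 1)}" (is "_ = ?B")
  proof (rule set_eqI)
    fix q
    show "q \<in> hyp_ball p r \<longleftrightarrow> q \<in> ?B"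
    proof
      assume q: "q \<in> hyp_ball p r"
      then show "q \<in> ?B" using hyp_ball_height(1)[OF p q r] hyp_dist_le_iff[OF p _ r, of q]
        by (auto simp: hyp_ball_def)
    next
      assume q: "q \<in> ?B"
      have "0 < snd p * exp (- r)" using pos by simp
      then have "q \<in> hyp_space" using q by (simp add: hyp_space_def)
      then show "q \<in> hyp_ball p r" using q hyp_dist_le_iff[OF p _ r, of q] by (auto simp: hyp_ball_def)
    qed
  qed
  have "closed ?B" by (intro closed_Collect_conj closed_Collect_le continuous_intros)
  moreover have "hyp_ball p r \<subseteq> cball p (sqrt (2 * snd p * (snd p * exp r) * (cosh r - 1)))"
  proof
    fix q assume q: "q \<in> hyp_ball p r"
    have "(norm (p - q))\<^sup>2 \<le> 2 * snd p * snd q * (cosh r - 1)" using q eq by auto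
    also have "\<dots> \<le> 2 * snd p * (snd p * exp r) * (cosh r - 1)"
      using hyp_ball_height(2)[OF p q r] pos cosh_real_ge_1[of r]
      by (intro mult_right_mono mult_left_mono) auto
    finally show "q \<in> cball p (sqrt (2 * snd p * (snd p * exp r) * (cosh r - 1)))"
      by (simp add: dist_norm real_le_rsqrt)
  qed
  then have "bounded (hyp_ball p r)" using bounded_cball bounded_subset by blast
  ultimately show ?thesis unfolding eq[symmetric] by (simp add: compact_eq_bounded_closed)
qed

lemma open_hyp_space: "open (hyp_space :: ('a::euclidean_space \<times> real) set)"
  unfolding hyp_space_def by (intro open_Collect_less continuous_intros)

lemma open_hyp_ball:
  assumes p: "p \<in> hyp_space" and r: "0 \<le> r" shows "open {q \<in> hyp_space. hyp_dist p q < r}"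
proof -
  have "{q \<in> hyp_space. hyp_dist p q < r} =
      hyp_space \<inter> {q. (norm (p - q))\<^sup>2 < 2 * snd p * snd q * (cosh r - 1)}"
    using hyp_dist_less_iff[OF p _ r] by auto
  then show ?thesis
    by (auto intro!: open_Int open_hyp_space open_Collect_less continuous_intros)
qed

section \<open>Covering and packing of balls\<close>

lemma hyp_ball_finite_cover:
  assumes p: "p \<in> hyp_space" and r: "0 \<le> r" and \<delta>: "0 < \<delta>"
  obtains F where "finite F" "F \<subseteq> hyp_ball p r" "\<And>q. q \<in> hyp_ball p r \<Longrightarrow> \<exists>x\<in>F. hyp_dist x q < \<delta>"
proof -
  have c1: "hyp_ball p r \<subseteq> (\<Union>x\<in>hyp_ball p r. {q \<in> hyp_space. hyp_dist x q < \<delta>})"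
    using hyp_ball_subset[of p r] \<delta> by (auto simp: hyp_dist_self)
  have c2: "open {q \<in> hyp_space. hyp_dist x q < \<delta>}" if "x \<in> hyp_ball p r" for x
    using that \<delta> hyp_ball_subset[of p r] by (intro open_hyp_ball) auto
  obtain F where F: "F \<subseteq> hyp_ball p r" "finite F" "hyp_ball p r \<subseteq> (\<Union>x\<in>F. {q \<in> hyp_space. hyp_dist x q < \<delta>})"
    by (rule compactE_image[OF compact_hyp_ball[OF p r] c2 c1])
  show ?thesis
    by (rule that[OF F(2,1)]) (use F(3) in blast)
qed

definition hyp_separated :: "real \<Rightarrow> ('a::euclidean_space \<times> real) set \<Rightarrow> bool" where
  "hyp_separated \<delta> A \<longleftrightarrow> A \<subseteq> hyp_space \<and> (\<forall>x\<in>A. \<forall>y\<in>A. x \<noteq> y \<longrightarrow> \<delta> \<le> hyp_dist x y)"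

text \<open>A ball of radius \<delta>/2 contains at most one point of a \<delta>-separated set, so
  the assignment of points to covering balls is injective.\<close>

lemma card_separated_le_cover:
  assumes F: "finite F" "F \<subseteq> hyp_space" and cover: "\<And>q. q \<in> A \<Longrightarrow> \<exists>x\<in>F. hyp_dist x q < \<delta> / 2"
    and A: "hyp_separated \<delta> A"
  shows "finite A" "card A \<le> card F"
proof -
  obtain f where f: "\<And>q. q \<in> A \<Longrightarrow> f q \<in> F \<and> hyp_dist (f q) q < \<delta> / 2" using cover by metis
  have "inj_on f A"
  proof (rule inj_onI, rule ccontr)
    fix x y assume xy: "x \<in> A" "y \<in> A" "f x = f y" "x \<noteq> y"
    have "\<delta> \<le> hyp_dist x y" using A xy by (auto simp: hyp_separated_def)
    also have "\<dots> \<le> hyp_dist x (f x) + hyp_dist (f x) y"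
      using A xy F f[OF xy(1)] by (intro hyp_dist_triangle) (auto simp: hyp_separated_def)
    also have "\<dots> < \<delta> / 2 + \<delta> / 2"
      using f[OF xy(1)] f[OF xy(2)] xy(3) by (simp add: hyp_dist_commute[of x])
    finally show False by simp
  qed
  moreover have "f ` A \<subseteq> F" using f by auto
  ultimately show "finite A" "card A \<le> card F"
    using F(1) inj_on_finite card_inj_on_le by blast+
qed

text \<open>A horizontal translation followed by a dilation: an isometry that takes \<open>p\<close>
  to the base point (0, 1).\<close>

definition hyp_normalize :: "'a::euclidean_space \<times> real \<Rightarrow> 'a \<times> real \<Rightarrow> 'a \<times> real" where
  "hyp_normalize p q = (1 / snd p) *\<^sub>R (q - (fst p, 0))"

lemma hyp_normalize_in: "p \<in> hyp_space \<Longrightarrow> q \<in> hyp_space \<Longrightarrow> hyp_normalize p q \<in> hyp_space"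
  by (simp add: hyp_normalize_def hyp_space_def)

lemma hyp_normalize_self: "p \<in> hyp_space \<Longrightarrow> hyp_normalize p p = (0, 1)"
  by (simp add: hyp_normalize_def hyp_space_def prod_eq_iff)

lemma hyp_dist_normalize:
  assumes p: "p \<in> hyp_space"
  shows "hyp_dist (hyp_normalize p x) (hyp_normalize p y) = hyp_dist x y"
proof -
  have pos: "0 < snd p" using p by (simp add: hyp_space_def)
  have "hyp_normalize p x - hyp_normalize p y = (1 / snd p) *\<^sub>R (x - y)"
    by (simp add: hyp_normalize_def scaleR_diff_right[symmetric])
  then have "(norm (hyp_normalize p x - hyp_normalize p y))\<^sup>2 = (norm (x - y))\<^sup>2 / (snd p)\<^sup>2"
    using pos by (simp add: power_divide)
  moreover have "snd (hyp_normalize p q) = snd q / snd p" for q by (simp add: hyp_normalize_def)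
  ultimately show ?thesis using pos by (simp add: hyp_dist_def power2_eq_square)
qed

text \<open>Compactness yields a bound for the ball around (0, 1); the isometry
  \<open>hyp_normalize p\<close> transports it to every \<open>p\<close>. The uniformity in
  \<open>p\<close> is what makes the final constant independent of the size of the window.\<close>

lemma hyp_packing:
  assumes r: "0 \<le> r" and \<delta>: "0 < \<delta>"
  obtains m :: nat where "\<And>p A. (p :: 'a::euclidean_space \<times> real) \<in> hyp_space \<Longrightarrow> hyp_separated \<delta> A \<Longrightarrow>
      A \<subseteq> hyp_ball p r \<Longrightarrow> finite A \<and> card A \<le> m"
proof -
  let ?o = "(0, 1) :: 'a \<times> real"
  have o: "?o \<in> hyp_space" by (simp add: hyp_space_def)
  obtain F where F: "finite F" "F \<subseteq> hyp_ball ?o r" "\<And>q. q \<in> hyp_ball ?o r \<Longrightarrow> \<exists>x\<in>F. hyp_dist x q < \<delta> / 2"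
    using hyp_ball_finite_cover[OF o r, of "\<delta> / 2"] \<delta> by auto
  show ?thesis
  proof
    fix p :: "'a \<times> real" and A assume p: "p \<in> hyp_space" and A: "hyp_separated \<delta> A" "A \<subseteq> hyp_ball p r"
    let ?n = "hyp_normalize p"
    have pos: "0 < snd p" using p by (simp add: hyp_space_def)
    have inj: "inj_on ?n A" using pos by (auto simp: inj_on_def hyp_normalize_def)
    have sub: "?n ` A \<subseteq> hyp_ball ?o r"
    proof (rule image_subsetI)
      fix q assume "q \<in> A"
      then have "q \<in> hyp_space" "hyp_dist p q \<le> r" using A(2) by (auto simp: hyp_ball_def)
      then show "?n q \<in> hyp_ball ?o r"
        using hyp_normalize_in[OF p] hyp_dist_normalize[OF p, of p q] hyp_normalize_self[OF p]
        by (simp add: hyp_ball_def)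
    qed
    have sep: "hyp_separated \<delta> (?n ` A)"
      unfolding hyp_separated_def
    proof (intro conjI ballI impI)
      show "?n ` A \<subseteq> hyp_space"
        using A(1) by (intro image_subsetI hyp_normalize_in[OF p]) (auto simp: hyp_separated_def)
    next
      fix x y assume "x \<in> ?n ` A" "y \<in> ?n ` A" and ne: "x \<noteq> y"
      then obtain u w where uw: "u \<in> A" "w \<in> A" "x = ?n u" "y = ?n w" by blast
      have "u \<noteq> w" using ne uw(3,4) by metis
      then have "\<delta> \<le> hyp_dist u w" using A(1) uw(1,2) by (simp add: hyp_separated_def)
      then show "\<delta> \<le> hyp_dist x y" unfolding uw(3,4) hyp_dist_normalize[OF p] .
    qed
    have Fs: "F \<subseteq> hyp_space" using F(2) hyp_ball_subset by (rule order.trans)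
    have cover: "\<exists>x\<in>F. hyp_dist x q < \<delta> / 2" if "q \<in> ?n ` A" for q
      using subsetD[OF sub that] by (rule F(3))
    have "finite (?n ` A)" "card (?n ` A) \<le> card F"
      by (rule card_separated_le_cover[OF F(1) Fs cover sep], assumption)+
    then show "finite A \<and> card A \<le> card F"
      using inj by (simp add: card_image finite_image_iff)
  qed
qed

subsection \<open>Volume of balls\<close>

lemma hyp_space_borel [measurable]: "hyp_space \<in> sets borel"
  using open_hyp_space by (rule borel_open)

lemma hyp_ball_borel: "p \<in> hyp_space \<Longrightarrow> 0 \<le> r \<Longrightarrow> hyp_ball p r \<in> sets borel"
  by (intro borel_compact compact_hyp_ball)

lemma sets_hyp_vol: "A \<in> sets hyp_vol \<longleftrightarrow> A \<in> sets borel \<and> A \<subseteq> hyp_space"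
  by (auto simp: hyp_vol_def sets_restrict_space_iff)

lemma space_hyp_vol: "space hyp_vol = hyp_space"
  by (simp add: hyp_vol_def space_restrict_space)

lemma borel_measurable_snd_compose:
  fixes h :: "real \<Rightarrow> ennreal"
  assumes "h \<in> borel_measurable borel"
  shows "(\<lambda>q :: 'a::euclidean_space \<times> real. h (snd q)) \<in> borel_measurable borel"
proof (rule measurable_compose[OF _ assms])
  show "(snd :: 'a \<times> real \<Rightarrow> real) \<in> borel_measurable borel"
    by (intro borel_measurable_continuous_onI continuous_intros)
qed

lemma emeasure_hyp_vol:
  fixes A :: "('a::euclidean_space \<times> real) set"
  assumes "A \<in> sets borel" "A \<subseteq> hyp_space"
  shows "emeasure hyp_vol A = (\<integral>\<^sup>+q. ennreal (1 / snd q ^ DIM('a \<times> real)) * indicator A q \<partial>lborel)"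
proof -
  have m: "(\<lambda>q :: 'a \<times> real. ennreal (1 / snd q ^ DIM('a \<times> real))) \<in> borel_measurable borel"
    by (rule borel_measurable_snd_compose) measurable
  have "emeasure hyp_vol A =
      (\<integral>\<^sup>+q. ennreal (1 / snd q ^ DIM('a \<times> real)) * indicator A q \<partial>restrict_space lborel hyp_space)"
    unfolding hyp_vol_def using assms m
    by (intro emeasure_density) (auto simp: sets_restrict_space_iff intro: measurable_restrict_space1)
  also have "\<dots> = (\<integral>\<^sup>+q. ennreal (1 / snd q ^ DIM('a \<times> real)) * indicator A q * indicator hyp_space q \<partial>lborel)"
    by (rule nn_integral_restrict_space) simp
  also have "\<dots> = (\<integral>\<^sup>+q. ennreal (1 / snd q ^ DIM('a \<times> real)) * indicator A q \<partial>lborel)"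
    using assms(2) by (intro nn_integral_cong) (auto split: split_indicator)
  finally show ?thesis .
qed

lemma nn_integral_powr_tail:
  fixes a b :: real
  assumes "0 < a" "0 < b"
  shows "(\<integral>\<^sup>+t. ennreal (t powr (- b - 1)) * indicator {a..} t \<partial>lborel) = ennreal (a powr (- b) / b)"
proof -
  have "(\<integral>\<^sup>+t. ennreal (t powr (- b - 1)) * indicator {a..} t \<partial>lborel) = ennreal (0 - (- (a powr (- b)) / b))"
  proof (rule nn_integral_FTC_atLeast)
    show "((\<lambda>t. - (t powr (- b)) / b) has_real_derivative t powr (- b - 1)) (at t)" if "a \<le> t" for t
      using that assms by (auto intro!: derivative_eq_intros)
    show "((\<lambda>t. - (t powr (- b)) / b) \<longlongrightarrow> 0) at_top"
      using assms by real_asymp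
  qed auto
  then show ?thesis by simp
qed

text \<open>At height t the ball lies inside a Euclidean ball of dimension \<open>k\<close> and
  squared radius 2 s t exp r, where s is the height of \<open>p\<close>, and t is at least s
  exp(-r). Integrating t powr (- k/2 - 1) over these heights gives the factor \<open>2 / k\<close>.
  The radius and the lower end of the range contribute exp (k r / 2) each, and the powers of s
  cancel.\<close>

lemma hyp_ball_volume:
  defines "k \<equiv> DIM('a::euclidean_space)"
  defines "\<Gamma> \<equiv> unit_ball_vol k * (2 / k) * 2 powr (k / 2)"
  assumes p: "(p :: 'a \<times> real) \<in> hyp_space" and r: "0 \<le> r"
  shows "emeasure hyp_vol (hyp_ball p r) \<le> ennreal (\<Gamma> * exp (k * r))"
proof -
  let ?s = "snd p" and ?a = "snd p * exp (- r)" and ?\<omega> = "unit_ball_vol k"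
  have pos: "0 < ?s" using p by (simp add: hyp_space_def)
  have a: "0 < ?a" using pos by simp
  have k: "0 < k" by (simp add: k_def)
  let ?R = "\<lambda>t. sqrt (2 * ?s * t * exp r)"
  let ?g = "\<lambda>q :: 'a \<times> real. ennreal (1 / snd q ^ (k + 1)) * indicator {?a..} (snd q) *
      indicator (cball (fst p) (?R (snd q))) (fst q)"
  have gm: "?g \<in> borel_measurable (lborel \<Otimes>\<^sub>M lborel)"
  proof -
    have "(\<lambda>q :: 'a \<times> real. indicator (cball (fst p) (?R (snd q))) (fst q) :: ennreal) =
        indicator {q. dist (fst p) (fst q) \<le> ?R (snd q)}"
      by (auto simp: fun_eq_iff indicator_def)
    moreover have "closed {q :: 'a \<times> real. dist (fst p) (fst q) \<le> ?R (snd q)}"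
      by (intro closed_Collect_le continuous_intros)
    ultimately have 2: "(\<lambda>q :: 'a \<times> real. indicator (cball (fst p) (?R (snd q))) (fst q) :: ennreal) \<in> borel_measurable borel"
      by (simp add: borel_closed)
    have 1: "(\<lambda>q :: 'a \<times> real. ennreal (1 / snd q ^ (k + 1)) * indicator {?a..} (snd q)) \<in> borel_measurable borel"
      by (rule borel_measurable_snd_compose) measurable
    have "?g \<in> borel_measurable borel" using 1 2 by (rule borel_measurable_times_ennreal)
    then show ?thesis by (simp add: lborel_prod)
  qed
  have "emeasure hyp_vol (hyp_ball p r) =
      (\<integral>\<^sup>+q. ennreal (1 / snd q ^ DIM('a \<times> real)) * indicator (hyp_ball p r) q \<partial>lborel)"
    by (intro emeasure_hyp_vol hyp_ball_borel p r hyp_ball_subset)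
  also have "\<dots> \<le> (\<integral>\<^sup>+q. ?g q \<partial>lborel)"
  proof (rule nn_integral_mono)
    fix q :: "'a \<times> real"
    show "ennreal (1 / snd q ^ DIM('a \<times> real)) * indicator (hyp_ball p r) q \<le> ?g q"
    proof (cases "q \<in> hyp_ball p r")
      case True
      note h = hyp_ball_height[OF p True r]
      have "norm (fst q - fst p) \<le> ?R (snd q)" using h(3) by (intro real_le_rsqrt) (simp add: mult_ac)
      then have "fst q \<in> cball (fst p) (?R (snd q))" by (simp add: dist_norm norm_minus_commute)
      then show ?thesis using h(1) True by (simp add: k_def)
    qed simp
  qed
  also have "\<dots> = (\<integral>\<^sup>+q. ?g q \<partial>(lborel \<Otimes>\<^sub>M lborel))" by (simp add: lborel_prod)
  also have "\<dots> = (\<integral>\<^sup>+t. (\<integral>\<^sup>+x. ?g (x, t) \<partial>lborel) \<partial>lborel)"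
    by (rule lborel_pair.nn_integral_snd[symmetric]) (rule gm)
  also have "\<dots> = (\<integral>\<^sup>+t. ennreal (?\<omega> * (2 * ?s * exp r) powr (k / 2)) *
      (ennreal (t powr (- (k / 2) - 1)) * indicator {?a..} t) \<partial>lborel)"
  proof (rule nn_integral_cong)
    fix t :: real
    have "(\<integral>\<^sup>+x. ?g (x, t) \<partial>lborel) =
        ennreal (1 / t ^ (k + 1)) * indicator {?a..} t * emeasure lborel (cball (fst p) (?R t))"
      unfolding fst_conv snd_conv by (rule nn_integral_cmult_indicator) simp
    also have "\<dots> = ennreal (?\<omega> * (2 * ?s * exp r) powr (k / 2)) *
        (ennreal (t powr (- (k / 2) - 1)) * indicator {?a..} t)"
    proof (cases "?a \<le> t")
      case True
      then have t: "0 < t" using a by linarith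
      have "?R t ^ k = (2 * ?s * exp r * t) powr (k / 2)"
      proof -
        have "?R t = (2 * ?s * exp r * t) powr (1 / 2)" using t pos by (simp add: powr_half_sqrt mult_ac)
        then have "?R t powr k = (2 * ?s * exp r * t) powr (k / 2)" by (simp only: powr_powr) simp
        then show ?thesis using t pos by (simp add: powr_realpow)
      qed
      also have "\<dots> = (2 * ?s * exp r) powr (k / 2) * t powr (k / 2)" using t pos by (simp add: powr_mult)
      finally have Rk: "?R t ^ k = (2 * ?s * exp r) powr (k / 2) * t powr (k / 2)" .
      have t1: "1 / t ^ (k + 1) = t powr (- real (k + 1))"
        using powr_realpow[OF t, of "k + 1"] by (simp only: powr_minus_divide)
      have t2: "- real (k + 1) + k / 2 = - (k / 2) - 1" by simp
      have tk: "1 / t ^ (k + 1) * t powr (k / 2) = t powr (- (k / 2) - 1)"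
        by (simp only: t1 t2 powr_add[symmetric])
      have eq: "1 / t ^ (k + 1) * (?\<omega> * ?R t ^ k) = ?\<omega> * (2 * ?s * exp r) powr (k / 2) * t powr (- (k / 2) - 1)"
        unfolding Rk tk[symmetric] by (simp only: mult_ac)
      have "emeasure lborel (cball (fst p) (?R t)) = ennreal (?\<omega> * ?R t ^ k)"
        using t pos by (simp add: emeasure_cball k_def)
      then show ?thesis using True t eq by (simp add: ennreal_mult'[symmetric])
    qed simp
    finally show "(\<integral>\<^sup>+x. ?g (x, t) \<partial>lborel) = ennreal (?\<omega> * (2 * ?s * exp r) powr (k / 2)) *
        (ennreal (t powr (- (k / 2) - 1)) * indicator {?a..} t)" .
  qed
  also have "\<dots> = ennreal (?\<omega> * (2 * ?s * exp r) powr (k / 2)) * ennreal (?a powr (- (k / 2)) / (k / 2))"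
    using nn_integral_powr_tail[OF a, of "k / 2"] k by (subst nn_integral_cmult) auto
  also have "\<dots> = ennreal (?\<omega> * (2 * ?s * exp r) powr (k / 2) * (?a powr (- (k / 2)) / (k / 2)))"
    by (simp add: ennreal_mult'[symmetric])
  also have "?\<omega> * (2 * ?s * exp r) powr (k / 2) * (?a powr (- (k / 2)) / (k / 2)) = \<Gamma> * exp (k * r)"
  proof -
    have "(2 * ?s * exp r) powr (k / 2) = 2 powr (k / 2) * ?s powr (k / 2) * exp (r * (k / 2))"
      using pos by (simp add: powr_mult exp_powr_real)
    moreover have "?a powr (- (k / 2)) = ?s powr (- (k / 2)) * exp (r * (k / 2))"
      using pos by (simp add: powr_mult exp_powr_real)
    moreover have "?s powr (k / 2) * ?s powr (- (k / 2)) = 1" using pos by (simp add: powr_minus)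
    moreover have "exp (r * (k / 2)) * exp (r * (k / 2)) = exp (k * r)"
      unfolding exp_add[symmetric] by (simp add: algebra_simps)
    ultimately have "?\<omega> * (2 * ?s * exp r) powr (k / 2) * (?a powr (- (k / 2)) / (k / 2)) =
        ?\<omega> * (2 / k) * 2 powr (k / 2) * ((?s powr (k / 2) * ?s powr (- (k / 2))) * exp (k * r))"
      by (simp only: mult_ac) (simp add: mult_ac)
    also have "\<dots> = ?\<omega> * (2 / k) * 2 powr (k / 2) * exp (k * r)" using pos by (simp add: powr_minus)
    finally show ?thesis unfolding \<Gamma>_def .
  qed
  finally show ?thesis .
qed

text \<open>The density is positive and the ball contains a Euclidean ball around \<open>p\<close>,
  which has positive Lebesgue measure.\<close>

lemma hyp_ball_volume_pos:
  fixes p :: "'a::euclidean_space \<times> real"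
  assumes p: "p \<in> hyp_space" and r: "0 < r" shows "0 < emeasure hyp_vol (hyp_ball p r)"
proof (rule ccontr)
  let ?U = "{q \<in> hyp_space. hyp_dist p q < r}"
  let ?f = "\<lambda>q :: 'a \<times> real. ennreal (1 / snd q ^ DIM('a \<times> real)) * indicator (hyp_ball p r) q"
  assume "\<not> 0 < emeasure hyp_vol (hyp_ball p r)"
  then have "(\<integral>\<^sup>+q. ?f q \<partial>lborel) = 0"
    using emeasure_hyp_vol[OF hyp_ball_borel[OF p, of r] hyp_ball_subset] r by simp
  moreover have "?f \<in> borel_measurable lborel"
  proof -
    have "(\<lambda>q :: 'a \<times> real. ennreal (1 / snd q ^ DIM('a \<times> real))) \<in> borel_measurable borel"
      by (rule borel_measurable_snd_compose) measurable
    then show ?thesis using hyp_ball_borel[OF p, of r] r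
      by (intro borel_measurable_times_ennreal) auto
  qed
  ultimately have "AE q in lborel. ?f q = 0" by (simp only: nn_integral_0_iff_AE)
  then have "AE q in lborel. q \<notin> hyp_ball p r"
  proof eventually_elim
    case (elim q)
    show ?case
    proof
      assume q: "q \<in> hyp_ball p r"
      then have "0 < snd q" by (simp add: hyp_ball_def hyp_space_def)
      then have "0 < 1 / snd q ^ DIM('a \<times> real)" by simp
      then have "ennreal (1 / snd q ^ DIM('a \<times> real)) \<noteq> 0" by (simp only: ennreal_eq_0_iff not_le)
      with elim q show False by (simp only: indicator_simps mult_1_right)
    qed
  qed
  then have 0: "emeasure lborel (hyp_ball p r) = 0"
    using AE_iff_null_sets[of "hyp_ball p r" lborel] hyp_ball_borel[OF p, of r] r by auto
  have "open ?U" by (rule open_hyp_ball[OF p]) (use r in simp)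
  moreover have "p \<in> ?U" using p r by (simp add: hyp_dist_self)
  ultimately obtain \<epsilon> where \<epsilon>: "0 < \<epsilon>" "ball p \<epsilon> \<subseteq> ?U" by (rule openE)
  have "?U \<subseteq> hyp_ball p r" by (auto simp: hyp_ball_def)
  with \<epsilon>(2) have "ball p \<epsilon> \<subseteq> hyp_ball p r" by (rule order.trans)
  then have "emeasure lborel (ball p \<epsilon>) \<le> emeasure lborel (hyp_ball p r)"
    using hyp_ball_borel[OF p, of r] r by (intro emeasure_mono) auto
  moreover have "0 < emeasure lborel (ball p \<epsilon>)"
    using \<epsilon>(1) by (subst emeasure_ball) auto
  ultimately show False using 0 by simp
qed

section \<open>Discretisation of the Poisson process\<close>

lemma separated_net:
  fixes p :: "'a::euclidean_space \<times> real"
  assumes p: "p \<in> hyp_space" and r: "0 \<le> r" and \<delta>: "0 < \<delta>"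
  obtains I where "I \<subseteq> hyp_ball p r" "finite I" "hyp_separated \<delta> I"
    "\<And>q. q \<in> hyp_ball p r \<Longrightarrow> \<exists>z\<in>I. hyp_dist z q < \<delta>"
proof -
  let ?P = "\<lambda>A. A \<subseteq> hyp_ball p r \<and> hyp_separated \<delta> A"
  obtain m where m: "\<And>A. ?P A \<Longrightarrow> finite A \<and> card A \<le> m"
    using hyp_packing[OF r \<delta>, where 'a='a] p by metis
  have "?P {}" by (simp add: hyp_separated_def)
  moreover have "\<forall>A. ?P A \<longrightarrow> card A < Suc m" using m by (auto simp: less_Suc_eq_le)
  \<comment> \<open>The packing bound limits the cardinality, so a separated set with the largest
    possible number of points exists. A point at distance at least \<delta> from all of it could be
    added, whence the covering property.\<close>
  ultimately obtain I where I: "?P I" and max: "\<And>A. ?P A \<Longrightarrow> card A \<le> card I"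
    using ex_has_greatest_nat[of ?P "{}" card "Suc m"] by blast
  show ?thesis
  proof
    show "I \<subseteq> hyp_ball p r" "finite I" "hyp_separated \<delta> I" using I m by auto
    fix q assume q: "q \<in> hyp_ball p r"
    show "\<exists>z\<in>I. hyp_dist z q < \<delta>"
    proof (rule ccontr)
      assume "\<not> (\<exists>z\<in>I. hyp_dist z q < \<delta>)"
      then have far: "\<And>z. z \<in> I \<Longrightarrow> \<delta> \<le> hyp_dist z q" by force
      then have "q \<notin> I" using far[of q] hyp_dist_self[of q] \<delta> by auto
      moreover have "?P (insert q I)"
      proof
        show "insert q I \<subseteq> hyp_ball p r" using q I by simp
        have "q \<in> hyp_space" using q hyp_ball_subset by blast
        moreover have "\<delta> \<le> hyp_dist x y" if "x \<in> insert q I" "y \<in> insert q I" "x \<noteq> y" for x y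
        proof (cases "x = q")
          case True
          then have "y \<in> I" using that by simp
          then show ?thesis using far[of y] True hyp_dist_commute[of q y] by simp
        next
          case False
          then have "x \<in> I" using that by simp
          then show ?thesis using far[of x] I that by (cases "y = q") (simp_all add: hyp_separated_def)
        qed
        ultimately show "hyp_separated \<delta> (insert q I)"
          using I unfolding hyp_separated_def by (intro conjI ballI impI) simp_all
      qed
      ultimately show False using max[of "insert q I"] I m[of I] by simp
    qed
  qed
qed

text \<open>Cells are required to be nonempty so that each has a representative, through which its
  centre will be chosen.\<close>

definition hyp_partition :: "real \<Rightarrow> ('a::euclidean_space \<times> real) set \<Rightarrow> ('a \<times> real) set set \<Rightarrow> bool" where
  "hyp_partition \<eta> W C \<longleftrightarrow> finite C \<and> \<Union>C = W \<and> disjoint C \<and>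
     (\<forall>c\<in>C. c \<noteq> {} \<and> c \<in> sets borel \<and> (\<forall>x\<in>c. \<forall>y\<in>c. hyp_dist x y < \<eta>))"

text \<open>Two points lie in the same cell iff they lie in the same balls of a finite cover.\<close>

lemma hyp_partition_exists:
  fixes p :: "'a::euclidean_space \<times> real"
  assumes p: "p \<in> hyp_space" and r: "0 \<le> r" and \<eta>: "0 < \<eta>"
  shows "\<exists>C. hyp_partition \<eta> (hyp_ball p r) C"
proof -
  let ?W = "hyp_ball p r"
  obtain F where F: "finite F" "F \<subseteq> ?W" "\<And>q. q \<in> ?W \<Longrightarrow> \<exists>x\<in>F. hyp_dist x q < \<eta> / 2"
    using hyp_ball_finite_cover[OF p r, of "\<eta> / 2"] \<eta> by auto
  define T where "T q = {x\<in>F. hyp_dist x q < \<eta> / 2}" for q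
  define cell where "cell t = {q\<in>?W. T q = t}" for t
  define C where "C = cell ` T ` ?W"
  have Ws: "?W \<subseteq> hyp_space" by (rule hyp_ball_subset)
  have "T ` ?W \<subseteq> Pow F" by (auto simp: T_def)
  then have fin: "finite C" unfolding C_def using F(1) by (auto intro: finite_subset)
  have un: "\<Union>C = ?W" by (auto simp: C_def cell_def)
  have disj: "disjoint C" by (auto simp: disjoint_def C_def cell_def)
  have ne: "c \<noteq> {}" if "c \<in> C" for c using that by (auto simp: C_def cell_def)
  have borel: "c \<in> sets borel" if c: "c \<in> C" for c
  proof -
    obtain q where c: "c = cell (T q)" using c by (auto simp: C_def)
    let ?U = "\<lambda>x. {q \<in> hyp_space. hyp_dist x q < \<eta> / 2}"
    have U: "?U x \<in> sets borel" if "x \<in> F" for x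
      using that F(2) Ws \<eta> by (intro borel_open open_hyp_ball) auto
    have "c = ?W \<inter> (\<Inter>x\<in>T q. ?U x) - (\<Union>x\<in>F - T q. ?U x)"
      using Ws unfolding c cell_def T_def by blast
    \<comment> \<open>Complements turn the intersection into a finite union, for which
      \<open>sets.finite_UN\<close> applies directly.\<close>
    also have "\<dots> = ?W - ((\<Union>x\<in>T q. - ?U x) \<union> (\<Union>x\<in>F - T q. ?U x))" by blast
    also have "\<dots> \<in> sets borel"
    proof (intro sets.Diff sets.Un sets.finite_UN hyp_ball_borel p r)
      show "finite (T q)" "finite (F - T q)" using F(1) by (auto simp: T_def)
      show "- ?U x \<in> sets borel" if "x \<in> T q" for x using U[of x] that by (auto simp: T_def)
      show "?U x \<in> sets borel" if "x \<in> F - T q" for x using U[of x] that by auto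
    qed
    finally show ?thesis .
  qed
  have mesh: "hyp_dist x y < \<eta>" if c: "c \<in> C" and x: "x \<in> c" and y: "y \<in> c" for c x y
  proof -
    have xy: "x \<in> ?W" "y \<in> ?W" "T x = T y" using c x y by (auto simp: C_def cell_def)
    obtain u where u: "u \<in> F" "hyp_dist u x < \<eta> / 2" using F(3)[OF xy(1)] by blast
    then have "u \<in> T y" using xy(3) by (auto simp: T_def)
    then have "hyp_dist u y < \<eta> / 2" by (simp add: T_def)
    moreover have "hyp_dist x y \<le> hyp_dist x u + hyp_dist u y"
      using xy u F(2) Ws by (intro hyp_dist_triangle) auto
    ultimately show ?thesis using u(2) hyp_dist_commute[of x u] by linarith
  qed
  show ?thesis unfolding hyp_partition_def
    by (intro exI[of _ C] conjI ballI fin un disj ne borel mesh; assumption)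
qed

section \<open>Cell counts and the number of isolated points\<close>

definition cell_adj :: "real \<Rightarrow> ('a::euclidean_space \<times> real) set \<Rightarrow> ('a \<times> real) set \<Rightarrow> bool" where
  "cell_adj \<rho> c c' \<longleftrightarrow> (\<exists>x\<in>c. \<exists>y\<in>c'. hyp_dist x y \<le> \<rho>)"

definition cell_count :: "real \<Rightarrow> ('a::euclidean_space \<times> real) set set \<Rightarrow> ('a \<times> real) set \<Rightarrow> real" where
  "cell_count \<rho> C V = (\<Sum>c\<in>C. of_bool (card (V \<inter> c) = 1 \<and>
     (\<forall>c'\<in>C. c' \<noteq> c \<longrightarrow> cell_adj \<rho> c c' \<longrightarrow> card (V \<inter> c') = 0)))"

lemma finite_pos_lower_bound:
  fixes T :: "real set"
  assumes "finite T" "\<And>t. t \<in> T \<Longrightarrow> 0 < t"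
  shows "\<exists>b>0. \<forall>t\<in>T. b \<le> t"
proof (cases "T = {}")
  case False
  then show ?thesis using assms by (intro exI[of _ "Min T"]) auto
qed (auto intro: zero_less_one)

text \<open>A finite configuration has a positive gap \<open>b\<close> below all its distances and
  below the excess over \<open>\<rho>\<close> of those distances that exceed \<open>\<rho>\<close>.
  If the mesh is at most \<open>b / 2\<close>, a cell holds at most one point, and replacing two
  points by others in their cells changes their distance by less than \<open>b\<close>, so occupied
  cells are close exactly if their points are joined. Distances equal to \<open>\<rho>\<close> count
  as joined on both sides.\<close>

lemma cell_count_eq_isolated_count:
  fixes V :: "('a::euclidean_space \<times> real) set"
  assumes V: "finite V" "V \<subseteq> W" and W: "W \<subseteq> hyp_space"
  obtains b where "0 < b" "\<And>\<eta> C. \<eta> \<le> b \<Longrightarrow> hyp_partition \<eta> W C \<Longrightarrow> cell_count \<rho> C V = isolated_count \<rho> V"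
proof -
  define T where "T = (\<lambda>(x, y). hyp_dist x y) ` {(x, y)\<in>V \<times> V. x \<noteq> y} \<union>
      (\<lambda>(x, y). hyp_dist x y - \<rho>) ` {(x, y)\<in>V \<times> V. \<rho> < hyp_dist x y}"
  have Vs: "V \<subseteq> hyp_space" using V W by blast
  have "finite T" unfolding T_def using V(1) by (intro finite_UnI finite_imageI) (auto intro: finite_subset[of _ "V \<times> V"])
  moreover have "0 < t" if "t \<in> T" for t
  proof -
    have "0 < hyp_dist x y" if "x \<in> V" "y \<in> V" "x \<noteq> y" for x y
    proof -
      have "x \<in> hyp_space" "y \<in> hyp_space" using that Vs by blast+
      then show ?thesis using hyp_dist_nonneg[of x y] hyp_dist_eq_0_iff[of x y] that(3) by linarith
    qed
    then show ?thesis using that by (auto simp: T_def)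
  qed
  ultimately have "\<exists>b>0. \<forall>t\<in>T. b \<le> t" by (rule finite_pos_lower_bound)
  then obtain b where b: "0 < b" "\<And>t. t \<in> T \<Longrightarrow> b \<le> t" by blast
  have b1: "b \<le> hyp_dist x y" if "x \<in> V" "y \<in> V" "x \<noteq> y" for x y
    by (rule b(2)) (use that in \<open>force simp: T_def\<close>)
  have b2: "b + \<rho> \<le> hyp_dist x y" if "x \<in> V" "y \<in> V" "\<rho> < hyp_dist x y" for x y
  proof -
    have "hyp_dist x y - \<rho> \<in> T" using that by (force simp: T_def)
    from b(2)[OF this] show ?thesis by linarith
  qed
  show ?thesis
  proof
    show "0 < b / 2" using b(1) by simp
    fix \<eta> C assume \<eta>: "\<eta> \<le> b / 2" and C: "hyp_partition \<eta> W C"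
    have finC: "finite C" and UC: "\<Union>C = W" and disj: "disjoint C"
      and mesh: "\<And>c x y. c \<in> C \<Longrightarrow> x \<in> c \<Longrightarrow> y \<in> c \<Longrightarrow> hyp_dist x y < \<eta>"
      using C unfolding hyp_partition_def by blast+
    have "\<forall>x\<in>V. \<exists>c\<in>C. x \<in> c" using V(2) UC by blast
    then obtain f where f: "\<And>x. x \<in> V \<Longrightarrow> f x \<in> C \<and> x \<in> f x" by metis
    have uniq: "c = f x" if "x \<in> V" "c \<in> C" "x \<in> c" for x c
      using disj f[OF that(1)] that unfolding disjoint_def by blast
    have one: "x = y" if "x \<in> V" "y \<in> V" "c \<in> C" "x \<in> c" "y \<in> c" for x y c
      using b1[OF that(1,2)] mesh[OF that(3-5)] \<eta> b(1) by force
    have Vc: "V \<inter> f x = {x}" if "x \<in> V" for x using one[OF _ that] f[OF that] that by blast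
    have inj: "inj_on f V"
    proof (rule inj_onI)
      fix x y assume xy: "x \<in> V" "y \<in> V" and eq: "f x = f y"
      have "{x} = {y}" using Vc[OF xy(1)] Vc[OF xy(2)] unfolding eq by (rule trans[OF sym])
      then show "x = y" by (rule singleton_inject)
    qed
    let ?iso = "\<lambda>c. card (V \<inter> c) = 1 \<and> (\<forall>c'\<in>C. c' \<noteq> c \<longrightarrow> cell_adj \<rho> c c' \<longrightarrow> card (V \<inter> c') = 0)"
    have iso_iff: "?iso (f x) \<longleftrightarrow> rgg_degree \<rho> V x = 0" if x: "x \<in> V" for x
    proof -
      have deg: "rgg_degree \<rho> V x = 0 \<longleftrightarrow> (\<forall>y\<in>V. x \<noteq> y \<longrightarrow> \<rho> < hyp_dist x y)"
        using V(1) by (auto simp: rgg_degree_def rgg_adj_def not_le)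
      show ?thesis unfolding deg
      proof
        assume iso: "?iso (f x)"
        show "\<forall>y\<in>V. x \<noteq> y \<longrightarrow> \<rho> < hyp_dist x y"
        proof (intro ballI impI, rule ccontr)
          fix y assume y: "y \<in> V" "x \<noteq> y" "\<not> \<rho> < hyp_dist x y"
          have "f y \<noteq> f x" using inj y x by (auto dest: inj_onD)
          moreover have "cell_adj \<rho> (f x) (f y)" using f[OF x] f[OF y(1)] y(3) by (auto simp: cell_adj_def not_less)
          ultimately have "card (V \<inter> f y) = 0" using iso f[OF y(1)] by blast
          then show False using Vc[OF y(1)] by simp
        qed
      next
        assume far: "\<forall>y\<in>V. x \<noteq> y \<longrightarrow> \<rho> < hyp_dist x y"
        show "?iso (f x)"
        proof (intro conjI ballI impI)
          show "card (V \<inter> f x) = 1" using Vc[OF x] by simp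
          fix c' assume c': "c' \<in> C" "c' \<noteq> f x" "cell_adj \<rho> (f x) c'"
          show "card (V \<inter> c') = 0"
          proof (rule ccontr)
            assume "card (V \<inter> c') \<noteq> 0"
            then obtain y where y: "y \<in> V" "y \<in> c'" by (metis Int_iff all_not_in_conv card.empty)
            obtain u w where uw: "u \<in> f x" "w \<in> c'" "hyp_dist u w \<le> \<rho>" using c'(3) by (auto simp: cell_adj_def)
            have "x \<noteq> y" using uniq[OF x c'(1)] c'(2) y(2) by blast
            then have "b + \<rho> \<le> hyp_dist x y" using b2[OF x y(1)] far y(1) by blast
            moreover have sp: "x \<in> hyp_space" "y \<in> hyp_space" "u \<in> hyp_space" "w \<in> hyp_space"
              using x y uw c' f[OF x] Vs UC W by blast+
            moreover have "hyp_dist x y \<le> hyp_dist x u + hyp_dist u y" "hyp_dist u y \<le> hyp_dist u w + hyp_dist w y"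
              using sp by (auto intro!: hyp_dist_triangle)
            moreover have "hyp_dist x u < \<eta>" "hyp_dist w y < \<eta>"
              using mesh f[OF x] uw c'(1) y(2) by blast+
            ultimately show False using uw(3) \<eta> by linarith
          qed
        qed
      qed
    qed
    have "{c\<in>C. ?iso c} = f ` {x\<in>V. rgg_degree \<rho> V x = 0}"
    proof (intro equalityI subsetI)
      fix c assume c: "c \<in> {c\<in>C. ?iso c}"
      then have "card (V \<inter> c) = 1" by blast
      then obtain x where "x \<in> V" "x \<in> c" by (metis Int_iff card_1_singletonE insertI1)
      then have "x \<in> V" "c = f x" using uniq c by blast+
      then show "c \<in> f ` {x\<in>V. rgg_degree \<rho> V x = 0}" using c iso_iff by blast
    next
      fix c assume "c \<in> f ` {x\<in>V. rgg_degree \<rho> V x = 0}"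
      then show "c \<in> {c\<in>C. ?iso c}" using iso_iff f by blast
    qed
    moreover have "inj_on f {x\<in>V. rgg_degree \<rho> V x = 0}" using inj by (rule inj_on_subset) auto
    ultimately have "card {c\<in>C. ?iso c} = card {x\<in>V. rgg_degree \<rho> V x = 0}" by (simp only: card_image)
    moreover have "cell_count \<rho> C V = card {c\<in>C. ?iso c}"
      unfolding cell_count_def using finC by (simp add: sum.If_cases of_bool_def Int_def)
    ultimately show "cell_count \<rho> C V = isolated_count \<rho> V" by (simp add: isolated_count_def)
  qed
qed

section \<open>From the Poisson measure to the cell model\<close>

lemma (in prob_space) indep_sets_reindex:
  assumes g: "inj_on g C" and F: "indep_sets F (g ` C)"
  shows "indep_sets (\<lambda>c. F (g c)) C"
  unfolding indep_sets_def
proof (intro conjI ballI allI impI)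
  fix c assume "c \<in> C"
  then show "F (g c) \<subseteq> events" using F by (auto simp: indep_sets_def)
next
  fix J A assume J: "J \<subseteq> C" "J \<noteq> {}" "finite J" and A: "A \<in> (\<Pi> c\<in>J. F (g c))"
  define A' where "A' i = A (inv_into C g i)" for i
  have A': "A' (g c) = A c" if "c \<in> J" for c using that J(1) g by (auto simp: A'_def)
  have gJ: "inj_on g J" using g J(1) by (rule inj_on_subset)
  have "A' \<in> Pi (g ` J) F" using A A' by auto
  then have "prob (\<Inter>i\<in>g ` J. A' i) = (\<Prod>i\<in>g ` J. prob (A' i))"
    using F J by (intro indep_setsD[where I="g ` C"]) auto
  also have "(\<Prod>i\<in>g ` J. prob (A' i)) = (\<Prod>c\<in>J. prob (A c))"
    using A' by (simp add: prod.reindex[OF gJ])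
  also have "(\<Inter>i\<in>g ` J. A' i) = (\<Inter>c\<in>J. A c)" using A' by auto
  finally show "prob (\<Inter>c\<in>J. A c) = (\<Prod>c\<in>J. prob (A c))" .
qed

text \<open>The Poisson measure is specified by independence along disjoint sequences. A finite
  family of cells is made into such a sequence by numbering it injectively and putting the empty set
  at all other indices.\<close>

lemma (in prob_space) indep_vars_finite_disjoint:
  assumes indep: "\<And>A :: nat \<Rightarrow> 'b set. range A \<subseteq> S \<Longrightarrow> disjoint_family A \<Longrightarrow>
      indep_vars (\<lambda>_. count_space UNIV) (\<lambda>i \<omega>. Y (A i) \<omega>) UNIV"
    and C: "finite C" "C \<subseteq> S" "disjoint C" and S: "{} \<in> S"
  shows "indep_vars (\<lambda>_. count_space UNIV) (\<lambda>c \<omega>. Y c \<omega>) C"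
proof -
  obtain g :: "'b set \<Rightarrow> nat" where g: "inj_on g C" using finite_imp_inj_to_nat_seg[OF C(1)] by blast
  define A where "A i = (if i \<in> g ` C then inv_into C g i else {})" for i
  have Ag: "A (g c) = c" if "c \<in> C" for c using that g by (simp add: A_def)
  have "range A \<subseteq> S" using C(2) S by (auto simp: A_def inv_into_into subset_iff)
  moreover have "disjoint_family A"
    unfolding disjoint_family_on_def
  proof (intro ballI impI)
    fix i j :: nat assume ij: "i \<noteq> j"
    show "A i \<inter> A j = {}"
    proof (cases "i \<in> g ` C \<and> j \<in> g ` C")
      case True
      then obtain c c' where "c \<in> C" "i = g c" "c' \<in> C" "j = g c'" by blast
      moreover from this have "c \<noteq> c'" using ij by blast
      ultimately show ?thesis using Ag disjointD[OF C(3), of c c'] by simp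
    qed (auto simp: A_def)
  qed
  ultimately have "indep_vars (\<lambda>_. count_space UNIV) (\<lambda>i \<omega>. Y (A i) \<omega>) UNIV" by (rule indep)
  then have "indep_vars (\<lambda>_. count_space UNIV) (\<lambda>i \<omega>. Y (A i) \<omega>) (g ` C)"
    by (rule indep_vars_subset) simp
  then have "indep_vars (\<lambda>_. count_space UNIV) (\<lambda>c \<omega>. Y (A (g c)) \<omega>) C"
    unfolding indep_vars_def2 using indep_sets_reindex[OF g] by auto
  also have "?this \<longleftrightarrow> ?thesis"
    using Ag by (intro indep_vars_cong) auto
  finally show ?thesis .
qed

text \<open>Mesh and net have scale \<rho>/4, so a centre is within \<rho>/2 of every point of its
  cells. Hence cells of one centre are adjacent, adjacent cells have centres at distance at most
  \<rho>/2 + \<rho> + \<rho>/2 = 2 \<rho>, and the cells of one centre lie in a ball of radius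
  \<rho>. Degrees are thus packing numbers of balls of radius 2 \<rho>.\<close>

lemma poisson_cells_hyp_partition:
  fixes p :: "'a::euclidean_space \<times> real" and M :: "'w measure"
  defines "rep \<equiv> \<lambda>c :: ('a \<times> real) set. SOME x. x \<in> c"
  assumes p: "p \<in> hyp_space" and \<rho>: "0 < \<rho>" and r: "0 < r"
    and P: "poisson_measure M (restrict_space hyp_vol (hyp_ball p r)) P"
    and I: "I \<subseteq> hyp_ball p r" "finite I" "hyp_separated (\<rho> / 4) I"
      "\<And>q. q \<in> hyp_ball p r \<Longrightarrow> \<exists>z\<in>I. hyp_dist z q < \<rho> / 4"
    and C: "hyp_partition (\<rho> / 4) (hyp_ball p r) C"
    and d: "\<And>q A. (q :: 'a \<times> real) \<in> hyp_space \<Longrightarrow> hyp_separated (\<rho> / 4) A \<Longrightarrow> A \<subseteq> hyp_ball q (2 * \<rho>) \<Longrightarrow>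
        finite A \<and> card A \<le> d"
    and K: "\<And>q. (q :: 'a \<times> real) \<in> hyp_space \<Longrightarrow> measure hyp_vol (hyp_ball q \<rho>) \<le> K"
  shows "poisson_cells M C (\<lambda>c \<omega>. card (P \<omega> \<inter> c)) (measure hyp_vol) (cell_adj \<rho>)
      (\<lambda>c. SOME z. z \<in> I \<and> hyp_dist z (rep c) < \<rho> / 4) I (\<lambda>z z'. hyp_dist z z' \<le> 2 * \<rho>) d K"
    and "(\<Sum>c\<in>C. measure hyp_vol c) = measure hyp_vol (hyp_ball p r)"
proof -
  let ?W = "hyp_ball p r"
  let ?\<nu> = "restrict_space hyp_vol ?W"
  define \<kappa> where "\<kappa> c = (SOME z. z \<in> I \<and> hyp_dist z (rep c) < \<rho> / 4)" for c
  have Ws: "?W \<subseteq> hyp_space" by (rule hyp_ball_subset)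
  have Wb: "?W \<in> sets borel" using p r by (intro hyp_ball_borel) auto
  have Wv: "?W \<in> sets hyp_vol" using Ws Wb by (simp add: sets_hyp_vol)
  have sets_\<nu>: "A \<in> sets ?\<nu> \<longleftrightarrow> A \<in> sets borel \<and> A \<subseteq> ?W" for A
    using Wv Ws by (subst sets_restrict_space_iff) (auto simp: space_hyp_vol sets_hyp_vol Int_absorb2)
  have \<nu>_eq: "measure ?\<nu> A = measure hyp_vol A" if "A \<subseteq> ?W" for A
    using that Wv Ws by (intro measure_restrict_space) (auto simp: space_hyp_vol Int_absorb2)
  interpret prob_space M using P by (simp add: poisson_measure_def)
  interpret N: finite_measure ?\<nu> using P by (simp add: poisson_measure_def)
  have fin_P: "finite (P \<omega>)" if "\<omega> \<in> space M" for \<omega> using P that by (simp add: poisson_measure_def)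
  have law: "prob {\<omega>\<in>space M. card (P \<omega> \<inter> A) = k} =
      measure ?\<nu> A ^ k / fact k * exp (- measure ?\<nu> A)" if "A \<in> sets ?\<nu>" for A k
    using P that unfolding poisson_measure_def by blast
  have indep: "indep_vars (\<lambda>_. count_space UNIV) (\<lambda>i \<omega>. card (P \<omega> \<inter> A i)) UNIV"
    if "range A \<subseteq> sets ?\<nu>" "disjoint_family A" for A :: "nat \<Rightarrow> ('a \<times> real) set"
    using P that unfolding poisson_measure_def by blast
  have finC: "finite C" and UC: "\<Union>C = ?W" and disj: "disjoint C"
    and ne: "\<And>c. c \<in> C \<Longrightarrow> c \<noteq> {}" and bor: "\<And>c. c \<in> C \<Longrightarrow> c \<in> sets borel"
    and mesh: "\<And>c x y. c \<in> C \<Longrightarrow> x \<in> c \<Longrightarrow> y \<in> c \<Longrightarrow> hyp_dist x y < \<rho> / 4"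
    using C unfolding hyp_partition_def by blast+
  have CW: "c \<subseteq> ?W" if "c \<in> C" for c using that UC by blast
  have C_sets: "C \<subseteq> sets ?\<nu>" using bor CW by (auto simp: sets_\<nu>)
  have sum_measure: "(\<Sum>c\<in>A. measure hyp_vol c) = measure hyp_vol (\<Union>A)" "\<Union>A \<in> sets ?\<nu>" if A: "A \<subseteq> C" for A
  proof -
    have fA: "finite A" using A finC by (rule finite_subset)
    have "measure ?\<nu> (\<Union>c\<in>A. c) = (\<Sum>c\<in>A. measure ?\<nu> c)"
    proof (rule N.finite_measure_finite_Union[OF fA])
      show "disjoint_family_on (\<lambda>c. c) A"
        unfolding disjoint_family_on_def using A by (intro ballI impI disjointD[OF disj]) auto
    qed (use A C_sets in auto)
    moreover have "(\<Sum>c\<in>A. measure ?\<nu> c) = (\<Sum>c\<in>A. measure hyp_vol c)"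
      using A CW by (intro sum.cong refl \<nu>_eq) auto
    moreover have "measure ?\<nu> (\<Union>A) = measure hyp_vol (\<Union>A)" using A CW by (intro \<nu>_eq) auto
    ultimately show "(\<Sum>c\<in>A. measure hyp_vol c) = measure hyp_vol (\<Union>A)" by simp
    show "\<Union>A \<in> sets ?\<nu>" using fA A C_sets by (intro sets.finite_Union) auto
  qed
  have sum_card: "(\<Sum>c\<in>A. card (P \<omega> \<inter> c)) = card (P \<omega> \<inter> \<Union>A)" if A: "A \<subseteq> C" and \<omega>: "\<omega> \<in> space M" for A \<omega>
  proof -
    have "card (\<Union>c\<in>A. P \<omega> \<inter> c) = (\<Sum>c\<in>A. card (P \<omega> \<inter> c))"
      using finite_subset[OF A finC] fin_P[OF \<omega>] disj A
      by (intro card_UN_disjoint) (auto simp: disjoint_def)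
    moreover have "(\<Union>c\<in>A. P \<omega> \<inter> c) = P \<omega> \<inter> \<Union>A" by blast
    ultimately show ?thesis by simp
  qed
  have prob_count: "prob {\<omega>\<in>space M. (\<Sum>c\<in>A. card (P \<omega> \<inter> c)) = k} =
      (\<Sum>c\<in>A. measure hyp_vol c) ^ k / fact k * exp (- (\<Sum>c\<in>A. measure hyp_vol c))" if A: "A \<subseteq> C" for A k
  proof -
    have "{\<omega>\<in>space M. (\<Sum>c\<in>A. card (P \<omega> \<inter> c)) = k} = {\<omega>\<in>space M. card (P \<omega> \<inter> \<Union>A) = k}"
      using sum_card[OF A] by auto
    moreover have "measure ?\<nu> (\<Union>A) = measure hyp_vol (\<Union>A)" using A CW by (intro \<nu>_eq) auto
    ultimately show ?thesis using law[OF sum_measure(2)[OF A]] sum_measure(1)[OF A] by simp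
  qed
  have rep: "rep c \<in> c" if "c \<in> C" for c using ne[OF that] unfolding rep_def by (rule some_in_eq[THEN iffD2])
  have repW: "rep c \<in> ?W" if "c \<in> C" for c using rep[OF that] CW[OF that] by blast
  have \<kappa>: "\<kappa> c \<in> I \<and> hyp_dist (\<kappa> c) (rep c) < \<rho> / 4" if "c \<in> C" for c
    unfolding \<kappa>_def by (rule someI_ex) (use I(4)[OF repW[OF that]] in blast)
  have IS: "z \<in> hyp_space" if "z \<in> I" for z using that I(1) Ws by blast
  have \<kappa>_near: "hyp_dist (\<kappa> c) x < \<rho> / 2" if "c \<in> C" "x \<in> c" for c x
  proof -
    have "hyp_dist (\<kappa> c) x \<le> hyp_dist (\<kappa> c) (rep c) + hyp_dist (rep c) x"
    proof (rule hyp_dist_triangle)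
      show "\<kappa> c \<in> hyp_space" using \<kappa>[OF that(1)] IS by blast
      show "rep c \<in> hyp_space" using repW[OF that(1)] Ws by blast
      show "x \<in> hyp_space" using CW[OF that(1)] that(2) Ws by blast
    qed
    then show ?thesis using \<kappa>[OF that(1)] mesh[OF that(1) rep[OF that(1)] that(2)] by linarith
  qed
  have "poisson_cells M C (\<lambda>c \<omega>. card (P \<omega> \<inter> c)) (measure hyp_vol) (cell_adj \<rho>) \<kappa> I (\<lambda>z z'. hyp_dist z z' \<le> 2 * \<rho>) d K"
  proof unfold_locales
    show "finite C" by (rule finC)
    show "finite I" by (rule I)
    show "\<kappa> c \<in> I" if "c \<in> C" for c using \<kappa>[OF that] by blast
    show "indep_vars (\<lambda>_. count_space UNIV) (\<lambda>c \<omega>. card (P \<omega> \<inter> c)) C"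
      by (rule indep_vars_finite_disjoint[where S="sets ?\<nu>" and Y="\<lambda>c \<omega>. card (P \<omega> \<inter> c)"])
         (use indep finC C_sets disj in auto)
    show "0 \<le> measure hyp_vol c" for c :: "('a \<times> real) set" by simp
    show "prob {\<omega>\<in>space M. (\<Sum>c\<in>A. card (P \<omega> \<inter> c)) = 0} = exp (- (\<Sum>c\<in>A. measure hyp_vol c))" if "A \<subseteq> C" for A
      using prob_count[OF that, of 0] by simp
    show "prob {\<omega>\<in>space M. (\<Sum>c\<in>A. card (P \<omega> \<inter> c)) = 1} =
        (\<Sum>c\<in>A. measure hyp_vol c) * exp (- (\<Sum>c\<in>A. measure hyp_vol c))" if "A \<subseteq> C" for A
      using prob_count[OF that, of 1] by simp
    show "cell_adj \<rho> c c'" if c: "c \<in> C" and c': "c' \<in> C" and eq: "\<kappa> c = \<kappa> c'" for c c'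
    proof -
      have "hyp_dist (rep c) (rep c') \<le> hyp_dist (rep c) (\<kappa> c) + hyp_dist (\<kappa> c) (rep c')"
      proof (rule hyp_dist_triangle)
        show "rep c \<in> hyp_space" "rep c' \<in> hyp_space" using repW c c' Ws by blast+
        show "\<kappa> c \<in> hyp_space" using \<kappa>[OF c] IS by blast
      qed
      also have "\<dots> \<le> \<rho>" using \<kappa>_near[OF c rep[OF c]] \<kappa>_near[OF c' rep[OF c']] eq hyp_dist_commute[of "rep c"] by simp
      finally show ?thesis using rep[OF c] rep[OF c'] unfolding cell_adj_def by blast
    qed
    show "cell_adj \<rho> c' c" if "cell_adj \<rho> c c'" for c c' :: "('a \<times> real) set"
      using that unfolding cell_adj_def by (metis hyp_dist_commute)
    show "hyp_dist z z \<le> 2 * \<rho>" for z :: "'a \<times> real" using \<rho> by (simp add: hyp_dist_self)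
    show "hyp_dist z' z \<le> 2 * \<rho>" if "hyp_dist z z' \<le> 2 * \<rho>" for z z' :: "'a \<times> real"
      using that by (simp add: hyp_dist_commute)
    show "hyp_dist (\<kappa> c) (\<kappa> c') \<le> 2 * \<rho>" if c: "c \<in> C" and c': "c' \<in> C" and adj: "cell_adj \<rho> c c'" for c c'
    proof -
      obtain x y where xy: "x \<in> c" "y \<in> c'" "hyp_dist x y \<le> \<rho>" using adj by (auto simp: cell_adj_def)
      have sp: "x \<in> hyp_space" "y \<in> hyp_space" "\<kappa> c \<in> hyp_space" "\<kappa> c' \<in> hyp_space"
        using xy CW[OF c] CW[OF c'] Ws \<kappa>[OF c] \<kappa>[OF c'] IS by blast+
      have "hyp_dist (\<kappa> c) (\<kappa> c') \<le> hyp_dist (\<kappa> c) x + hyp_dist x (\<kappa> c')"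
        by (rule hyp_dist_triangle[OF sp(3,1,4)])
      moreover have "hyp_dist x (\<kappa> c') \<le> hyp_dist x y + hyp_dist y (\<kappa> c')"
        by (rule hyp_dist_triangle[OF sp(1,2,4)])
      ultimately show ?thesis
        using xy(3) \<kappa>_near[OF c xy(1)] \<kappa>_near[OF c' xy(2)] hyp_dist_commute[of y] by simp
    qed
    show "card {z'\<in>I. hyp_dist z z' \<le> 2 * \<rho>} \<le> d" if "z \<in> I" for z
    proof -
      have "hyp_separated (\<rho> / 4) {z'\<in>I. hyp_dist z z' \<le> 2 * \<rho>}" using I(3) by (simp add: hyp_separated_def subset_iff)
      moreover have "{z'\<in>I. hyp_dist z z' \<le> 2 * \<rho>} \<subseteq> hyp_ball z (2 * \<rho>)" using IS by (auto simp: hyp_ball_def)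
      ultimately show ?thesis using d[OF IS[OF that]] by blast
    qed
    show "(\<Sum>c\<in>{c\<in>C. \<kappa> c = z}. measure hyp_vol c) \<le> K" if z: "z \<in> I" for z
    proof -
      let ?A = "{c\<in>C. \<kappa> c = z}"
      have "(\<Sum>c\<in>?A. measure hyp_vol c) = measure hyp_vol (\<Union>?A)" by (rule sum_measure) auto
      also have "\<dots> \<le> measure hyp_vol (hyp_ball z \<rho>)"
      proof (rule measure_mono_fmeasurable)
        show "\<Union>?A \<subseteq> hyp_ball z \<rho>"
        proof
          fix x assume "x \<in> \<Union>?A"
          then obtain c where c: "c \<in> C" "\<kappa> c = z" "x \<in> c" by blast
          then have "x \<in> hyp_space" using CW Ws by blast
          moreover have "hyp_dist z x \<le> \<rho>" using \<kappa>_near[OF c(1,3)] c(2) \<rho> by simp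
          ultimately show "x \<in> hyp_ball z \<rho>" by (simp add: hyp_ball_def)
        qed
        have "\<Union>?A \<in> sets ?\<nu>" by (rule sum_measure) auto
        then show "\<Union>?A \<in> sets hyp_vol" using Ws by (auto simp: sets_\<nu> sets_hyp_vol)
        show "hyp_ball z \<rho> \<in> fmeasurable hyp_vol"
        proof (rule fmeasurableI)
          show "hyp_ball z \<rho> \<in> sets hyp_vol"
            using hyp_ball_borel[OF IS[OF z], of \<rho>] \<rho> hyp_ball_subset[of z \<rho>] by (simp add: sets_hyp_vol)
          show "emeasure hyp_vol (hyp_ball z \<rho>) < \<infinity>"
            using hyp_ball_volume[OF IS[OF z], of \<rho>] \<rho> by (auto intro: le_less_trans)
        qed
      qed
      also have "\<dots> \<le> K" by (rule K[OF IS[OF z]])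
      finally show ?thesis .
    qed
    have "(\<Sum>c\<in>C. measure hyp_vol c) = measure hyp_vol ?W" using sum_measure(1)[of C] UC by simp
    moreover have "0 < measure hyp_vol ?W"
      using hyp_ball_volume_pos[OF p r] hyp_ball_volume[OF p, of r] r
      by (auto simp: measure_def enn2real_positive_iff intro: le_less_trans)
    ultimately show "0 < (\<Sum>c\<in>C. measure hyp_vol c)" by simp
  qed
  then show "poisson_cells M C (\<lambda>c \<omega>. card (P \<omega> \<inter> c)) (measure hyp_vol) (cell_adj \<rho>)
      (\<lambda>c. SOME z. z \<in> I \<and> hyp_dist z (rep c) < \<rho> / 4) I (\<lambda>z z'. hyp_dist z z' \<le> 2 * \<rho>) d K"
    unfolding \<kappa>_def .
  show "(\<Sum>c\<in>C. measure hyp_vol c) = measure hyp_vol ?W" using sum_measure(1)[of C] UC by simp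
qed

section \<open>Passage to the limit of vanishing mesh\<close>

lemma (in prob_space) normal_approximation_limit:
  fixes X :: "nat \<Rightarrow> 'a \<Rightarrow> real" and Y :: "'a \<Rightarrow> real"
  assumes meas [measurable]: "\<And>m. X m \<in> borel_measurable M"
    and bound: "\<And>m \<omega>. \<omega> \<in> space M \<Longrightarrow> \<bar>X m \<omega>\<bar> \<le> B"
    and ev: "\<And>\<omega>. \<omega> \<in> space M \<Longrightarrow> \<forall>\<^sub>F m in sequentially. X m \<omega> = Y \<omega>"
    and var_ge: "\<And>m. a \<le> variance (X m)" and var_le: "\<And>m. variance (X m) \<le> b" and a: "0 < a"
    and kol: "\<And>m t. \<bar>prob {\<omega>\<in>space M. (X m \<omega> - expectation (X m)) / sqrt (variance (X m)) \<le> t} - Phi t\<bar>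
        \<le> k / sqrt (variance (X m))"
    and lip: "\<And>m h. (\<And>y z. \<bar>h y - h z\<bar> \<le> \<bar>y - z\<bar>) \<Longrightarrow>
        \<bar>expectation (\<lambda>\<omega>. h ((X m \<omega> - expectation (X m)) / sqrt (variance (X m)))) - Nint h\<bar>
        \<le> k / sqrt (variance (X m))"
  shows "Y \<in> borel_measurable M" and "a \<le> variance Y" and "variance Y \<le> b"
    and "\<bar>prob {\<omega>\<in>space M. (Y \<omega> - expectation Y) / sqrt (variance Y) \<le> t} - Phi t\<bar> \<le> k / sqrt (variance Y)"
    and "(\<And>y z. \<bar>h y - h z\<bar> \<le> \<bar>y - z\<bar>) \<Longrightarrow>
        \<bar>expectation (\<lambda>\<omega>. h ((Y \<omega> - expectation Y) / sqrt (variance Y))) - Nint h\<bar> \<le> k / sqrt (variance Y)"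
proof -
  have lim: "(\<lambda>m. X m \<omega>) \<longlonglongrightarrow> Y \<omega>" if "\<omega> \<in> space M" for \<omega>
    using ev[OF that] by (rule tendsto_eventually)
  show Ym [measurable]: "Y \<in> borel_measurable M"
    by (rule borel_measurable_LIMSEQ_real[OF lim meas])
  have Yb: "\<bar>Y \<omega>\<bar> \<le> B" if \<omega>: "\<omega> \<in> space M" for \<omega>
  proof -
    obtain m where "X m \<omega> = Y \<omega>" using eventually_happens[OF ev[OF \<omega>]] by auto
    then show ?thesis using bound[OF \<omega>, of m] by simp
  qed
  \<comment> \<open>Uniform bounds and pointwise convergence carry means, variances and test
    functions to the limit; the lower bound \<open>a\<close> keeps the normalising factors away from
    0.\<close>
  have dominated: "(\<lambda>m. expectation (F m)) \<longlonglongrightarrow> expectation G"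
    if dom: "\<And>m. F m \<in> borel_measurable M" "G \<in> borel_measurable M"
      "\<And>\<omega>. \<omega> \<in> space M \<Longrightarrow> (\<lambda>m. F m \<omega>) \<longlonglongrightarrow> G \<omega>"
      "\<exists>L. \<forall>m. \<forall>\<omega>\<in>space M. \<bar>F m \<omega>\<bar> \<le> L"
    for F :: "nat \<Rightarrow> 'a \<Rightarrow> real" and G :: "'a \<Rightarrow> real"
  proof -
    obtain L where "\<And>m \<omega>. \<omega> \<in> space M \<Longrightarrow> \<bar>F m \<omega>\<bar> \<le> L" using dom(4) by blast
    then show ?thesis
      by (intro integral_dominated_convergence[where w="\<lambda>_. L"]) (use dom in auto)
  qed
  have iX: "integrable M (X m)" for m by (rule integrable_const_bound[where B=B]) (use bound in auto)
  have iY: "integrable M Y" by (rule integrable_const_bound[where B=B]) (use Yb in auto)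
  have sq: "(y :: real)\<^sup>2 \<le> B\<^sup>2" if "\<bar>y\<bar> \<le> B" for y
    using that by (simp add: abs_le_square_iff[symmetric])
  have iX2: "integrable M (\<lambda>\<omega>. (X m \<omega>)\<^sup>2)" for m
    by (rule integrable_const_bound[where B="B\<^sup>2"]) (use bound sq in auto)
  have iY2: "integrable M (\<lambda>\<omega>. (Y \<omega>)\<^sup>2)"
    by (rule integrable_const_bound[where B="B\<^sup>2"]) (use Yb sq in auto)
  define \<mu> where "\<mu> = expectation Y"
  define v where "v = variance Y"
  define \<mu>' where "\<mu>' m = expectation (X m)" for m
  define v' where "v' m = variance (X m)" for m
  have \<mu>_lim: "\<mu>' \<longlonglongrightarrow> \<mu>"
    unfolding \<mu>_def \<mu>'_def by (rule dominated) (use lim bound in \<open>auto intro!: exI[of _ B]\<close>)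
  have "(\<lambda>m. expectation (\<lambda>\<omega>. (X m \<omega>)\<^sup>2)) \<longlonglongrightarrow> expectation (\<lambda>\<omega>. (Y \<omega>)\<^sup>2)"
    by (rule dominated) (use lim bound sq in \<open>auto intro!: tendsto_intros exI[of _ "B\<^sup>2"]\<close>)
  then have "(\<lambda>m. expectation (\<lambda>\<omega>. (X m \<omega>)\<^sup>2) - (\<mu>' m)\<^sup>2) \<longlonglongrightarrow> expectation (\<lambda>\<omega>. (Y \<omega>)\<^sup>2) - \<mu>\<^sup>2"
    by (intro tendsto_intros \<mu>_lim)
  then have v_lim: "v' \<longlonglongrightarrow> v"
    unfolding v_def v'_def \<mu>_def \<mu>'_def variance_eq[OF iX iX2] variance_eq[OF iY iY2] .
  have v'_ge: "a \<le> v' m" for m using var_ge by (simp add: v'_def)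
  have v_ge: "a \<le> v" using v_lim v'_ge by (intro LIMSEQ_le_const[OF v_lim]) auto
  then show "a \<le> variance Y" by (simp add: v_def)
  have "v \<le> b" using var_le by (intro LIMSEQ_le_const2[OF v_lim]) (auto simp: v'_def)
  then show "variance Y \<le> b" by (simp add: v_def)
  have v_pos: "0 < v" using v_ge a by linarith
  have s_lim: "(\<lambda>m. sqrt (v' m)) \<longlonglongrightarrow> sqrt v" by (intro tendsto_intros v_lim)
  have k_lim: "(\<lambda>m. k / sqrt (v' m)) \<longlonglongrightarrow> k / sqrt v" using v_pos by (intro tendsto_intros s_lim) auto
  have "\<bar>prob {\<omega>\<in>space M. (Y \<omega> - \<mu>) / sqrt v \<le> t} - Phi t\<bar> \<le> k / sqrt v"
  proof -
    \<comment> \<open>The mean and the variance vary with \<open>m\<close>, so the threshold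
      \<open>s\<close> is fixed for the unnormalised variables: the indicators then become
      eventually constant at each sample point. The variation moves into the thresholds
      \<open>t' m\<close>, which tend to \<open>t\<close>, and \<open>Phi\<close> is
      Lipschitz.\<close>
    define s where "s = \<mu> + sqrt v * t"
    define t' where "t' m = (s - \<mu>' m) / sqrt (v' m)" for m
    have prob_eq: "prob {\<omega>\<in>space M. (Z \<omega> - c) / e \<le> (s - c) / e} = expectation (\<lambda>\<omega>. indicat_real {..s} (Z \<omega>))"
      if [measurable]: "Z \<in> borel_measurable M" and "0 < e" for Z and c e :: real
    proof -
      have "expectation (\<lambda>\<omega>. indicat_real {..s} (Z \<omega>)) = expectation (indicat_real {\<omega>\<in>space M. (Z \<omega> - c) / e \<le> (s - c) / e})"
        using \<open>0 < e\<close> by (intro Bochner_Integration.integral_cong) (auto simp: indicator_def divide_le_cancel)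
      also have "\<dots> = prob {\<omega>\<in>space M. (Z \<omega> - c) / e \<le> (s - c) / e}" by simp
      finally show ?thesis by simp
    qed
    have t_eq: "t = (s - \<mu>) / sqrt v" using v_pos by (simp add: s_def)
    have t_lim: "t' \<longlonglongrightarrow> t" unfolding t'_def t_eq using v_pos by (intro tendsto_intros \<mu>_lim s_lim) auto
    have Phi_lip: "\<bar>Phi y - Phi z\<bar> \<le> \<bar>y - z\<bar>" for y z
    proof -
      have "Phi y \<le> Phi z" if "y \<le> z" for y z
      proof -
        interpret N: prob_space std_normal_distribution by (rule prob_space_normal_density) simp
        show ?thesis unfolding Phi_def using that by (intro N.finite_measure_mono) auto
      qed
      from this[of y z] this[of z y] show ?thesis
        using Phi_increment[of y z] Phi_increment[of z y] by linarith
    qed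
    have "(\<lambda>m. \<bar>t' m - t\<bar>) \<longlonglongrightarrow> 0" using t_lim by (simp add: LIM_zero tendsto_rabs_zero)
    then have "(\<lambda>m. Phi (t' m) - Phi t) \<longlonglongrightarrow> 0"
      by (rule Lim_null_comparison[rotated]) (use Phi_lip in auto)
    then have Phi_lim: "(\<lambda>m. Phi (t' m)) \<longlonglongrightarrow> Phi t" by (rule LIM_zero_cancel)
    have "(\<lambda>m. expectation (\<lambda>\<omega>. indicat_real {..s} (X m \<omega>))) \<longlonglongrightarrow> expectation (\<lambda>\<omega>. indicat_real {..s} (Y \<omega>))"
    proof (rule dominated)
      show "(\<lambda>m. indicat_real {..s} (X m \<omega>)) \<longlonglongrightarrow> indicat_real {..s} (Y \<omega>)" if "\<omega> \<in> space M" for \<omega>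
        by (rule tendsto_eventually) (use ev[OF that] in \<open>auto elim: eventually_mono\<close>)
    qed (auto simp: indicator_def intro!: exI[of _ 1])
    then have "(\<lambda>m. \<bar>expectation (\<lambda>\<omega>. indicat_real {..s} (X m \<omega>)) - Phi (t' m)\<bar>)
        \<longlonglongrightarrow> \<bar>expectation (\<lambda>\<omega>. indicat_real {..s} (Y \<omega>)) - Phi t\<bar>"
      by (intro tendsto_intros Phi_lim)
    moreover have "\<bar>expectation (\<lambda>\<omega>. indicat_real {..s} (X m \<omega>)) - Phi (t' m)\<bar> \<le> k / sqrt (v' m)" for m
      using kol[of m "t' m"] prob_eq[OF meas, of "sqrt (v' m)" m "\<mu>' m"] v'_ge[of m] a
      by (simp add: t'_def \<mu>'_def v'_def)
    ultimately have "\<bar>expectation (\<lambda>\<omega>. indicat_real {..s} (Y \<omega>)) - Phi t\<bar> \<le> k / sqrt v"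
      using k_lim by (intro LIMSEQ_le) auto
    then show ?thesis using prob_eq[OF Ym, of "sqrt v" \<mu>] v_pos by (simp add: t_eq)
  qed
  then show "\<bar>prob {\<omega>\<in>space M. (Y \<omega> - expectation Y) / sqrt (variance Y) \<le> t} - Phi t\<bar> \<le> k / sqrt (variance Y)"
    by (simp only: \<mu>_def v_def)
  assume hl: "\<And>y z. \<bar>h y - h z\<bar> \<le> \<bar>y - z\<bar>"
  have hc: "continuous_on UNIV h"
    by (rule lipschitz_on_continuous_on[where L=1]) (use hl in \<open>auto simp: lipschitz_on_def dist_real_def\<close>)
  have [measurable]: "h \<in> borel_measurable borel" using hc by (rule borel_measurable_continuous_onI)
  have "(\<lambda>m. expectation (\<lambda>\<omega>. h ((X m \<omega> - \<mu>' m) / sqrt (v' m)))) \<longlonglongrightarrow> expectation (\<lambda>\<omega>. h ((Y \<omega> - \<mu>) / sqrt v))"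
  proof (rule dominated)
    fix \<omega> assume \<omega>: "\<omega> \<in> space M"
    have "(\<lambda>m. (X m \<omega> - \<mu>' m) / sqrt (v' m)) \<longlonglongrightarrow> (Y \<omega> - \<mu>) / sqrt v"
      using v_pos by (intro tendsto_intros lim[OF \<omega>] \<mu>_lim s_lim) auto
    then show "(\<lambda>m. h ((X m \<omega> - \<mu>' m) / sqrt (v' m))) \<longlonglongrightarrow> h ((Y \<omega> - \<mu>) / sqrt v)"
      using hc by (intro isCont_tendsto_compose[where g=h]) (auto simp: continuous_on_eq_continuous_at)
  next
    have bd: "\<bar>h ((X m \<omega> - \<mu>' m) / sqrt (v' m))\<bar> \<le> \<bar>h 0\<bar> + 2 * B / sqrt a" if \<omega>: "\<omega> \<in> space M" for m \<omega>
    proof -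
      have "\<bar>\<mu>' m\<bar> \<le> B"
      proof -
        have "\<bar>\<mu>' m\<bar> \<le> expectation (\<lambda>\<omega>. \<bar>X m \<omega>\<bar>)" unfolding \<mu>'_def by (rule integral_abs_bound)
        also have "\<dots> \<le> B" using iX bound by (intro integral_le_const) auto
        finally show ?thesis .
      qed
      then have "\<bar>X m \<omega> - \<mu>' m\<bar> \<le> 2 * B" using bound[OF \<omega>, of m] by linarith
      moreover have "sqrt a \<le> sqrt (v' m)" using v'_ge by simp
      ultimately have "\<bar>(X m \<omega> - \<mu>' m) / sqrt (v' m)\<bar> \<le> 2 * B / sqrt a"
        unfolding abs_divide using a by (intro frac_le) auto
      then show "\<bar>h ((X m \<omega> - \<mu>' m) / sqrt (v' m))\<bar> \<le> \<bar>h 0\<bar> + 2 * B / sqrt a"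
        using hl[of "(X m \<omega> - \<mu>' m) / sqrt (v' m)" 0] by linarith
    qed
    then show "\<exists>L. \<forall>m. \<forall>\<omega>\<in>space M. \<bar>h ((X m \<omega> - \<mu>' m) / sqrt (v' m))\<bar> \<le> L" by blast
  qed measurable
  then have "(\<lambda>m. \<bar>expectation (\<lambda>\<omega>. h ((X m \<omega> - \<mu>' m) / sqrt (v' m))) - Nint h\<bar>)
      \<longlonglongrightarrow> \<bar>expectation (\<lambda>\<omega>. h ((Y \<omega> - \<mu>) / sqrt v)) - Nint h\<bar>"
    by (intro tendsto_intros)
  then have "\<bar>expectation (\<lambda>\<omega>. h ((Y \<omega> - \<mu>) / sqrt v)) - Nint h\<bar> \<le> k / sqrt v"
    using k_lim lip[OF hl] by (intro LIMSEQ_le) (auto simp: \<mu>'_def v'_def)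
  then show "\<bar>expectation (\<lambda>\<omega>. h ((Y \<omega> - expectation Y) / sqrt (variance Y))) - Nint h\<bar> \<le> k / sqrt (variance Y)"
    by (simp only: \<mu>_def v_def)
qed

lemma hyp_partition_mono: "hyp_partition \<eta> W C \<Longrightarrow> \<eta> \<le> \<eta>' \<Longrightarrow> hyp_partition \<eta>' W C"
  unfolding hyp_partition_def by (meson less_le_trans)

text \<open>The centres are chosen once, and only the partition is refined. So \<open>d\<close>,
  \<open>K\<close>, the volume and the bound \<open>card I\<close> on the cell counts are the same
  for all meshes, and the estimates survive the limit.\<close>

lemma isolated_count_normal_approximation:
  fixes p :: "'a::euclidean_space \<times> real" and M :: "'w measure" and d :: nat and K \<rho> r :: real
  defines "D \<equiv> real d ^ 6" and "a \<equiv> exp (- (2 * d + 1) * K) / (4 * d)"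
  assumes p: "p \<in> hyp_space" and \<rho>: "0 < \<rho>" and r: "0 < r"
    and P: "poisson_measure M (restrict_space hyp_vol (hyp_ball p r)) P"
    and d: "\<And>q A. (q :: 'a \<times> real) \<in> hyp_space \<Longrightarrow> hyp_separated (\<rho> / 4) A \<Longrightarrow> A \<subseteq> hyp_ball q (2 * \<rho>) \<Longrightarrow>
        finite A \<and> card A \<le> d"
    and K: "\<And>q. (q :: 'a \<times> real) \<in> hyp_space \<Longrightarrow> measure hyp_vol (hyp_ball q \<rho>) \<le> K"
  defines "H \<equiv> \<lambda>\<omega>. isolated_count \<rho> (P \<omega>)" and "n \<equiv> measure hyp_vol (hyp_ball p r)"
  defines "V \<equiv> prob_space.variance M H"
  shows "H \<in> borel_measurable M" and "0 < V" and "V \<le> 2 * D * n"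
    and "\<bar>measure M {\<omega>\<in>space M. (H \<omega> - integral\<^sup>L M H) / sqrt V \<le> t} - Phi t\<bar> \<le> clt_const D a / sqrt V"
    and "(\<And>y z. \<bar>h y - h z\<bar> \<le> \<bar>y - z\<bar>) \<Longrightarrow>
      \<bar>(\<integral>\<omega>. h ((H \<omega> - integral\<^sup>L M H) / sqrt V) \<partial>M) - Nint h\<bar> \<le> clt_const D a / sqrt V"
proof -
  let ?W = "hyp_ball p r"
  interpret prob_space M using P by (simp add: poisson_measure_def)
  have r0: "0 \<le> r" and \<rho>4: "0 < \<rho> / 4" using r \<rho> by auto
  obtain I where I: "I \<subseteq> ?W" "finite I" "hyp_separated (\<rho> / 4) I"
      "\<And>q. q \<in> ?W \<Longrightarrow> \<exists>z\<in>I. hyp_dist z q < \<rho> / 4"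
    by (rule separated_net[OF p r0 \<rho>4]) (rule that)
  \<comment> \<open>The mesh tends to 0 but never exceeds \<open>\<rho> / 4\<close>, as the cell
    model requires.\<close>
  define \<eta> where "\<eta> m = \<rho> / 4 / real (Suc m)" for m
  have \<eta>: "0 < \<eta> m" "\<eta> m \<le> \<rho> / 4" for m
  proof -
    show "0 < \<eta> m" using \<rho> by (simp add: \<eta>_def)
    have "\<rho> / 4 / real (Suc m) \<le> \<rho> / 4 / 1" using \<rho> by (intro divide_left_mono) auto
    then show "\<eta> m \<le> \<rho> / 4" by (simp add: \<eta>_def)
  qed
  have "\<forall>m. \<exists>C. hyp_partition (\<eta> m) ?W C" using hyp_partition_exists[OF p r0] \<eta>(1) by blast
  then obtain C where C: "\<And>m. hyp_partition (\<eta> m) ?W (C m)" by metis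
  define X where "X m \<omega> = cell_count \<rho> (C m) (P \<omega>)" for m \<omega>
  have cells: "X m \<in> borel_measurable M \<and> (\<forall>\<omega>. \<bar>X m \<omega>\<bar> \<le> card I) \<and> 0 < a * n \<and> a * n \<le> variance (X m) \<and>
      variance (X m) \<le> 2 * D * n \<and>
      (\<forall>t. \<bar>prob {\<omega>\<in>space M. (X m \<omega> - expectation (X m)) / sqrt (variance (X m)) \<le> t} - Phi t\<bar>
        \<le> clt_const D a / sqrt (variance (X m))) \<and>
      (\<forall>h. (\<forall>y z. \<bar>h y - h z\<bar> \<le> \<bar>y - z\<bar>) \<longrightarrow>
        \<bar>expectation (\<lambda>\<omega>. h ((X m \<omega> - expectation (X m)) / sqrt (variance (X m)))) - Nint h\<bar>
        \<le> clt_const D a / sqrt (variance (X m)))" for m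
  proof -
    note part = hyp_partition_mono[OF C[of m] \<eta>(2)]
    interpret PC: poisson_cells M "C m" "\<lambda>c \<omega>. card (P \<omega> \<inter> c)" "measure hyp_vol" "cell_adj \<rho>"
      "\<lambda>c. SOME z. z \<in> I \<and> hyp_dist z (SOME x. x \<in> c) < \<rho> / 4" I "\<lambda>z z'. hyp_dist z z' \<le> 2 * \<rho>" d K
      by (rule poisson_cells_hyp_partition(1)[OF p \<rho> r P I part d K])
    have n: "PC.n = n"
      unfolding PC.n_def n_def by (rule poisson_cells_hyp_partition(2)[OF p \<rho> r P I part d K])
    have a: "PC.var_const = a" by (simp add: PC.var_const_def a_def)
    have X: "PC.H (\<lambda>c. card (P \<omega> \<inter> c)) = X m \<omega>" for \<omega>
      by (simp add: X_def cell_count_def PC.H_def PC.iso_def)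
    have \<mu>: "PC.\<mu> = expectation (X m)" unfolding PC.\<mu>_def PC.E_def X ..
    have "\<bar>PC.H z\<bar> \<le> card I" for z
    proof -
      have "0 \<le> PC.H z" unfolding PC.H_eq by (intro sum_nonneg PC.X_range)
      moreover have "PC.H z \<le> (\<Sum>i\<in>I. 1)" unfolding PC.H_eq by (intro sum_mono PC.X_range)
      ultimately show ?thesis by simp
    qed
    then have "\<forall>\<omega>. \<bar>X m \<omega>\<bar> \<le> card I" unfolding X[symmetric] by blast
    moreover have "X m \<in> borel_measurable M" using PC.meas[OF PC.dep_H] unfolding X .
    moreover have "0 < a * n"
      using PC.var_const_pos PC.vol_pos unfolding a[symmetric] n[symmetric] PC.n_def by simp
    ultimately show ?thesis
      using PC.normal_approximation unfolding X \<mu> n a D_def[symmetric] by blast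
  qed
  have Pw: "finite (P \<omega>)" "P \<omega> \<subseteq> ?W" if "\<omega> \<in> space M" for \<omega>
    using P that by (auto simp: poisson_measure_def space_restrict_space)
  have ev: "\<forall>\<^sub>F m in sequentially. X m \<omega> = H \<omega>" if \<omega>: "\<omega> \<in> space M" for \<omega>
  proof -
    obtain b where b: "0 < b" "\<And>\<eta> C. \<eta> \<le> b \<Longrightarrow> hyp_partition \<eta> ?W C \<Longrightarrow> cell_count \<rho> C (P \<omega>) = isolated_count \<rho> (P \<omega>)"
      using cell_count_eq_isolated_count[OF Pw[OF \<omega>] hyp_ball_subset] by blast
    have "\<eta> \<longlonglongrightarrow> 0" unfolding \<eta>_def by real_asymp
    then have "\<forall>\<^sub>F m in sequentially. \<eta> m < b" using b(1) by (rule order_tendstoD)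
    then show ?thesis
    proof eventually_elim
      case (elim m)
      then show ?case unfolding X_def H_def by (intro b(2)[OF _ C]) simp
    qed
  qed
  note limit = normal_approximation_limit[of X "card I" H "a * n" "2 * D * n" "clt_const D a", OF _ _ ev]
  show "H \<in> borel_measurable M" by (rule limit(1)) (use cells in blast)+
  have "a * n \<le> V" unfolding V_def by (rule limit(2)) (use cells in blast)+
  then show "0 < V" using cells by force
  show "V \<le> 2 * D * n" unfolding V_def by (rule limit(3)) (use cells in blast)+
  show "\<bar>prob {\<omega>\<in>space M. (H \<omega> - expectation H) / sqrt V \<le> t} - Phi t\<bar> \<le> clt_const D a / sqrt V"
    unfolding V_def by (rule limit(4)) (use cells in blast)+
  show "\<bar>expectation (\<lambda>\<omega>. h ((H \<omega> - expectation H) / sqrt V)) - Nint h\<bar> \<le> clt_const D a / sqrt V"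
    if "\<And>y z. \<bar>h y - h z\<bar> \<le> \<bar>y - z\<bar>"
    unfolding V_def by (rule limit(5)) (use cells that in blast)+
qed

section \<open>The two distances and the conclusion\<close>

lemma (in prob_space) kolmogorov_dist_standardized_le:
  assumes X: "X \<in> borel_measurable M"
    and "\<And>t. \<bar>prob {\<omega>\<in>space M. (X \<omega> - expectation X) / sqrt (variance X) \<le> t} - Phi t\<bar> \<le> b"
  shows "kolmogorov_dist (standardized_law M X) std_normal_distribution \<le> b"
  unfolding kolmogorov_dist_def
proof (rule cSUP_least)
  fix t :: real
  let ?f = "\<lambda>\<omega>. (X \<omega> - expectation X) / sqrt (variance X)"
  have "measure (standardized_law M X) {..t} = prob (?f -` {..t} \<inter> space M)"
    unfolding standardized_law_def using X by (intro measure_distr) auto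
  also have "?f -` {..t} \<inter> space M = {\<omega>\<in>space M. ?f \<omega> \<le> t}" by auto
  finally show "\<bar>measure (standardized_law M X) {..t} - measure std_normal_distribution {..t}\<bar> \<le> b"
    using assms(2)[of t] by (simp add: Phi_def)
qed simp

lemma (in prob_space) wasserstein_dist_standardized_le:
  assumes X: "X \<in> borel_measurable M"
    and "\<And>h. (\<And>y z. \<bar>h y - h z\<bar> \<le> \<bar>y - z\<bar>) \<Longrightarrow>
      \<bar>expectation (\<lambda>\<omega>. h ((X \<omega> - expectation X) / sqrt (variance X))) - Nint h\<bar> \<le> b"
  shows "wasserstein_dist (standardized_law M X) std_normal_distribution \<le> ennreal b"
  unfolding wasserstein_dist_def
proof (rule SUP_least)
  fix h :: "real \<Rightarrow> real" assume "h \<in> {h. 1-lipschitz_on UNIV h}"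
  then have h: "1-lipschitz_on UNIV h" by simp
  then have [measurable]: "h \<in> borel_measurable borel"
    by (intro borel_measurable_continuous_onI lipschitz_on_continuous_on)
  let ?f = "\<lambda>\<omega>. (X \<omega> - expectation X) / sqrt (variance X)"
  have "(\<integral>x. h x \<partial>standardized_law M X) = expectation (\<lambda>\<omega>. h (?f \<omega>))"
    unfolding standardized_law_def using X by (intro integral_distr) auto
  moreover have "\<bar>expectation (\<lambda>\<omega>. h (?f \<omega>)) - Nint h\<bar> \<le> b"
    using lipschitz_onD[OF h] by (intro assms(2)) (simp add: dist_real_def)
  ultimately show "ennreal \<bar>(\<integral>x. h x \<partial>standardized_law M X) - Nint h\<bar> \<le> ennreal b"
    by (simp add: ennreal_leI)
qed

text \<open>The volume bound serves twice: for the window and, at radius \<rho>, as the bound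
  \<open>K\<close> on the volume attached to a centre. Both distances are bounded by the same rate;
  the Wasserstein bound follows by adding the nonnegative second summand.\<close>

theorem corollary5p4:
  shows "(\<forall>p \<in> (hyp_space :: ('a::euclidean_space \<times> real) set). \<forall>\<rho>>0. \<exists>C>0. \<forall>R\<ge>2.
            \<forall>(M :: 'w measure) (P :: 'w \<Rightarrow> ('a \<times> real) set).
              poisson_measure M (restrict_space hyp_vol (hyp_ball p R)) P \<longrightarrow>
              (let H = (\<lambda>\<omega>. isolated_count \<rho> (P \<omega>));
                   V = prob_space.variance M H;
                   vol = measure hyp_vol (hyp_ball p R)
               in kolmogorov_dist (standardized_law M H) std_normal_distribution
                    \<le> C * (sqrt vol / V) \<and>
                  wasserstein_dist (standardized_law M H) std_normal_distribution
                    \<le> ennreal (C * (sqrt vol / V) + C * (vol / V powr (3/2)))))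
         \<and>
         (\<exists>\<Gamma>>0. \<forall>p \<in> (hyp_space :: ('a \<times> real) set). \<forall>R\<ge>2.
            emeasure hyp_vol (hyp_ball p R)
              \<le> ennreal (\<Gamma> * exp ((real DIM('a \<times> real) - 1) * R)))"
proof (intro conjI ballI allI impI)
  let ?k = "DIM('a)"
  define \<Gamma> where "\<Gamma> = unit_ball_vol ?k * (2 / ?k) * 2 powr (?k / 2)"
  have vol: "emeasure hyp_vol (hyp_ball q r) \<le> ennreal (\<Gamma> * exp (?k * r))"
    if "q \<in> hyp_space" "0 \<le> r" for q :: "'a \<times> real" and r :: real
    unfolding \<Gamma>_def by (rule hyp_ball_volume[OF that])
  show "\<exists>\<Gamma>>0. \<forall>p \<in> (hyp_space :: ('a \<times> real) set). \<forall>R\<ge>2.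
      emeasure hyp_vol (hyp_ball p R) \<le> ennreal (\<Gamma> * exp ((real DIM('a \<times> real) - 1) * R))"
  proof (intro exI[of _ \<Gamma>] conjI ballI allI impI)
    show "0 < \<Gamma>" by (simp add: \<Gamma>_def)
  qed (use vol in simp)
  fix p :: "'a \<times> real" and \<rho> :: real assume p: "p \<in> hyp_space" and \<rho>: "0 < \<rho>"
  obtain d :: nat where d: "\<And>q A. (q :: 'a \<times> real) \<in> hyp_space \<Longrightarrow> hyp_separated (\<rho> / 4) A \<Longrightarrow>
      A \<subseteq> hyp_ball q (2 * \<rho>) \<Longrightarrow> finite A \<and> card A \<le> d"
    using hyp_packing[of "2 * \<rho>" "\<rho> / 4", where 'a='a] \<rho> by auto
  define K where "K = \<Gamma> * exp (?k * \<rho>)"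
  have K: "measure hyp_vol (hyp_ball q \<rho>) \<le> K" if "q \<in> hyp_space" for q :: "'a \<times> real"
  proof -
    have "0 \<le> K" by (simp add: K_def \<Gamma>_def)
    then show ?thesis using vol[OF that, of \<rho>] \<rho> by (simp add: measure_def K_def enn2real_leI)
  qed
  define D where "D = real d ^ 6"
  define k where "k = clt_const D (exp (- (2 * d + 1) * K) / (4 * d))"
  \<comment> \<open>The factor \<open>sqrt (2 * D)\<close> comes from comparing the variance with
    the volume; the absolute value and the added 1 make \<open>C\<close> positive without a
    discussion of the sign of \<open>k\<close>.\<close>
  define C where "C = \<bar>k\<bar> * sqrt (2 * D) + 1"
  have C: "0 < C" by (simp add: C_def D_def add_nonneg_pos)
  show "\<exists>C>0. \<forall>R\<ge>2. \<forall>(M :: 'w measure) (P :: 'w \<Rightarrow> ('a \<times> real) set).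
      poisson_measure M (restrict_space hyp_vol (hyp_ball p R)) P \<longrightarrow>
      (let H = (\<lambda>\<omega>. isolated_count \<rho> (P \<omega>));
           V = prob_space.variance M H;
           vol = measure hyp_vol (hyp_ball p R)
       in kolmogorov_dist (standardized_law M H) std_normal_distribution
            \<le> C * (sqrt vol / V) \<and>
          wasserstein_dist (standardized_law M H) std_normal_distribution
            \<le> ennreal (C * (sqrt vol / V) + C * (vol / V powr (3/2))))"
  proof (intro exI[of _ C] conjI allI impI C)
    fix R :: real and M :: "'w measure" and P assume R: "2 \<le> R"
      and P: "poisson_measure M (restrict_space hyp_vol (hyp_ball p R)) P"
    define H where "H = (\<lambda>\<omega>. isolated_count \<rho> (P \<omega>))"
    define n where "n = measure hyp_vol (hyp_ball p R)"
    interpret prob_space M using P by (simp add: poisson_measure_def)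
    have R0: "0 < R" using R by simp
    note approx = isolated_count_normal_approximation[where d=d and K=K, OF p \<rho> R0 P]
    have Hm: "H \<in> borel_measurable M"
      unfolding H_def by (rule approx(1)) (erule (2) d, erule K)
    have V: "0 < variance H"
      unfolding H_def by (rule approx(2)) (erule (2) d, erule K)
    have Vn: "variance H \<le> 2 * D * n"
      unfolding H_def n_def D_def by (rule approx(3)) (erule (2) d, erule K)
    have kol: "\<bar>prob {\<omega>\<in>space M. (H \<omega> - expectation H) / sqrt (variance H) \<le> t} - Phi t\<bar> \<le> k / sqrt (variance H)" for t
      unfolding H_def k_def D_def by (rule approx(4)) (erule (2) d, erule K)
    have lip: "\<bar>expectation (\<lambda>\<omega>. h ((H \<omega> - expectation H) / sqrt (variance H))) - Nint h\<bar> \<le> k / sqrt (variance H)"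
      if "\<And>y z. \<bar>h y - h z\<bar> \<le> \<bar>y - z\<bar>" for h
      unfolding H_def k_def D_def by (rule approx(5)) (erule (2) d, erule K, rule that)
    \<comment> \<open>1 / sqrt V = sqrt V / V, and V \<le> 2 D n is inserted in the
      numerator.\<close>
    have rate: "k / sqrt (variance H) \<le> C * (sqrt n / variance H)"
    proof -
      have "k / sqrt (variance H) = k * sqrt (variance H) / variance H"
      proof -
        have "sqrt (variance H) * sqrt (variance H) = variance H" using V by simp
        moreover have "sqrt (variance H) \<noteq> 0" using V by simp
        ultimately show ?thesis by (metis mult_divide_mult_cancel_right)
      qed
      also have "\<dots> \<le> \<bar>k\<bar> * sqrt (2 * D * n) / variance H"
        using V Vn by (intro divide_right_mono mult_mono) auto
      also have "\<dots> = \<bar>k\<bar> * sqrt (2 * D) * (sqrt n / variance H)" by (simp add: real_sqrt_mult)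
      also have "\<dots> \<le> C * (sqrt n / variance H)"
        using V by (intro mult_right_mono) (auto simp: C_def n_def)
      finally show ?thesis .
    qed
    have "kolmogorov_dist (standardized_law M H) std_normal_distribution \<le> C * (sqrt n / variance H)"
      using Hm order.trans[OF kol rate] by (rule kolmogorov_dist_standardized_le)
    moreover have "wasserstein_dist (standardized_law M H) std_normal_distribution
        \<le> ennreal (C * (sqrt n / variance H) + C * (n / variance H powr (3/2)))"
    proof -
      have "0 \<le> C * (n / variance H powr (3/2))" using C by (simp add: n_def)
      then have "C * (sqrt n / variance H) \<le> C * (sqrt n / variance H) + C * (n / variance H powr (3/2))" by simp
      from order.trans[OF rate this] show ?thesis
        by (intro wasserstein_dist_standardized_le Hm) (rule order.trans[OF lip])
    qed
    ultimately show "let H = (\<lambda>\<omega>. isolated_count \<rho> (P \<omega>));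
           V = prob_space.variance M H;
           vol = measure hyp_vol (hyp_ball p R)
       in kolmogorov_dist (standardized_law M H) std_normal_distribution
            \<le> C * (sqrt vol / V) \<and>
          wasserstein_dist (standardized_law M H) std_normal_distribution
            \<le> ennreal (C * (sqrt vol / V) + C * (vol / V powr (3/2)))"
      unfolding Let_def H_def n_def by blast
  qed
qed

end
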